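(* Let $R$ be a ring. The relations $\leq_{\mathrm{pp}}^{\lambda}$, for $\lambda$ an infinite cardinal, are cofinal in the poset of relations $\preccurlyeq$ on $R\text{-}\mathrm{Mod}$ (the class of all $R$-modules) such that $\preccurlyeq$ refines direct summands, $(R\text{-}\mathrm{Mod},\preccurlyeq)$ is a $\mu$-AEC for some infinite regular cardinal $\mu$, and $(R\text{-}\mathrm{Mod},\preccurlyeq)$ has strong coherence; that is, for every such $\preccurlyeq$ there is an infinite cardinal $\lambda$ such that $\preccurlyeq$ refines $\leq_{\mathrm{pp}}^{\lambda}$ (i.e. $A\leq_{\mathrm{pp}}^{\lambda}B$ implies $A\preccurlyeq B$ for all $R$-modules $A,B$). In particular, for every such $\preccurlyeq$, $(R\text{-}\mathrm{Mod},\preccurlyeq)$ is almost stable, and if in addition $(R\text{-}\mathrm{Mod},\preccurlyeq)$ has $\infty$-AP, then it is stable.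
   Context: $R$ is an associative ring with identity; modules are unital left modules. $A\leq_\oplus B$ means $A$ is a direct summand of $B$. For $R$-modules $A\leq B$, $A\leq_{\mathrm{pp}}^{\lambda}B$ ($A$ is $\lambda$-pure in $B$) means that every system of fewer than $\lambda$ $R$-linear equations with parameters in $A$ that has a solution in $B$ has a solution in $A$. A relation $\preccurlyeq$ on $R\text{-}\mathrm{Mod}$ refines direct summands if $A\leq_\oplus B$ implies $A\preccurlyeq B$. Abstract classes. An abstract class (AC) is a pair $\mathcal{K}=(\mathbf{K},\preccurlyeq)$ where $\mathbf{K}$ is a non-empty class of structures in a fixed language $\tau$ (here the language of $R$-modules: $0,+,-$ and a unary function symbol for each $r\in R$) and $\preccurlyeq$ is a reflexive transitive relation on $\mathbf{K}$ such that $M\preccurlyeq N$ implies $M\leq N$ ($M$ is a substructure of $N$), closed under isomorphism: if $f:N\to N'$ is an isomorphism and $N\in\mathbf{K}$ then $N'\in\mathbf{K}$, and if moreover $M\in\mathbf{K}$ and $M\preccurlyeq N$ then $f(M)\in\mathbf{K}$ and $f(M)\preccurlyeq N'$. A $\mathcal{K}$-embedding is an embedding $f:M\to N$ with $M,N\in\mathbf{K}$ and $f(M)\preccurlyeq N$. $\mathcal{K}$ has strong coherence if $A,B,C\in\mathbf{K}$, $A\leq B\leq C$ and $A\preccurlyeq C$ imply $A\preccurlyeq B$. $\mu$-AECs. A poset is $\mu$-directed if each subset of cardinality $<\mu$ has an upper bound. A $\mu$-directed system in $\mathcal{K}$ is a family $(M_i\mid i\in I)$ of members of $\mathbf{K}$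 with $I$ a $\mu$-directed poset and $M_i\preccurlyeq M_j$ whenever $i<j$. An AC $\mathcal{K}$ is a $\mu$-AEC if: (coherence) $M_0,M_1,M_2\in\mathbf{K}$, $M_0\preccurlyeq M_2$ and $M_0\leq M_1\preccurlyeq M_2$ imply $M_0\preccurlyeq M_1$; ($\mu$-continuity) for each $\mu$-directed system $(M_i)_{i\in I}$ in $\mathcal{K}$, $M=\bigcup_i M_i\in\mathbf{K}$ and $M_i\preccurlyeq M$ for all $i$; ($\mu$-smoothness) if $N\in\mathbf{K}$ and $(M_i)_{i\in I}$ is a $\mu$-directed system in $\mathcal{K}$ with all $M_i\preccurlyeq N$ and $M=\bigcup_i M_i\in\mathbf{K}$, then $M\preccurlyeq N$; (Löwenheim-Skolem) there is a cardinal $\theta=\theta^{<\mu}\geq|\tau|+\mu$ such that for all $M\in\mathbf{K}$ and $A\subseteq M$ there is $M_0\in\mathbf{K}$ with $A\subseteq M_0\preccurlyeq M$ and $|M_0|\leq|A|^{<\mu}+\theta$. Here $\theta^{<\mu}=\sup\{\theta^{\eta}\mid\eta<\mu\}$. Orbital types. For triples $(b_\ell,A,N_\ell)$ with $A\subseteq N_\ell\in\mathbf{K}$ and $b_\ell\in N_\ell$ ($\ell=1,2$), put $(b_1,A,N_1)E^{\mathrm{at}}(b_2,A,N_2)$ if there are $\mathcal{K}$-embeddings $f_\ell:N_\ell\to N$ with $f_1(b_1)=f_2(b_2)$ and $f_1\restriction A=f_2\restriction A=\mathrm{id}_A$; let $E$ be the transitive closure of $E^{\mathrm{at}}$, and let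 $\mathrm{ortp}(b/A;N)$ be the $E$-class of $(b,A,N)$. For $M\preccurlyeq N$ let $\mathcal{S}(M;N)=\{\mathrm{ortp}(c/M;N)\mid c\in N\}$ and $\mathcal{S}(M)=\bigcup_{M\preccurlyeq N\in\mathbf{K}}\mathcal{S}(M;N)$. $\mathcal{K}$ is stable if for unboundedly many infinite cardinals $\kappa$ one has $|\mathcal{S}(M)|\leq\kappa$ for each $M\in\mathbf{K}$ with $|M|=\kappa$; it is almost stable if for unboundedly many infinite cardinals $\kappa$ one has $|\mathcal{S}(M;N)|\leq\kappa$ for all $M\preccurlyeq N$ in $\mathbf{K}$ with $|M|=\kappa$. Amalgamation. $\mathcal{K}$ has $\infty$-AP if for every (set-indexed) collection of $\mathcal{K}$-embeddings $(f_i:M\to M_i\mid i\in I)$ there are $N\in\mathbf{K}$ and $\mathcal{K}$-embeddings $g_i:M_i\to N$ with $g_if_i=g_jf_j$ for all $i,j\in I$. *)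

theory Defs
  imports "HOL-Algebra.Module"
begin

unbundle cardinal_syntax

text \<open>
  Sets are modelled inside a Grothendieck universe: the type \<open>'u\<close> will be assumed to have
  strongly inaccessible cardinality, a ``set'' is a subset of \<open>'u\<close> of smaller cardinality, and a
  ``(proper) class'' is an arbitrary collection of structures carried by such sets. Correspondingly
  a cardinal is a cardinal order \<open>\<kappa> :: 'u rel\<close> with \<open>\<kappa> <o |UNIV|\<close>; cardinals are compared up to
  \<open>=o\<close>.
\<close>

definition strongly_inaccessible :: "'u rel \<Rightarrow> bool" where
  "strongly_inaccessible \<kappa> \<longleftrightarrow>
     Card_order \<kappa> \<and> natLeq <o \<kappa> \<and> regularCard \<kappa> \<and>
     (\<forall>A :: 'u set. |A| <o \<kappa> \<longrightarrow> |Pow A| <o \<kappa>)"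

definition small :: "'u set \<Rightarrow> bool" where
  "small A \<longleftrightarrow> |A| <o |UNIV :: 'u set|"

definition cardinal :: "'u rel \<Rightarrow> bool" where
  "cardinal \<kappa> \<longleftrightarrow> Card_order \<kappa> \<and> \<kappa> <o |UNIV :: 'u set|"

definition infinite_cardinal :: "'u rel \<Rightarrow> bool" where
  "infinite_cardinal \<kappa> \<longleftrightarrow> cardinal \<kappa> \<and> cinfinite \<kappa>"

text \<open>\<open>\<rho> = \<kappa>\<^bsup><\<mu>\<^esup> = sup {\<kappa>\<^bsup>\<eta>\<^esup> | \<eta> < \<mu>}\<close>; the supremum is determined up to \<open>=o\<close>.\<close>

definition is_weak_power :: "'u rel \<Rightarrow> 'u rel \<Rightarrow> 'u rel \<Rightarrow> bool" where
  "is_weak_power \<kappa> \<mu> \<rho> \<longleftrightarrow>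
     Card_order \<rho> \<and>
     (\<forall>\<eta> :: 'u rel. Card_order \<eta> \<and> \<eta> <o \<mu> \<longrightarrow> \<kappa> ^c \<eta> \<le>o \<rho>) \<and>
     (\<forall>\<sigma> :: 'u rel. Card_order \<sigma> \<and>
        (\<forall>\<eta> :: 'u rel. Card_order \<eta> \<and> \<eta> <o \<mu> \<longrightarrow> \<kappa> ^c \<eta> \<le>o \<sigma>) \<longrightarrow> \<rho> \<le>o \<sigma>)"


section \<open>Modules\<close>

text \<open>
  The library's locale \<open>module\<close> requires a commutative ring. The fields \<open>mult\<close> and \<open>one\<close> of the
  record representing a module, and the values of its operations outside of the carrier, carry no
  meaning. Structures that differ only there are isomorphic by the identity, so everything below
  that is closed under isomorphism is insensitive to them.
\<close>

locale left_module = R?: ring R + M?: abelian_group M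
  for R :: "('r, 'x) ring_scheme" (structure) and M :: "('r, 'u) module" (structure) +
  assumes smult_closed:
      "\<lbrakk>a \<in> carrier R; x \<in> carrier M\<rbrakk> \<Longrightarrow> a \<odot>\<^bsub>M\<^esub> x \<in> carrier M"
    and smult_l_distr:
      "\<lbrakk>a \<in> carrier R; b \<in> carrier R; x \<in> carrier M\<rbrakk> \<Longrightarrow>
       (a \<oplus>\<^bsub>R\<^esub> b) \<odot>\<^bsub>M\<^esub> x = a \<odot>\<^bsub>M\<^esub> x \<oplus>\<^bsub>M\<^esub> b \<odot>\<^bsub>M\<^esub> x"
    and smult_r_distr:
      "\<lbrakk>a \<in> carrier R; x \<in> carrier M; y \<in> carrier M\<rbrakk> \<Longrightarrow>
       a \<odot>\<^bsub>M\<^esub> (x \<oplus>\<^bsub>M\<^esub> y) = a \<odot>\<^bsub>M\<^esub> x \<oplus>\<^bsub>M\<^esub> a \<odot>\<^bsub>M\<^esub> y"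
    and smult_assoc:
      "\<lbrakk>a \<in> carrier R; b \<in> carrier R; x \<in> carrier M\<rbrakk> \<Longrightarrow>
       (a \<otimes>\<^bsub>R\<^esub> b) \<odot>\<^bsub>M\<^esub> x = a \<odot>\<^bsub>M\<^esub> (b \<odot>\<^bsub>M\<^esub> x)"
    and smult_one:
      "x \<in> carrier M \<Longrightarrow> \<one>\<^bsub>R\<^esub> \<odot>\<^bsub>M\<^esub> x = x"

definition R_Mod :: "('r, 'x) ring_scheme \<Rightarrow> ('r, 'u) module set" where
  "R_Mod R = {M. left_module R M \<and> small (carrier M)}"

text \<open>Compatibility with zero and with negation follows, both structures being modules.\<close>

definition is_submodule ::
  "('r, 'x) ring_scheme \<Rightarrow> ('r, 'u) module \<Rightarrow> ('r, 'u) module \<Rightarrow> bool" where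
  "is_submodule R M N \<longleftrightarrow>
     left_module R M \<and> left_module R N \<and> carrier M \<subseteq> carrier N \<and>
     (\<forall>x\<in>carrier M. \<forall>y\<in>carrier M. x \<oplus>\<^bsub>M\<^esub> y = x \<oplus>\<^bsub>N\<^esub> y) \<and>
     (\<forall>r\<in>carrier R. \<forall>x\<in>carrier M. r \<odot>\<^bsub>M\<^esub> x = r \<odot>\<^bsub>N\<^esub> x)"

definition direct_summand ::
  "('r, 'x) ring_scheme \<Rightarrow> ('r, 'u) module \<Rightarrow> ('r, 'u) module \<Rightarrow> bool" where
  "direct_summand R A B \<longleftrightarrow>
     is_submodule R A B \<and>
     (\<exists>C. is_submodule R C B \<and> carrier A \<inter> carrier C = {\<zero>\<^bsub>B\<^esub>} \<and>
          carrier B = {a \<oplus>\<^bsub>B\<^esub> c | a c. a \<in> carrier A \<and> c \<in> carrier C})"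

definition left_module_hom ::
  "('r, 'x) ring_scheme \<Rightarrow> ('r, 'u) module \<Rightarrow> ('r, 'u) module \<Rightarrow> ('u \<Rightarrow> 'u) set" where
  "left_module_hom R M N =
     {f. f \<in> carrier M \<rightarrow> carrier N \<and>
         (\<forall>x\<in>carrier M. \<forall>y\<in>carrier M. f (x \<oplus>\<^bsub>M\<^esub> y) = f x \<oplus>\<^bsub>N\<^esub> f y) \<and>
         (\<forall>r\<in>carrier R. \<forall>x\<in>carrier M. f (r \<odot>\<^bsub>M\<^esub> x) = r \<odot>\<^bsub>N\<^esub> f x)}"

definition left_module_iso ::
  "('r, 'x) ring_scheme \<Rightarrow> ('r, 'u) module \<Rightarrow> ('r, 'u) module \<Rightarrow> ('u \<Rightarrow> 'u) set" where
  "left_module_iso R M N =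
     {f \<in> left_module_hom R M N. bij_betw f (carrier M) (carrier N)}"


section \<open>Purity\<close>

text \<open>
  A pair \<open>(c, a)\<close> stands for the equation \<open>\<Sum>\<^sub>x c x \<cdot> x = a\<close>, where \<open>c\<close> has finite support. The
  unknowns are the elements of \<open>'u\<close>; as an equation involves finitely many of them, these suffice
  for any system that is indexed by a set of the universe.
\<close>

definition linear_system ::
  "('r, 'x) ring_scheme \<Rightarrow> ('r, 'u) module \<Rightarrow> (('u \<Rightarrow> 'r) \<times> 'u) set \<Rightarrow> bool" where
  "linear_system R A S \<longleftrightarrow>
     (\<forall>(c, a)\<in>S. (\<forall>x. c x \<in> carrier R) \<and> finite {x. c x \<noteq> \<zero>\<^bsub>R\<^esub>} \<and> a \<in> carrier A)"

definition solution ::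
  "('r, 'x) ring_scheme \<Rightarrow> ('r, 'u) module \<Rightarrow> (('u \<Rightarrow> 'r) \<times> 'u) set \<Rightarrow> ('u \<Rightarrow> 'u) \<Rightarrow> bool" where
  "solution R M S s \<longleftrightarrow>
     (\<forall>x. s x \<in> carrier M) \<and>
     (\<forall>(c, a)\<in>S. finsum M (\<lambda>x. c x \<odot>\<^bsub>M\<^esub> s x) {x. c x \<noteq> \<zero>\<^bsub>R\<^esub>} = a)"

definition pp_pure ::
  "('r, 'x) ring_scheme \<Rightarrow> 'u rel \<Rightarrow> ('r, 'u) module \<Rightarrow> ('r, 'u) module \<Rightarrow> bool" where
  "pp_pure R lam A B \<longleftrightarrow>
     A \<in> R_Mod R \<and> B \<in> R_Mod R \<and> is_submodule R A B \<and>
     (\<forall>S. linear_system R A S \<and> |S| <o lam \<and> (\<exists>s. solution R B S s) \<longrightarrow>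
          (\<exists>s. solution R A S s))"


section \<open>Abstract classes\<close>

text \<open>
  In the closure under isomorphism, \<open>M'\<close> is the substructure \<open>f(M)\<close> of \<open>N'\<close>; as a record it is
  determined only up to the irrelevant values mentioned above.
\<close>

definition abstract_class ::
  "('r, 'x) ring_scheme \<Rightarrow> ('r, 'u) module set \<Rightarrow>
   (('r, 'u) module \<Rightarrow> ('r, 'u) module \<Rightarrow> bool) \<Rightarrow> bool" where
  "abstract_class R K prec \<longleftrightarrow>
     K \<noteq> {} \<and> K \<subseteq> R_Mod R \<and>
     (\<forall>M N. prec M N \<longrightarrow> M \<in> K \<and> N \<in> K \<and> is_submodule R M N) \<and>
     (\<forall>M\<in>K. prec M M) \<and>
     (\<forall>M N P. prec M N \<and> prec N P \<longrightarrow> prec M P) \<and>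
     (\<forall>N\<in>K. \<forall>N' f. left_module R N' \<and> f \<in> left_module_iso R N N' \<longrightarrow>
        N' \<in> K \<and>
        (\<forall>M M'. prec M N \<and> is_submodule R M' N' \<and> carrier M' = f ` carrier M \<longrightarrow>
           M' \<in> K \<and> prec M' N'))"

definition K_embedding ::
  "('r, 'x) ring_scheme \<Rightarrow> ('r, 'u) module set \<Rightarrow>
   (('r, 'u) module \<Rightarrow> ('r, 'u) module \<Rightarrow> bool) \<Rightarrow>
   ('r, 'u) module \<Rightarrow> ('r, 'u) module \<Rightarrow> ('u \<Rightarrow> 'u) \<Rightarrow> bool" where
  "K_embedding R K prec M N f \<longleftrightarrow>
     M \<in> K \<and> N \<in> K \<and> f \<in> left_module_hom R M N \<and> inj_on f (carrier M) \<and>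
     prec (N\<lparr>carrier := f ` carrier M\<rparr>) N"

definition strong_coherence ::
  "('r, 'x) ring_scheme \<Rightarrow> ('r, 'u) module set \<Rightarrow>
   (('r, 'u) module \<Rightarrow> ('r, 'u) module \<Rightarrow> bool) \<Rightarrow> bool" where
  "strong_coherence R K prec \<longleftrightarrow>
     (\<forall>A\<in>K. \<forall>B\<in>K. \<forall>C\<in>K.
        is_submodule R A B \<and> is_submodule R B C \<and> prec A C \<longrightarrow> prec A B)"


section \<open>Classes with directed colimits and a Loewenheim-Skolem number\<close>

definition directed_poset :: "'u rel \<Rightarrow> 'u set \<Rightarrow> 'u rel \<Rightarrow> bool" where
  "directed_poset \<mu> I r \<longleftrightarrow>
     partial_order_on I r \<and>
     (\<forall>X\<subseteq>I. |X| <o \<mu> \<longrightarrow> (\<exists>u\<in>I. \<forall>x\<in>X. (x, u) \<in> r))"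

definition directed_system ::
  "('r, 'u) module set \<Rightarrow> (('r, 'u) module \<Rightarrow> ('r, 'u) module \<Rightarrow> bool) \<Rightarrow>
   'u rel \<Rightarrow> 'u set \<Rightarrow> 'u rel \<Rightarrow> ('u \<Rightarrow> ('r, 'u) module) \<Rightarrow> bool" where
  "directed_system K prec \<mu> I r F \<longleftrightarrow>
     small I \<and> directed_poset \<mu> I r \<and> (\<forall>i\<in>I. F i \<in> K) \<and>
     (\<forall>i j. (i, j) \<in> r \<and> i \<noteq> j \<longrightarrow> prec (F i) (F j))"

definition is_union ::
  "('r, 'x) ring_scheme \<Rightarrow> 'u set \<Rightarrow> ('u \<Rightarrow> ('r, 'u) module) \<Rightarrow> ('r, 'u) module \<Rightarrow> bool" where
  "is_union R I F M \<longleftrightarrow>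
     carrier M = (\<Union>i\<in>I. carrier (F i)) \<and> (\<forall>i\<in>I. is_submodule R (F i) M)"

datatype 'r module_symbol = Zero_sym | Plus_sym | Minus_sym | Scalar_sym 'r

definition module_language :: "('r, 'x) ring_scheme \<Rightarrow> 'r module_symbol set" where
  "module_language R = {Zero_sym, Plus_sym, Minus_sym} \<union> Scalar_sym ` carrier R"

definition mu_AEC ::
  "('r, 'x) ring_scheme \<Rightarrow> ('r, 'u) module set \<Rightarrow>
   (('r, 'u) module \<Rightarrow> ('r, 'u) module \<Rightarrow> bool) \<Rightarrow> 'u rel \<Rightarrow> bool" where
  "mu_AEC R K prec \<mu> \<longleftrightarrow>
     abstract_class R K prec \<and>
     \<comment> \<open>coherence\<close>
     (\<forall>M0\<in>K. \<forall>M1\<in>K. \<forall>M2\<in>K.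
        prec M0 M2 \<and> is_submodule R M0 M1 \<and> prec M1 M2 \<longrightarrow> prec M0 M1) \<and>
     \<comment> \<open>continuity\<close>
     (\<forall>I r F. directed_system K prec \<mu> I r F \<longrightarrow>
        (\<exists>M. is_union R I F M) \<and>
        (\<forall>M. is_union R I F M \<longrightarrow> M \<in> K \<and> (\<forall>i\<in>I. prec (F i) M))) \<and>
     \<comment> \<open>smoothness\<close>
     (\<forall>N\<in>K. \<forall>I r F. directed_system K prec \<mu> I r F \<and> (\<forall>i\<in>I. prec (F i) N) \<longrightarrow>
        (\<forall>M\<in>K. is_union R I F M \<and> is_submodule R M N \<longrightarrow> prec M N)) \<and>
     \<comment> \<open>Loewenheim-Skolem\<close>
     (\<exists>\<theta>. cardinal \<theta> \<and> is_weak_power \<theta> \<mu> \<theta> \<and> |module_language R| +c \<mu> \<le>o \<theta> \<and>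
        (\<forall>M\<in>K. \<forall>A\<subseteq>carrier M. \<exists>M0\<in>K. A \<subseteq> carrier M0 \<and> prec M0 M \<and>
           (\<exists>\<rho>. is_weak_power |A| \<mu> \<rho> \<and> |carrier M0| \<le>o \<rho> +c \<theta>)))"


section \<open>Orbital types and stability\<close>

type_synonym ('r, 'u) pointed = "'u \<times> 'u set \<times> ('r, 'u) module"

definition E_at ::
  "('r, 'x) ring_scheme \<Rightarrow> ('r, 'u) module set \<Rightarrow>
   (('r, 'u) module \<Rightarrow> ('r, 'u) module \<Rightarrow> bool) \<Rightarrow> ('r, 'u) pointed rel" where
  "E_at R K prec =
     {((b1, A1, N1), (b2, A2, N2)) | b1 A1 N1 b2 A2 N2.
        N1 \<in> K \<and> N2 \<in> K \<and> A1 = A2 \<and> A1 \<subseteq> carrier N1 \<and> A2 \<subseteq> carrier N2 \<and>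
        b1 \<in> carrier N1 \<and> b2 \<in> carrier N2 \<and>
        (\<exists>N f1 f2. K_embedding R K prec N1 N f1 \<and> K_embedding R K prec N2 N f2 \<and>
           f1 b1 = f2 b2 \<and> (\<forall>a\<in>A1. f1 a = a \<and> f2 a = a))}"

definition ortp ::
  "('r, 'x) ring_scheme \<Rightarrow> ('r, 'u) module set \<Rightarrow>
   (('r, 'u) module \<Rightarrow> ('r, 'u) module \<Rightarrow> bool) \<Rightarrow>
   'u \<Rightarrow> 'u set \<Rightarrow> ('r, 'u) module \<Rightarrow> ('r, 'u) pointed set" where
  "ortp R K prec b A N = (E_at R K prec)\<^sup>+ `` {(b, A, N)}"

definition types_in ::
  "('r, 'x) ring_scheme \<Rightarrow> ('r, 'u) module set \<Rightarrow>
   (('r, 'u) module \<Rightarrow> ('r, 'u) module \<Rightarrow> bool) \<Rightarrow>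
   ('r, 'u) module \<Rightarrow> ('r, 'u) module \<Rightarrow> ('r, 'u) pointed set set" where
  "types_in R K prec M N = {ortp R K prec c (carrier M) N | c. c \<in> carrier N}"

definition types_over ::
  "('r, 'x) ring_scheme \<Rightarrow> ('r, 'u) module set \<Rightarrow>
   (('r, 'u) module \<Rightarrow> ('r, 'u) module \<Rightarrow> bool) \<Rightarrow>
   ('r, 'u) module \<Rightarrow> ('r, 'u) pointed set set" where
  "types_over R K prec M = (\<Union>N\<in>{N \<in> K. prec M N}. types_in R K prec M N)"

definition stable_class ::
  "('r, 'x) ring_scheme \<Rightarrow> ('r, 'u) module set \<Rightarrow>
   (('r, 'u) module \<Rightarrow> ('r, 'u) module \<Rightarrow> bool) \<Rightarrow> bool" where
  "stable_class R K prec \<longleftrightarrow>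
     (\<forall>\<alpha> :: 'u rel. cardinal \<alpha> \<longrightarrow>
        (\<exists>\<kappa> :: 'u rel. infinite_cardinal \<kappa> \<and> \<alpha> \<le>o \<kappa> \<and>
           (\<forall>M\<in>K. |carrier M| =o \<kappa> \<longrightarrow> |types_over R K prec M| \<le>o \<kappa>)))"

definition almost_stable_class ::
  "('r, 'x) ring_scheme \<Rightarrow> ('r, 'u) module set \<Rightarrow>
   (('r, 'u) module \<Rightarrow> ('r, 'u) module \<Rightarrow> bool) \<Rightarrow> bool" where
  "almost_stable_class R K prec \<longleftrightarrow>
     (\<forall>\<alpha> :: 'u rel. cardinal \<alpha> \<longrightarrow>
        (\<exists>\<kappa> :: 'u rel. infinite_cardinal \<kappa> \<and> \<alpha> \<le>o \<kappa> \<and>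
           (\<forall>M\<in>K. \<forall>N\<in>K. prec M N \<and> |carrier M| =o \<kappa> \<longrightarrow> |types_in R K prec M N| \<le>o \<kappa>)))"

definition infinity_AP ::
  "('r, 'x) ring_scheme \<Rightarrow> ('r, 'u) module set \<Rightarrow>
   (('r, 'u) module \<Rightarrow> ('r, 'u) module \<Rightarrow> bool) \<Rightarrow> bool" where
  "infinity_AP R K prec \<longleftrightarrow>
     (\<forall>M\<in>K. \<forall>(I :: 'u set) F f.
        small I \<and> (\<forall>i\<in>I. K_embedding R K prec M (F i) (f i)) \<longrightarrow>
        (\<exists>N\<in>K. \<exists>g. (\<forall>i\<in>I. K_embedding R K prec (F i) N (g i)) \<and>
           (\<forall>i\<in>I. \<forall>j\<in>I. \<forall>x\<in>carrier M. g i (f i x) = g j (f j x))))"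


section \<open>The poset of relations\<close>

definition refines_direct_summands ::
  "('r, 'x) ring_scheme \<Rightarrow> (('r, 'u) module \<Rightarrow> ('r, 'u) module \<Rightarrow> bool) \<Rightarrow> bool" where
  "refines_direct_summands R prec \<longleftrightarrow>
     (\<forall>A\<in>R_Mod R. \<forall>B\<in>R_Mod R. direct_summand R A B \<longrightarrow> prec A B)"

definition admissible_relations ::
  "('r, 'x) ring_scheme \<Rightarrow> (('r, 'u) module \<Rightarrow> ('r, 'u) module \<Rightarrow> bool) set" where
  "admissible_relations R =
     {prec. refines_direct_summands R prec \<and>
          (\<exists>\<mu> :: 'u rel. infinite_cardinal \<mu> \<and> regularCard \<mu> \<and> mu_AEC R (R_Mod R) prec \<mu>) \<and>
          strong_coherence R (R_Mod R) prec}"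

end

(*
  Every relation lambda-pp is admissible: systems of fewer than lambda equations have at most lambda
  many unknowns and parameters, so mu = lambda^+ makes mu-directed unions harmless, and closing a
  subset under chosen solutions gives the Loewenheim-Skolem property.

  Conversely let prec be admissible with Loewenheim-Skolem number theta, and let A be theta^+-pure
  in B. For A0 prec A of size at most theta pick C prec B of size at most theta containing A0. The
  multiplication table of C over A0 is a system of theta equations, so purity provides a
  homomorphism h : C -> A over A0. Because of h, A is a direct summand of the pushout of A and C
  over A0, hence A0 prec A prec pushout, and A0 prec C prec B by strong coherence. As A is the
  mu-directed union of such A0, smoothness yields A prec B.

  Now fix lambda such that lambda-pure submodules are strong. If c and c' in N realize the same
  lambda-pp formulas over M, then the pushout of two copies of N that identifies c with c' over M
  contains both copies as pure submodules, so c and c' have the same orbital type. A pp type selects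
  for each formula at most one coset, hence there are at most kappa types over a module of size
  kappa = kappa^Phi, where Phi is the number of formulas. Given infinity-AP, kappa^+ many types
  in arbitrary extensions could all be realized in one extension.
*)
theory Submission
  imports Defs
begin

section \<open>Cardinals\<close>

text \<open>Strong coherence is decisive in the pushout argument. Ordinary coherence would give A0
  prec C only if the copy of C were known to be strong in the pushout, and nothing provides that;
  strong coherence asks merely that the copy lie between A0 and the pushout. The successor of lambda
  is used for mu because admissibility asks for a regular cardinal and lambda may be singular, while
  an infinite successor is always regular. For the count of types, the formulas must form a small
  set fixed before any module is chosen. Therefore the equations of a system are indexed, and its
  unknowns renamed, by the fixed set L = Field lambda; only then can kappa be chosen with kappa^Phi
  = kappa. Every module must be carried by a subset of the universe type, whereas products, cosets
  and cardinal successors live in other types. Such constructions end with a copy back into the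
  universe, and an extension of a module with a renaming that is the identity on that
  module.\<close>

lemma Cinfinite_card_of: "Cinfinite |A| \<longleftrightarrow> infinite A"
  by (simp add: cinfinite_def Field_card_of card_of_card_order_on)

lemma card_of_Func_mono:
  assumes "|A| \<le>o |B|"
  shows "|Func L A| \<le>o |Func L B|"
  using cexp_mono1[OF assms card_of_Card_order[of L]] by (simp add: cexp_def Field_card_of)

text \<open>Cantor's inequality for the power set of \<open>L\<close>, followed by an embedding of a
  two-element set into the infinite \<open>K\<close>.\<close>

lemma card_of_Func_less:
  assumes "infinite K"
  shows "|L| <o |Func L K|"
proof -
  have "|UNIV :: bool set| \<le>o |K|"
    using assms finite_ordLess_infinite[OF card_of_Well_order card_of_Well_order, of "UNIV :: bool set" K]
    by (simp add: Field_card_of ordLess_imp_ordLeq)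
  then have "|Func L (UNIV :: bool set)| \<le>o |Func L K|" by (rule card_of_Func_mono)
  moreover have "|L| <o |Func L (UNIV :: bool set)|"
    using card_of_Pow card_of_Pow_Func ordLess_ordIso_trans by blast
  ultimately show ?thesis using ordLess_ordLeq_trans by blast
qed

lemma card_of_Func_le_Pow: "|Func A B| \<le>o |Pow (A \<times> B)|"
proof (rule card_of_ordLeqI)
  show "inj_on (\<lambda>f. {(a, f a) | a. a \<in> A}) (Func A B)"
  proof (intro inj_onI ext)
    fix f g x assume f: "f \<in> Func A B" and g: "g \<in> Func A B"
      and eq: "{(a, f a) | a. a \<in> A} = {(a, g a) | a. a \<in> A}"
    show "f x = g x"
    proof (cases "x \<in> A")
      case True
      then have "(x, f x) \<in> {(a, g a) | a. a \<in> A}" unfolding eq[symmetric] by simp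
      then show ?thesis by simp
    qed (use f g in \<open>simp add: Func_def\<close>)
  qed
qed (auto simp: Func_def)

text \<open>
  Transfinite iteration along the successor of \<open>|L|\<close>: by its regularity every
  \<open>L\<close>-indexed family in the union already lies in some stage.
\<close>

lemma exists_closed_superset:
  fixes L :: "'i set" and A :: "'a set" and H :: "('i \<Rightarrow> 'a) \<Rightarrow> 'a set" and K :: "'k set"
  assumes L: "infinite L" and K: "infinite K" and A: "|A| \<le>o |K|"
    and KL: "|Func L K| \<le>o |K|" and H: "\<And>f. |H f| \<le>o |K|"
  shows "\<exists>X. A \<subseteq> X \<and> |X| \<le>o |K| \<and> (\<forall>f\<in>Func L X. H f \<subseteq> X)"
proof -
  let ?r = "cardSuc |L|"
  have CL: "Cinfinite |L|" using L by (simp add: Cinfinite_card_of)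
  have Cr: "Cinfinite ?r" using Cinfinite_cardSuc[OF CL] .
  then have wo: "Well_order ?r" by (simp add: card_order_on_well_order_on)
  then have wf: "wf (?r - Id)" by (simp add: well_order_on_def)
  \<comment> \<open>The hypothesis \<open>|K|^|L| \<le> |K|\<close> already forces
    \<open>|L| < |K|\<close>, so the length \<open>|L|^+\<close> of the iteration is at most
    \<open>|K|\<close>.\<close>
  have LK: "|L| <o |K|" using card_of_Func_less[OF K, of L] KL ordLess_ordLeq_trans by blast
  then have rK: "?r \<le>o |K|" by (simp add: cardSuc_least card_of_Card_order)
  have trans: "trans ?r" and antisym: "antisym ?r"
    using wo by (auto simp: well_order_on_def linear_order_on_def partial_order_on_def preorder_on_def)
  \<comment> \<open>Stage \<open>i\<close> adds to \<open>A\<close> all that \<open>H\<close> yields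
    from families with values in earlier stages, so successor and limit stages obey one
    clause.\<close>
  define S where "S = wfrec (?r - Id) (\<lambda>S i. A \<union> \<Union> (H ` Func L (\<Union>j\<in>underS ?r i. S j)))"
  have S: "S i = A \<union> \<Union> (H ` Func L (\<Union>j\<in>underS ?r i. S j))" for i
  proof -
    have "S i = A \<union> \<Union> (H ` Func L (\<Union>j\<in>underS ?r i. cut S (?r - Id) i j))"
      using wfrec[OF wf, of "\<lambda>S i. A \<union> \<Union> (H ` Func L (\<Union>j\<in>underS ?r i. S j))" i]
      by (simp add: S_def)
    also have "(\<Union>j\<in>underS ?r i. cut S (?r - Id) i j) = (\<Union>j\<in>underS ?r i. S j)"
      by (intro SUP_cong) (auto simp: cut_def underS_def)
    finally show ?thesis .
  qed
  have card: "|S i| \<le>o |K|" for i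
  proof (rule wf_induct_rule[OF wf, where P = "\<lambda>i. |S i| \<le>o |K|"])
    fix i assume IH: "\<And>j. (j, i) \<in> ?r - Id \<Longrightarrow> |S j| \<le>o |K|"
    have "|underS ?r i| \<le>o ?r"
    proof (cases "i \<in> Field ?r")
      case True
      then show ?thesis
        by (intro ordLess_imp_ordLeq card_of_underS conjunct2[OF Cr])
    next
      case False
      then have "underS ?r i = {}" by (auto simp: underS_def Field_def)
      then show ?thesis using Card_order_empty conjunct2[OF Cr] by metis
    qed
    then have "|underS ?r i| \<le>o |K|" using rK ordLeq_transitive by blast
    then have "|\<Union>j\<in>underS ?r i. S j| \<le>o |K|"
      by (intro card_of_UNION_ordLeq_infinite[OF K]) (auto intro!: IH simp: underS_def)
    then have "|Func L (\<Union>j\<in>underS ?r i. S j)| \<le>o |K|"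
      using card_of_Func_mono KL ordLeq_transitive by blast
    then have "|\<Union> (H ` Func L (\<Union>j\<in>underS ?r i. S j))| \<le>o |K|"
      using card_of_UNION_ordLeq_infinite[OF K] H by blast
    then show "|S i| \<le>o |K|" using A K
      by (subst S) (simp add: Un_Cinfinite_bound Cinfinite_card_of)
  qed
  define X where "X = (\<Union>i\<in>Field ?r. S i)"
  have chain: "relChain ?r S"
  proof (unfold relChain_def, intro allI impI)
    fix i j assume "(i, j) \<in> ?r"
    then have "underS ?r i \<subseteq> underS ?r j"
      using trans antisym by (auto simp: underS_def dest: transD antisymD)
    then have "Func L (\<Union>j\<in>underS ?r i. S j) \<subseteq> Func L (\<Union>i\<in>underS ?r j. S i)"
      by (auto simp: Func_def) blast
    then show "S i \<subseteq> S j" using S[of i] S[of j] by blast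
  qed
  have "|Field ?r| \<le>o |K|"
    using rK Cr card_of_Field_ordIso ordIso_ordLeq_trans by blast
  then have 1: "|X| \<le>o |K|" unfolding X_def
    using card card_of_UNION_ordLeq_infinite[OF K] by blast
  have "Field ?r \<noteq> {}" using Cr by (auto simp: cinfinite_def)
  then have 2: "A \<subseteq> X" unfolding X_def using S by blast
  have 3: "H f \<subseteq> X" if f: "f \<in> Func L X" for f
  proof -
    have "\<exists>i\<in>Field ?r. f ` L \<subseteq> S i"
    proof (rule cardSuc_UNION_Cinfinite[OF CL chain])
      show "f ` L \<subseteq> (\<Union>i\<in>Field ?r. S i)" using f by (auto simp: Func_def X_def)
      show "|f ` L| \<le>o |L|" by (rule card_of_image)
    qed
    then obtain i where i: "i \<in> Field ?r" "f ` L \<subseteq> S i" by blast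
    \<comment> \<open>The family takes its values in stage \<open>i\<close>, so its closure set is
      only certain to appear at a later stage; an infinite cardinal order has no last
      element.\<close>
    obtain j where j: "j \<in> Field ?r" "i \<noteq> j" "(i, j) \<in> ?r"
      using infinite_Card_order_limit[of ?r i] Cr i unfolding cinfinite_def
      by (metis FieldI2)
    have "f \<in> Func L (\<Union>i\<in>underS ?r j. S i)"
      using f i j by (auto simp: Func_def underS_def)
    then have "H f \<subseteq> S j" by (subst S) blast
    then show ?thesis using j by (auto simp: X_def)
  qed
  show ?thesis using 1 2 3 by (intro exI[of _ X] conjI ballI)
qed

lemma card_of_Pow_mono:
  assumes "|A| \<le>o |B|"
  shows "|Pow A| \<le>o |Pow B|"
proof -
  obtain f where f: "inj_on f A" "f ` A \<subseteq> B" using assms card_of_ordLeq by metis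
  show ?thesis
  proof (rule card_of_ordLeqI)
    show "inj_on ((`) f) (Pow A)" using f(1) by (rule inj_on_image_Pow)
  qed (use f in auto)
qed

text \<open>The exponent law: a family of subsets of \<open>V\<close> is a subset of
  \<open>L \<times> V\<close>, and the infinite \<open>V\<close> absorbs \<open>L\<close>. This is
  the source of cardinals that absorb the exponent \<open>|L|\<close>.\<close>

lemma card_of_Func_Pow:
  assumes "infinite V" "|L| \<le>o |V|"
  shows "|Func L (Pow V)| \<le>o |Pow V|"
proof -
  have "|Func L (Pow V)| \<le>o |Pow (L \<times> V)|"
  proof (rule card_of_ordLeqI)
    show "inj_on (\<lambda>f. Sigma L f) (Func L (Pow V))"
    proof (intro inj_onI ext)
      fix f g x assume f: "f \<in> Func L (Pow V)" and g: "g \<in> Func L (Pow V)"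
        and eq: "Sigma L f = Sigma L g"
      show "f x = g x"
      proof (cases "x \<in> L")
        case True
        have "f x = {v. (x, v) \<in> Sigma L f}" using True by auto
        also have "\<dots> = g x" unfolding eq using True by auto
        finally show ?thesis .
      qed (use f g in \<open>simp add: Func_def\<close>)
    qed
  qed (fastforce simp: Func_def)
  moreover have "|L \<times> V| \<le>o |V|"
    using assms card_of_Times_ordLeq_infinite_Field[of "|V|" L V]
    by (simp add: Field_card_of card_of_card_order_on card_of_refl ordIso_imp_ordLeq)
  ultimately show ?thesis using card_of_Pow_mono ordLeq_transitive by blast
qed

lemma strongly_inaccessible_infinite:
  assumes "strongly_inaccessible |UNIV :: 'u set|"
  shows "infinite (UNIV :: 'u set)"
proof -
  have "natLeq \<le>o |UNIV :: 'u set|"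
    using assms by (simp add: strongly_inaccessible_def ordLess_imp_ordLeq)
  then show ?thesis using infinite_iff_natLeq_ordLeq by blast
qed

section \<open>Closure properties of the universe of small sets\<close>

context
  assumes SI: "strongly_inaccessible |UNIV :: 'u set|"
begin

lemma infinite_universe: "infinite (UNIV :: 'u set)"
  using strongly_inaccessible_infinite[OF SI] .

lemma small_copy:
  assumes "|X :: 'v set| <o |UNIV :: 'u set|"
  obtains U :: "'u set" where "small U" "|X| =o |U|"
proof -
  obtain U :: "'u set" where "|X| =o |U|" "|U| <o |UNIV :: 'u set|"
    using iffD1[OF internalize_card_of_ordLess assms] by auto
  then show thesis using that by (simp add: small_def)
qed

lemma small_Pow:
  assumes "|X :: 'v set| <o |UNIV :: 'u set|"
  shows "|Pow X| <o |UNIV :: 'u set|"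
proof -
  obtain U :: "'u set" where U: "small U" "|X| =o |U|" using small_copy[OF assms] .
  then have "|Pow X| \<le>o |Pow U|" using card_of_Pow_mono ordIso_imp_ordLeq by blast
  then show ?thesis using U(1) SI ordLeq_ordLess_trans
    unfolding strongly_inaccessible_def small_def by blast
qed

lemma small_Times:
  assumes "|X :: 'v set| <o |UNIV :: 'u set|" "|Y :: 'w set| <o |UNIV :: 'u set|"
  shows "|X \<times> Y| <o |UNIV :: 'u set|"
proof -
  have "|X <+> Y| <o |UNIV :: 'u set|"
    using card_of_Plus_ordLess_infinite[OF infinite_universe assms] .
  moreover have "|X \<times> Y| \<le>o |Pow (X <+> Y)|"
  proof (rule card_of_ordLeqI)
    show "inj_on (\<lambda>(x, y). {Inl x, Inr y}) (X \<times> Y)" by (auto simp: inj_on_def doubleton_eq_iff)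
  qed auto
  ultimately show ?thesis using small_Pow ordLeq_ordLess_trans by blast
qed

lemma small_Plus:
  assumes "|X :: 'v set| <o |UNIV :: 'u set|" "|Y :: 'w set| <o |UNIV :: 'u set|"
  shows "|X <+> Y| <o |UNIV :: 'u set|"
  using card_of_Plus_ordLess_infinite[OF infinite_universe assms] .

lemma small_Func:
  assumes "|X :: 'v set| <o |UNIV :: 'u set|" "|Y :: 'w set| <o |UNIV :: 'u set|"
  shows "|Func X Y| <o |UNIV :: 'u set|"
  using card_of_Func_le_Pow small_Pow[OF small_Times[OF assms]] ordLeq_ordLess_trans by blast

lemma small_UNION:
  fixes F :: "'v \<Rightarrow> 'w set"
  assumes "|I| <o |UNIV :: 'u set|" "\<And>i. i \<in> I \<Longrightarrow> |F i| <o |UNIV :: 'u set|"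
  shows "|\<Union>i\<in>I. F i| <o |UNIV :: 'u set|"
proof (rule card_of_UNION_ordLess_infinite_Field_regularCard)
  show "Cinfinite |UNIV :: 'u set|" using infinite_universe by (simp add: Cinfinite_card_of)
qed (use SI assms in \<open>auto simp: strongly_inaccessible_def\<close>)

lemma small_finite: "finite (X :: 'v set) \<Longrightarrow> |X| <o |UNIV :: 'u set|"
  using finite_ordLess_infinite[OF card_of_Well_order card_of_Well_order, of X "UNIV :: 'u set"]
  by (simp add: Field_card_of infinite_universe)

text \<open>\<open>K\<close> is a copy of the power set of \<open>L <+> W\<close>: a cardinal
  \<open>2^\<nu>\<close> with infinite \<open>\<nu> \<ge> |L|\<close> does not grow under the
  exponent \<open>|L|\<close>, and strong inaccessibility keeps it small.\<close>

lemma exists_cardinal_Func_closed: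
  assumes L: "|L :: 'l set| <o |UNIV :: 'u set|" and W: "|W :: 'w set| <o |UNIV :: 'u set|"
    and inf: "infinite L"
  obtains K :: "'u set" where "small K" "infinite K" "|L| <o |K|" "|W| \<le>o |K|" "|Func L K| \<le>o |K|"
proof -
  let ?V = "L <+> W"
  have infV: "infinite ?V" using inf by simp
  obtain K :: "'u set" where K: "small K" "|Pow ?V| =o |K|"
    using small_copy[OF small_Pow[OF small_Plus[OF L W]]] .
  have LV: "|L| \<le>o |?V|" and WV: "|W| \<le>o |?V|" by (rule card_of_Plus1, rule card_of_Plus2)
  have VK: "|?V| <o |K|" using card_of_Pow K(2) ordLess_ordIso_trans by blast
  have "|Func L K| \<le>o |Func L (Pow ?V)|"
    using K(2) card_of_Func_mono ordIso_imp_ordLeq ordIso_symmetric by blast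
  moreover have "|Func L (Pow ?V)| \<le>o |K|"
    using card_of_Func_Pow[OF infV LV] K(2) ordLeq_ordIso_trans by blast
  ultimately have FK: "|Func L K| \<le>o |K|" using ordLeq_transitive by blast
  have "infinite K" using VK infV card_of_ordLeq_infinite ordLess_imp_ordLeq by blast
  moreover have "|L| <o |K|" using LV VK by (rule ordLeq_ordLess_trans)
  moreover have "|W| \<le>o |K|" using WV VK ordLess_imp_ordLeq ordLeq_transitive by blast
  ultimately show thesis using that K(1) FK by blast
qed

end

text \<open>The image of \<open>f\<close> stands for a quotient of \<open>T\<close> whose points
  live in a foreign type. Points that come from the copy \<open>j\<close> of \<open>N\<close> get
  back their old names; the others receive fresh names outside \<open>N\<close>, of which there are
  enough because \<open>N\<close> is small in an infinite universe. Pushouts and amalgams become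
  honest extensions in this way.\<close>

lemma exists_renaming:
  fixes f :: "'v \<Rightarrow> 'w" and N :: "'u set"
  assumes inf: "infinite (UNIV :: 'u set)" and small: "|f ` T| <o |UNIV :: 'u set|"
    and inj: "inj_on (f \<circ> j) N" and j: "j ` N \<subseteq> T"
  obtains \<pi> :: "'v \<Rightarrow> 'u" where
    "\<And>x y. x \<in> T \<Longrightarrow> y \<in> T \<Longrightarrow> \<pi> x = \<pi> y \<longleftrightarrow> f x = f y" "\<And>n. n \<in> N \<Longrightarrow> \<pi> (j n) = n"
proof -
  have "|N| \<le>o |f ` T|"
    by (rule card_of_ordLeqI[OF inj]) (use j in auto)
  then have "|N| <o |UNIV :: 'u set|" using small ordLeq_ordLess_trans by blast
  then have "\<not> |UNIV - N| <o |UNIV :: 'u set|"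
    using card_of_Un_ordLess_infinite[OF inf, of N "UNIV - N"] ordLess_irreflexive by auto
  then have "|UNIV :: 'u set| \<le>o |UNIV - N|"
    using not_ordLess_iff_ordLeq[OF card_of_Well_order card_of_Well_order] by blast
  then have "|f ` T| \<le>o |UNIV - N|" using small ordLess_imp_ordLeq ordLeq_transitive by blast
  then obtain g where g: "inj_on g (f ` T)" "g ` f ` T \<subseteq> UNIV - N" using card_of_ordLeq by metis
  define \<pi> where "\<pi> x = (if \<exists>n\<in>N. f (j n) = f x then THE n. n \<in> N \<and> f (j n) = f x else g (f x))" for x
  have 1: "\<pi> x = n" if "n \<in> N" "f (j n) = f x" for x n
  proof -
    have "(THE n. n \<in> N \<and> f (j n) = f x) = n"
      using that inj by (intro the_equality) (auto simp: inj_on_def)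
    then show ?thesis using that by (auto simp: \<pi>_def)
  qed
  have 2: "\<pi> x = g (f x)" if "\<not> (\<exists>n\<in>N. f (j n) = f x)" for x using that by (simp add: \<pi>_def)
  show thesis
  proof (rule that)
    fix x y assume xy: "x \<in> T" "y \<in> T"
    show "\<pi> x = \<pi> y \<longleftrightarrow> f x = f y"
    proof
      assume eq: "\<pi> x = \<pi> y"
      consider (a) n m where "n \<in> N" "f (j n) = f x" "m \<in> N" "f (j m) = f y"
        | (b) "\<not> (\<exists>n\<in>N. f (j n) = f x)" "\<not> (\<exists>n\<in>N. f (j n) = f y)"
        | (c) n where "n \<in> N" "f (j n) = f x" "\<not> (\<exists>n\<in>N. f (j n) = f y)"
        | (d) n where "n \<in> N" "f (j n) = f y" "\<not> (\<exists>n\<in>N. f (j n) = f x)"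
        by blast
      then show "f x = f y"
      proof cases
        case a then show ?thesis using eq 1[of n x] 1[of m y] by simp
      next
        case b then show ?thesis using eq 2[of x] 2[of y] g xy by (auto simp: inj_on_def)
      next
        case c then show ?thesis using eq 1[of n x] 2[of y] g xy by auto
      next
        case d then show ?thesis using eq 1[of n y] 2[of x] g xy by auto
      qed
    qed (simp add: \<pi>_def)
  qed (simp add: 1)
qed

section \<open>Left modules\<close>

lemma (in left_module) smult_zero:
  assumes "r \<in> carrier R"
  shows "r \<odot>\<^bsub>M\<^esub> \<zero>\<^bsub>M\<^esub> = \<zero>\<^bsub>M\<^esub>"
  using smult_r_distr[OF assms, of "\<zero>\<^bsub>M\<^esub>" "\<zero>\<^bsub>M\<^esub>"] smult_closed[OF assms, of "\<zero>\<^bsub>M\<^esub>"]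
  by (metis M.add.l_cancel_one M.l_zero M.zero_closed)

lemma (in left_module) zero_smult:
  assumes "x \<in> carrier M"
  shows "\<zero>\<^bsub>R\<^esub> \<odot>\<^bsub>M\<^esub> x = \<zero>\<^bsub>M\<^esub>"
  using smult_l_distr[of "\<zero>\<^bsub>R\<^esub>" "\<zero>\<^bsub>R\<^esub>" x] smult_closed[of "\<zero>\<^bsub>R\<^esub>" x] assms
  by (metis M.add.l_cancel_one R.l_zero R.zero_closed)

lemma (in left_module) smult_r_neg:
  assumes "r \<in> carrier R" "x \<in> carrier M"
  shows "r \<odot>\<^bsub>M\<^esub> \<ominus>\<^bsub>M\<^esub> x = \<ominus>\<^bsub>M\<^esub> (r \<odot>\<^bsub>M\<^esub> x)"
proof -
  have "r \<odot>\<^bsub>M\<^esub> \<ominus>\<^bsub>M\<^esub> x \<oplus>\<^bsub>M\<^esub> r \<odot>\<^bsub>M\<^esub> x = \<zero>\<^bsub>M\<^esub>"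
    using smult_r_distr[of r "\<ominus>\<^bsub>M\<^esub> x" x] assms smult_zero by (simp add: M.l_neg)
  then show ?thesis using assms M.minus_equality smult_closed by simp
qed

lemma (in left_module) minus_one_smult:
  assumes "x \<in> carrier M"
  shows "(\<ominus>\<^bsub>R\<^esub> \<one>\<^bsub>R\<^esub>) \<odot>\<^bsub>M\<^esub> x = \<ominus>\<^bsub>M\<^esub> x"
proof -
  have "(\<ominus>\<^bsub>R\<^esub> \<one>\<^bsub>R\<^esub>) \<odot>\<^bsub>M\<^esub> x \<oplus>\<^bsub>M\<^esub> x = \<zero>\<^bsub>M\<^esub>"
    using assms smult_l_distr[of "\<ominus>\<^bsub>R\<^esub> \<one>\<^bsub>R\<^esub>" "\<one>\<^bsub>R\<^esub>" x]
    by (simp add: smult_one zero_smult R.l_neg)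
  then show ?thesis using assms M.minus_equality smult_closed by simp
qed

text \<open>\<open>left_module_hom\<close> has the same carrier type on both sides; products and
  quotients require maps between different types.\<close>

definition lin_map ::
  "('r, 'x) ring_scheme \<Rightarrow> ('r, 'v) module \<Rightarrow> ('r, 'w) module \<Rightarrow> ('v \<Rightarrow> 'w) \<Rightarrow> bool" where
  "lin_map R M N f \<longleftrightarrow>
     f \<in> carrier M \<rightarrow> carrier N \<and>
     (\<forall>x\<in>carrier M. \<forall>y\<in>carrier M. f (x \<oplus>\<^bsub>M\<^esub> y) = f x \<oplus>\<^bsub>N\<^esub> f y) \<and>
     (\<forall>r\<in>carrier R. \<forall>x\<in>carrier M. f (r \<odot>\<^bsub>M\<^esub> x) = r \<odot>\<^bsub>N\<^esub> f x)"

lemma left_module_hom_iff: "f \<in> left_module_hom R M N \<longleftrightarrow> lin_map R M N f"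
  by (simp add: left_module_hom_def lin_map_def)

lemma lin_mapI:
  assumes "\<And>x. x \<in> carrier M \<Longrightarrow> f x \<in> carrier N"
    and "\<And>x y. x \<in> carrier M \<Longrightarrow> y \<in> carrier M \<Longrightarrow> f (x \<oplus>\<^bsub>M\<^esub> y) = f x \<oplus>\<^bsub>N\<^esub> f y"
    and "\<And>r x. r \<in> carrier R \<Longrightarrow> x \<in> carrier M \<Longrightarrow> f (r \<odot>\<^bsub>M\<^esub> x) = r \<odot>\<^bsub>N\<^esub> f x"
  shows "lin_map R M N f"
  using assms by (simp add: lin_map_def)

lemma lin_map_closed: "lin_map R M N f \<Longrightarrow> x \<in> carrier M \<Longrightarrow> f x \<in> carrier N"
  and lin_map_add: "lin_map R M N f \<Longrightarrow> x \<in> carrier M \<Longrightarrow> y \<in> carrier M \<Longrightarrow>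
    f (x \<oplus>\<^bsub>M\<^esub> y) = f x \<oplus>\<^bsub>N\<^esub> f y"
  and lin_map_smult: "lin_map R M N f \<Longrightarrow> r \<in> carrier R \<Longrightarrow> x \<in> carrier M \<Longrightarrow>
    f (r \<odot>\<^bsub>M\<^esub> x) = r \<odot>\<^bsub>N\<^esub> f x"
  by (auto simp: lin_map_def)

lemma lin_map_comp: "lin_map R M N f \<Longrightarrow> lin_map R N P g \<Longrightarrow> lin_map R M P (g \<circ> f)"
  unfolding lin_map_def by (simp add: Pi_iff)

lemma lin_map_zero:
  assumes "left_module R M" "left_module R N" "lin_map R M N f"
  shows "f \<zero>\<^bsub>M\<^esub> = \<zero>\<^bsub>N\<^esub>"
proof -
  interpret M: left_module R M by fact
  interpret N: left_module R N by fact
  have "f \<zero>\<^bsub>M\<^esub> \<oplus>\<^bsub>N\<^esub> f \<zero>\<^bsub>M\<^esub> = f \<zero>\<^bsub>M\<^esub>"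
    using lin_map_add[OF assms(3), of "\<zero>\<^bsub>M\<^esub>" "\<zero>\<^bsub>M\<^esub>"] by simp
  then show ?thesis using lin_map_closed[OF assms(3), of "\<zero>\<^bsub>M\<^esub>"] by (simp add: N.M.add.l_cancel_one)
qed

lemma lin_map_neg:
  assumes "left_module R M" "left_module R N" "lin_map R M N f" "x \<in> carrier M"
  shows "f (\<ominus>\<^bsub>M\<^esub> x) = \<ominus>\<^bsub>N\<^esub> f x"
proof -
  interpret M: left_module R M by fact
  interpret N: left_module R N by fact
  have "f (\<ominus>\<^bsub>M\<^esub> x) \<oplus>\<^bsub>N\<^esub> f x = \<zero>\<^bsub>N\<^esub>"
    using lin_map_add[OF assms(3), of "\<ominus>\<^bsub>M\<^esub> x" x] assms(4) lin_map_zero[OF assms(1-3)]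
    by (simp add: M.M.l_neg)
  then show ?thesis using lin_map_closed[OF assms(3)] assms(4) N.M.minus_equality by simp
qed

lemma inj_on_lin_mapI:
  assumes "left_module R M" "left_module R N" "lin_map R M N f"
    and "\<And>x. x \<in> carrier M \<Longrightarrow> f x = \<zero>\<^bsub>N\<^esub> \<Longrightarrow> x = \<zero>\<^bsub>M\<^esub>"
  shows "inj_on f (carrier M)"
proof (rule inj_onI)
  interpret M: left_module R M by fact
  interpret N: left_module R N by fact
  fix x y assume xy: "x \<in> carrier M" "y \<in> carrier M" "f x = f y"
  then have "f (x \<oplus>\<^bsub>M\<^esub> \<ominus>\<^bsub>M\<^esub> y) = \<zero>\<^bsub>N\<^esub>"
    using lin_map_closed[OF assms(3)]
    by (simp add: lin_map_add[OF assms(3)] lin_map_neg[OF assms(1-3)] N.M.r_neg)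
  then have "x \<oplus>\<^bsub>M\<^esub> \<ominus>\<^bsub>M\<^esub> y = \<zero>\<^bsub>M\<^esub>" using assms(4) xy by simp
  then show "x = y" using xy M.M.minus_equality[of x "\<ominus>\<^bsub>M\<^esub> y"] by simp
qed

lemma lin_map_inv_into:
  assumes "left_module R M" "lin_map R M N f" "bij_betw f (carrier M) (carrier N)"
  shows "lin_map R N M (inv_into (carrier M) f)"
proof -
  interpret M: left_module R M by fact
  let ?g = "inv_into (carrier M) f"
  have gf: "?g (f x) = x" if "x \<in> carrier M" for x
    using that assms(3) by (simp add: bij_betw_def)
  have ex: "\<exists>x\<in>carrier M. y = f x" if "y \<in> carrier N" for y
    using that assms(3) by (auto simp: bij_betw_def)
  show ?thesis
  proof (rule lin_mapI)
    fix y assume "y \<in> carrier N" then show "?g y \<in> carrier M" using ex gf by force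
  next
    fix y z assume "y \<in> carrier N" "z \<in> carrier N"
    then obtain a b where "a \<in> carrier M" "b \<in> carrier M" "y = f a" "z = f b" using ex by meson
    then show "?g (y \<oplus>\<^bsub>N\<^esub> z) = ?g y \<oplus>\<^bsub>M\<^esub> ?g z"
      by (simp add: lin_map_add[OF assms(2), symmetric] gf)
  next
    fix r y assume "r \<in> carrier R" "y \<in> carrier N"
    moreover from this obtain a where "a \<in> carrier M" "y = f a" using ex by meson
    ultimately show "?g (r \<odot>\<^bsub>N\<^esub> y) = r \<odot>\<^bsub>M\<^esub> ?g y"
      by (simp add: lin_map_smult[OF assms(2), symmetric] gf M.smult_closed)
  qed
qed

section \<open>Submodules\<close>

lemma is_submodule_lin_map: "is_submodule R M N \<Longrightarrow> lin_map R M N (\<lambda>x. x)"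
  by (auto simp: is_submodule_def lin_map_def)

lemma is_submoduleI:
  assumes "left_module R M" "left_module R N" "carrier M \<subseteq> carrier N" "lin_map R M N (\<lambda>x. x)"
  shows "is_submodule R M N"
  using assms by (auto simp: is_submodule_def lin_map_def)

lemma is_submoduleD:
  assumes "is_submodule R M N"
  shows "left_module R M" "left_module R N" "carrier M \<subseteq> carrier N"
    "x \<in> carrier M \<Longrightarrow> y \<in> carrier M \<Longrightarrow> x \<oplus>\<^bsub>M\<^esub> y = x \<oplus>\<^bsub>N\<^esub> y"
    "r \<in> carrier R \<Longrightarrow> x \<in> carrier M \<Longrightarrow> r \<odot>\<^bsub>M\<^esub> x = r \<odot>\<^bsub>N\<^esub> x"
  using assms by (auto simp: is_submodule_def)

lemma submodule_zero: "is_submodule R M N \<Longrightarrow> \<zero>\<^bsub>M\<^esub> = \<zero>\<^bsub>N\<^esub>"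
  using lin_map_zero is_submodule_lin_map is_submoduleD(1,2) by metis

lemma submodule_neg: "is_submodule R M N \<Longrightarrow> x \<in> carrier M \<Longrightarrow> \<ominus>\<^bsub>M\<^esub> x = \<ominus>\<^bsub>N\<^esub> x"
  using lin_map_neg is_submodule_lin_map is_submoduleD(1,2) by metis

lemma is_submodule_refl: "left_module R M \<Longrightarrow> is_submodule R M M"
  by (simp add: is_submodule_def)

lemma is_submodule_trans: "is_submodule R M N \<Longrightarrow> is_submodule R N P \<Longrightarrow> is_submodule R M P"
  unfolding is_submodule_def by (auto simp: subset_iff)

lemma is_submodule_of_subset:
  assumes "is_submodule R A C" "is_submodule R B C" "carrier A \<subseteq> carrier B"
  shows "is_submodule R A B"
  using assms unfolding is_submodule_def by (auto simp: subset_iff)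

lemma left_moduleI:
  assumes "ring R"
    and "\<And>x y. x \<in> carrier M \<Longrightarrow> y \<in> carrier M \<Longrightarrow> x \<oplus>\<^bsub>M\<^esub> y \<in> carrier M"
    and "\<zero>\<^bsub>M\<^esub> \<in> carrier M"
    and "\<And>x y z. x \<in> carrier M \<Longrightarrow> y \<in> carrier M \<Longrightarrow> z \<in> carrier M \<Longrightarrow>
      (x \<oplus>\<^bsub>M\<^esub> y) \<oplus>\<^bsub>M\<^esub> z = x \<oplus>\<^bsub>M\<^esub> (y \<oplus>\<^bsub>M\<^esub> z)"
    and "\<And>x y. x \<in> carrier M \<Longrightarrow> y \<in> carrier M \<Longrightarrow> x \<oplus>\<^bsub>M\<^esub> y = y \<oplus>\<^bsub>M\<^esub> x"
    and "\<And>x. x \<in> carrier M \<Longrightarrow> \<zero>\<^bsub>M\<^esub> \<oplus>\<^bsub>M\<^esub> x = x"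
    and "\<And>x. x \<in> carrier M \<Longrightarrow> \<exists>y\<in>carrier M. y \<oplus>\<^bsub>M\<^esub> x = \<zero>\<^bsub>M\<^esub>"
    and "\<And>r x. r \<in> carrier R \<Longrightarrow> x \<in> carrier M \<Longrightarrow> r \<odot>\<^bsub>M\<^esub> x \<in> carrier M"
    and "\<And>r s x. r \<in> carrier R \<Longrightarrow> s \<in> carrier R \<Longrightarrow> x \<in> carrier M \<Longrightarrow>
      (r \<oplus>\<^bsub>R\<^esub> s) \<odot>\<^bsub>M\<^esub> x = r \<odot>\<^bsub>M\<^esub> x \<oplus>\<^bsub>M\<^esub> s \<odot>\<^bsub>M\<^esub> x"
    and "\<And>r x y. r \<in> carrier R \<Longrightarrow> x \<in> carrier M \<Longrightarrow> y \<in> carrier M \<Longrightarrow>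
      r \<odot>\<^bsub>M\<^esub> (x \<oplus>\<^bsub>M\<^esub> y) = r \<odot>\<^bsub>M\<^esub> x \<oplus>\<^bsub>M\<^esub> r \<odot>\<^bsub>M\<^esub> y"
    and "\<And>r s x. r \<in> carrier R \<Longrightarrow> s \<in> carrier R \<Longrightarrow> x \<in> carrier M \<Longrightarrow>
      (r \<otimes>\<^bsub>R\<^esub> s) \<odot>\<^bsub>M\<^esub> x = r \<odot>\<^bsub>M\<^esub> (s \<odot>\<^bsub>M\<^esub> x)"
    and "\<And>x. x \<in> carrier M \<Longrightarrow> \<one>\<^bsub>R\<^esub> \<odot>\<^bsub>M\<^esub> x = x"
  shows "left_module R M"
proof -
  interpret ring R by fact
  interpret abelian_group M by (rule abelian_groupI) (use assms in auto)
  show ?thesis by unfold_locales (use assms in auto)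
qed

text \<open>
  Transport along a map into another type and passage to a quotient are the injective and the
  general case of one construction: \<open>\<pi>\<close> only has to identify points compatibly with the operations.
\<close>

definition image_module :: "('r, 'v) module \<Rightarrow> ('v \<Rightarrow> 'w) \<Rightarrow> ('r, 'w) module" where
  "image_module Q \<pi> =
     \<lparr>carrier = \<pi> ` carrier Q, mult = undefined, one = undefined, zero = \<pi> \<zero>\<^bsub>Q\<^esub>,
      add = \<lambda>u v. \<pi> (inv_into (carrier Q) \<pi> u \<oplus>\<^bsub>Q\<^esub> inv_into (carrier Q) \<pi> v),
      smult = \<lambda>r u. \<pi> (r \<odot>\<^bsub>Q\<^esub> inv_into (carrier Q) \<pi> u)\<rparr>"

lemma image_module:
  assumes Q: "left_module R Q"
    and add: "\<And>x x' y y'. x \<in> carrier Q \<Longrightarrow> x' \<in> carrier Q \<Longrightarrow> y \<in> carrier Q \<Longrightarrow> y' \<in> carrier Q \<Longrightarrow>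
      \<pi> x = \<pi> x' \<Longrightarrow> \<pi> y = \<pi> y' \<Longrightarrow> \<pi> (x \<oplus>\<^bsub>Q\<^esub> y) = \<pi> (x' \<oplus>\<^bsub>Q\<^esub> y')"
    and smult: "\<And>r x x'. r \<in> carrier R \<Longrightarrow> x \<in> carrier Q \<Longrightarrow> x' \<in> carrier Q \<Longrightarrow>
      \<pi> x = \<pi> x' \<Longrightarrow> \<pi> (r \<odot>\<^bsub>Q\<^esub> x) = \<pi> (r \<odot>\<^bsub>Q\<^esub> x')"
  shows "left_module R (image_module Q \<pi>)" "lin_map R Q (image_module Q \<pi>) \<pi>"
proof -
  interpret Q: left_module R Q by fact
  let ?P = "image_module Q \<pi>"
  have inv: "inv_into (carrier Q) \<pi> (\<pi> x) \<in> carrier Q"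
    "\<pi> (inv_into (carrier Q) \<pi> (\<pi> x)) = \<pi> x" if "x \<in> carrier Q" for x
    using that by (auto intro: inv_into_into f_inv_into_f)
  have c: "carrier ?P = \<pi> ` carrier Q" and z: "\<zero>\<^bsub>?P\<^esub> = \<pi> \<zero>\<^bsub>Q\<^esub>" by (simp_all add: image_module_def)
  have a: "\<pi> x \<oplus>\<^bsub>?P\<^esub> \<pi> y = \<pi> (x \<oplus>\<^bsub>Q\<^esub> y)" if "x \<in> carrier Q" "y \<in> carrier Q" for x y
    unfolding image_module_def by (simp, rule add) (use that inv in auto)
  have s: "r \<odot>\<^bsub>?P\<^esub> \<pi> x = \<pi> (r \<odot>\<^bsub>Q\<^esub> x)" if "r \<in> carrier R" "x \<in> carrier Q" for r x
    unfolding image_module_def by (simp, rule smult) (use that inv in auto)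
  show "left_module R ?P"
  proof (rule left_moduleI)
    fix x assume "x \<in> carrier ?P"
    then obtain y where "y \<in> carrier Q" "x = \<pi> y" unfolding c by blast
    then show "\<exists>y\<in>carrier ?P. y \<oplus>\<^bsub>?P\<^esub> x = \<zero>\<^bsub>?P\<^esub>"
      by (intro bexI[of _ "\<pi> (\<ominus>\<^bsub>Q\<^esub> y)"]) (auto simp: c a z Q.M.l_neg)
  qed (auto simp: c z a s Q.M.a_assoc Q.smult_closed Q.smult_one Q.smult_assoc
      Q.smult_l_distr Q.smult_r_distr Q.R.ring_axioms intro!: arg_cong[of _ _ \<pi>] Q.M.a_comm)
  show "lin_map R Q ?P \<pi>" by (auto intro!: lin_mapI simp: c a s)
qed

lemma carrier_image_module [simp]: "carrier (image_module Q \<pi>) = \<pi> ` carrier Q"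
  by (simp add: image_module_def)

text \<open>Negatives stay in \<open>X\<close> because they are multiples by minus one.\<close>

lemma restrict_carrier_module:
  assumes N: "left_module R N" and X: "X \<subseteq> carrier N" "\<zero>\<^bsub>N\<^esub> \<in> X"
    and add: "\<And>x y. x \<in> X \<Longrightarrow> y \<in> X \<Longrightarrow> x \<oplus>\<^bsub>N\<^esub> y \<in> X"
    and smult: "\<And>r x. r \<in> carrier R \<Longrightarrow> x \<in> X \<Longrightarrow> r \<odot>\<^bsub>N\<^esub> x \<in> X"
  shows "left_module R (N\<lparr>carrier := X\<rparr>)" "is_submodule R (N\<lparr>carrier := X\<rparr>) N"
proof -
  interpret N: left_module R N by fact
  have neg: "\<ominus>\<^bsub>N\<^esub> x \<in> X" if "x \<in> X" for x
  proof -
    have x: "x \<in> carrier N" using that X by blast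
    have "\<ominus>\<^bsub>N\<^esub> x = (\<ominus>\<^bsub>R\<^esub> \<one>\<^bsub>R\<^esub>) \<odot>\<^bsub>N\<^esub> x" using x by (simp add: N.minus_one_smult)
    then show ?thesis using smult that by simp
  qed
  have X': "x \<in> carrier N" if "x \<in> X" for x using that X by blast
  show 1: "left_module R (N\<lparr>carrier := X\<rparr>)"
  proof (rule left_moduleI)
    fix x assume "x \<in> carrier (N\<lparr>carrier := X\<rparr>)"
    then show "\<exists>y\<in>carrier (N\<lparr>carrier := X\<rparr>). y \<oplus>\<^bsub>N\<lparr>carrier := X\<rparr>\<^esub> x = \<zero>\<^bsub>N\<lparr>carrier := X\<rparr>\<^esub>"
      using neg X' by (intro bexI[of _ "\<ominus>\<^bsub>N\<^esub> x"]) (auto simp: N.M.l_neg)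
  qed (auto simp: X X' add smult N.M.a_assoc N.smult_one N.smult_assoc
      N.smult_l_distr N.smult_r_distr N.R.ring_axioms intro: N.M.a_comm)
  show "is_submodule R (N\<lparr>carrier := X\<rparr>) N" using 1 N X by (simp add: is_submodule_def)
qed

lemma submodule_restrict_carrier:
  assumes "is_submodule R M N"
  shows "is_submodule R (N\<lparr>carrier := carrier M\<rparr>) N"
proof -
  note D = is_submoduleD[OF assms]
  interpret M: left_module R M by (rule D)
  show ?thesis
  proof (rule restrict_carrier_module(2)[OF D(2) D(3)])
    show "\<zero>\<^bsub>N\<^esub> \<in> carrier M" using submodule_zero[OF assms] M.M.zero_closed by simp
    show "x \<oplus>\<^bsub>N\<^esub> y \<in> carrier M" if "x \<in> carrier M" "y \<in> carrier M" for x y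
      using D(4)[OF that] M.M.a_closed[OF that] by simp
    show "r \<odot>\<^bsub>N\<^esub> x \<in> carrier M" if "r \<in> carrier R" "x \<in> carrier M" for r x
      using D(5)[OF that] M.smult_closed[OF that] by simp
  qed
qed

lemma lin_map_image_submodule:
  assumes "left_module R M" "left_module R N" "lin_map R M N f"
  shows "is_submodule R (N\<lparr>carrier := f ` carrier M\<rparr>) N"
    "lin_map R M (N\<lparr>carrier := f ` carrier M\<rparr>) f"
proof -
  interpret M: left_module R M by fact
  show "is_submodule R (N\<lparr>carrier := f ` carrier M\<rparr>) N"
  proof (rule restrict_carrier_module(2)[OF assms(2)])
    show "f ` carrier M \<subseteq> carrier N" using lin_map_closed[OF assms(3)] by blast
    show "\<zero>\<^bsub>N\<^esub> \<in> f ` carrier M" using lin_map_zero[OF assms, symmetric] by auto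
    show "x \<oplus>\<^bsub>N\<^esub> y \<in> f ` carrier M" if "x \<in> f ` carrier M" "y \<in> f ` carrier M" for x y
      using that lin_map_add[OF assms(3), symmetric] by fastforce
    show "r \<odot>\<^bsub>N\<^esub> x \<in> f ` carrier M" if "r \<in> carrier R" "x \<in> f ` carrier M" for r x
      using that lin_map_smult[OF assms(3), symmetric] M.smult_closed by fastforce
  qed
  show "lin_map R M (N\<lparr>carrier := f ` carrier M\<rparr>) f"
    using assms(3) by (auto simp: lin_map_def)
qed

text \<open>The left-hand side of an equation as it occurs in \<open>solution\<close>, with the
  types of the unknowns and of the module freed, so that unknowns can be renamed and modules
  varied.\<close>

definition lincomb ::
  "('r, 'x) ring_scheme \<Rightarrow> ('r, 'v) module \<Rightarrow> ('i \<Rightarrow> 'r) \<Rightarrow> ('i \<Rightarrow> 'v) \<Rightarrow> 'v" where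
  "lincomb R M c s = finsum M (\<lambda>x. c x \<odot>\<^bsub>M\<^esub> s x) {x. c x \<noteq> \<zero>\<^bsub>R\<^esub>}"

definition coeffs :: "('r, 'x) ring_scheme \<Rightarrow> 'i set \<Rightarrow> ('i \<Rightarrow> 'r) set" where
  "coeffs R L = {c. (\<forall>x. c x \<in> carrier R) \<and> finite {x. c x \<noteq> \<zero>\<^bsub>R\<^esub>} \<and> {x. c x \<noteq> \<zero>\<^bsub>R\<^esub>} \<subseteq> L}"

lemma lincomb_closed:
  assumes "left_module R M" "c \<in> coeffs R L" "\<And>x. x \<in> L \<Longrightarrow> s x \<in> carrier M"
  shows "lincomb R M c s \<in> carrier M"
proof -
  interpret M: left_module R M by fact
  show ?thesis unfolding lincomb_def
    using assms(2,3) by (intro M.M.finsum_closed) (auto simp: coeffs_def intro!: M.smult_closed)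
qed

lemma lincomb_lin_map:
  assumes "left_module R M" "left_module R N" "lin_map R M N f" "c \<in> coeffs R L"
    "\<And>x. x \<in> L \<Longrightarrow> s x \<in> carrier M"
  shows "f (lincomb R M c s) = lincomb R N c (\<lambda>x. f (s x))"
proof -
  interpret M: left_module R M by fact
  interpret N: left_module R N by fact
  have "X \<subseteq> {x. c x \<noteq> \<zero>\<^bsub>R\<^esub>} \<Longrightarrow>
    f (finsum M (\<lambda>x. c x \<odot>\<^bsub>M\<^esub> s x) X) = finsum N (\<lambda>x. c x \<odot>\<^bsub>N\<^esub> f (s x)) X" if "finite X" for X
    using that
  proof (induction X rule: finite_induct)
    case empty
    then show ?case using lin_map_zero[OF assms(1-3)] by simp
  next
    case (insert x X)
    have c: "c y \<in> carrier R" for y using assms(4) by (simp add: coeffs_def)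
    have s: "s y \<in> carrier M" if "y \<in> insert x X" for y
      using that insert.prems assms(4,5) by (auto simp: coeffs_def)
    have sum: "finsum M (\<lambda>x. c x \<odot>\<^bsub>M\<^esub> s x) X \<in> carrier M"
      using s c by (intro M.M.finsum_closed) (auto intro!: M.smult_closed)
    have "f (finsum M (\<lambda>x. c x \<odot>\<^bsub>M\<^esub> s x) (insert x X))
        = f (c x \<odot>\<^bsub>M\<^esub> s x \<oplus>\<^bsub>M\<^esub> finsum M (\<lambda>x. c x \<odot>\<^bsub>M\<^esub> s x) X)"
      using insert s c by (subst M.M.finsum_insert) (auto intro!: M.smult_closed)
    also have "\<dots> = c x \<odot>\<^bsub>N\<^esub> f (s x) \<oplus>\<^bsub>N\<^esub> finsum N (\<lambda>x. c x \<odot>\<^bsub>N\<^esub> f (s x)) X"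
      using insert s c sum
      by (simp add: lin_map_add[OF assms(3)] lin_map_smult[OF assms(3)] M.smult_closed)
    also have "\<dots> = finsum N (\<lambda>x. c x \<odot>\<^bsub>N\<^esub> f (s x)) (insert x X)"
      using insert s c lin_map_closed[OF assms(3)]
      by (subst N.M.finsum_insert) (auto intro!: N.smult_closed)
    finally show ?case .
  qed
  then show ?thesis using assms(4) by (simp add: lincomb_def coeffs_def)
qed

lemma lincomb_add:
  assumes "left_module R M" "c \<in> coeffs R L"
    "\<And>x. x \<in> L \<Longrightarrow> s x \<in> carrier M" "\<And>x. x \<in> L \<Longrightarrow> t x \<in> carrier M"
  shows "lincomb R M c (\<lambda>x. s x \<oplus>\<^bsub>M\<^esub> t x) = lincomb R M c s \<oplus>\<^bsub>M\<^esub> lincomb R M c t"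
proof -
  interpret M: left_module R M by fact
  have "(\<Oplus>\<^bsub>M\<^esub>x\<in>{x. c x \<noteq> \<zero>\<^bsub>R\<^esub>}. c x \<odot>\<^bsub>M\<^esub> (s x \<oplus>\<^bsub>M\<^esub> t x))
      = (\<Oplus>\<^bsub>M\<^esub>x\<in>{x. c x \<noteq> \<zero>\<^bsub>R\<^esub>}. c x \<odot>\<^bsub>M\<^esub> s x \<oplus>\<^bsub>M\<^esub> c x \<odot>\<^bsub>M\<^esub> t x)"
    using assms(2-4)
    by (intro M.M.add.finprod_cong') (auto simp: coeffs_def intro!: M.smult_r_distr M.smult_closed M.M.a_closed)
  also have "\<dots> = lincomb R M c s \<oplus>\<^bsub>M\<^esub> lincomb R M c t"
    unfolding lincomb_def using assms(2-4)
    by (intro M.M.finsum_addf) (auto simp: coeffs_def intro!: M.smult_closed)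
  finally show ?thesis by (simp add: lincomb_def)
qed

lemma lincomb_neg:
  assumes "left_module R M" "c \<in> coeffs R L" "\<And>x. x \<in> L \<Longrightarrow> s x \<in> carrier M"
  shows "lincomb R M c (\<lambda>x. \<ominus>\<^bsub>M\<^esub> s x) = \<ominus>\<^bsub>M\<^esub> lincomb R M c s"
proof -
  interpret M: left_module R M by fact
  have "lin_map R M M (\<lambda>x. \<ominus>\<^bsub>M\<^esub> x)"
    by (rule lin_mapI) (auto simp: M.smult_r_neg M.M.minus_add)
  from lincomb_lin_map[OF assms(1,1) this assms(2,3)] show ?thesis by simp
qed

lemma lincomb_cong:
  assumes "left_module R M" "c \<in> coeffs R L" "\<And>x. x \<in> L \<Longrightarrow> s x = t x"
    "\<And>x. x \<in> L \<Longrightarrow> t x \<in> carrier M"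
  shows "lincomb R M c s = lincomb R M c t"
proof -
  interpret M: left_module R M by fact
  show ?thesis unfolding lincomb_def using assms(2-4)
    by (intro M.M.add.finprod_cong') (auto simp: coeffs_def subset_iff intro!: M.smult_closed)
qed

lemma lincomb_submodule:
  assumes "is_submodule R M N" "c \<in> coeffs R L" "\<And>x. x \<in> L \<Longrightarrow> s x \<in> carrier M"
  shows "lincomb R M c s = lincomb R N c s"
  using lincomb_lin_map[OF is_submoduleD(1,2)[OF assms(1)] is_submodule_lin_map[OF assms(1)]
      assms(2,3)] by simp

section \<open>Pushouts\<close>

definition prod_module :: "('r, 'v) module \<Rightarrow> ('r, 'w) module \<Rightarrow> ('r, 'v \<times> 'w) module" where
  "prod_module M N =
     \<lparr>carrier = carrier M \<times> carrier N, mult = undefined, one = undefined,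
      zero = (\<zero>\<^bsub>M\<^esub>, \<zero>\<^bsub>N\<^esub>), add = \<lambda>x y. (fst x \<oplus>\<^bsub>M\<^esub> fst y, snd x \<oplus>\<^bsub>N\<^esub> snd y),
      smult = \<lambda>r x. (r \<odot>\<^bsub>M\<^esub> fst x, r \<odot>\<^bsub>N\<^esub> snd x)\<rparr>"

lemma prod_module_simps [simp]:
  "carrier (prod_module M N) = carrier M \<times> carrier N"
  "\<zero>\<^bsub>prod_module M N\<^esub> = (\<zero>\<^bsub>M\<^esub>, \<zero>\<^bsub>N\<^esub>)"
  "x \<oplus>\<^bsub>prod_module M N\<^esub> y = (fst x \<oplus>\<^bsub>M\<^esub> fst y, snd x \<oplus>\<^bsub>N\<^esub> snd y)"
  "r \<odot>\<^bsub>prod_module M N\<^esub> x = (r \<odot>\<^bsub>M\<^esub> fst x, r \<odot>\<^bsub>N\<^esub> snd x)"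
  by (simp_all add: prod_module_def)

lemma prod_module:
  assumes "left_module R M" "left_module R N"
  shows "left_module R (prod_module M N)"
proof -
  interpret M: left_module R M by fact
  interpret N: left_module R N by fact
  show ?thesis
  proof (rule left_moduleI)
    fix x assume "x \<in> carrier (prod_module M N)"
    then show "\<exists>y\<in>carrier (prod_module M N). y \<oplus>\<^bsub>prod_module M N\<^esub> x = \<zero>\<^bsub>prod_module M N\<^esub>"
      by (intro bexI[of _ "(\<ominus>\<^bsub>M\<^esub> fst x, \<ominus>\<^bsub>N\<^esub> snd x)"]) (auto simp: M.M.l_neg N.M.l_neg)
  qed (auto simp: M.M.a_assoc N.M.a_assoc M.smult_closed N.smult_closed M.smult_one N.smult_one
      M.smult_assoc N.smult_assoc M.smult_l_distr N.smult_l_distr M.smult_r_distr N.smult_r_distr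
      M.R.ring_axioms intro: M.M.a_comm N.M.a_comm)
qed

text \<open>
  The pushout of \<open>N1\<close> and \<open>N2\<close> along the linear relation \<open>K\<close>, in the form of an extension of \<open>N1\<close>:
  it is \<open>(N1 \<times> N2) / K\<close>, renamed so that \<open>(x, 0)\<close> becomes \<open>x\<close>.
\<close>

lemma exists_pushout:
  fixes R :: "('r, 'x) ring_scheme" and N1 N2 :: "('r, 'u) module"
  assumes SI: "strongly_inaccessible |UNIV :: 'u set|"
    and N1: "N1 \<in> R_Mod R" and N2: "N2 \<in> R_Mod R"
    and K: "K \<subseteq> carrier N1 \<times> carrier N2" "(\<zero>\<^bsub>N1\<^esub>, \<zero>\<^bsub>N2\<^esub>) \<in> K"
    and add: "\<And>x y x' y'. (x, y) \<in> K \<Longrightarrow> (x', y') \<in> K \<Longrightarrow> (x \<oplus>\<^bsub>N1\<^esub> x', y \<oplus>\<^bsub>N2\<^esub> y') \<in> K"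
    and smult: "\<And>r x y. r \<in> carrier R \<Longrightarrow> (x, y) \<in> K \<Longrightarrow> (r \<odot>\<^bsub>N1\<^esub> x, r \<odot>\<^bsub>N2\<^esub> y) \<in> K"
    and K0: "\<And>x. (x, \<zero>\<^bsub>N2\<^esub>) \<in> K \<Longrightarrow> x = \<zero>\<^bsub>N1\<^esub>"
  shows "\<exists>P f. P \<in> R_Mod R \<and> is_submodule R N1 P \<and> lin_map R N2 P f \<and>
    (\<forall>p\<in>carrier P. \<exists>x\<in>carrier N1. \<exists>y\<in>carrier N2. p = x \<oplus>\<^bsub>P\<^esub> f y) \<and>
    (\<forall>x\<in>carrier N1. \<forall>y\<in>carrier N2. x \<oplus>\<^bsub>P\<^esub> f y = \<zero>\<^bsub>P\<^esub> \<longleftrightarrow> (x, y) \<in> K)"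
proof -
  have lm: "left_module R N1" "left_module R N2" using N1 N2 by (auto simp: R_Mod_def)
  let ?Q = "prod_module N1 N2"
  have Q: "left_module R ?Q" by (rule prod_module[OF lm])
  interpret N1: left_module R N1 by (rule lm)
  interpret N2: left_module R N2 by (rule lm)
  interpret Q: left_module R ?Q by (rule Q)
  have KQ: "K \<subseteq> carrier ?Q" using K by simp
  note subK = restrict_carrier_module[of R ?Q K, OF Q KQ]
  have sK: "is_submodule R (?Q\<lparr>carrier := K\<rparr>) ?Q"
    by (rule subK) (use K add smult in auto)
  have negK: "\<ominus>\<^bsub>?Q\<^esub> k \<in> K" if "k \<in> K" for k
    using submodule_neg[OF sK, of k] that
      abelian_group.a_inv_closed[OF left_module.axioms(2)[OF is_submoduleD(1)[OF sK]], of k] by simp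
  have addK: "k \<oplus>\<^bsub>?Q\<^esub> k' \<in> K" if "k \<in> K" "k' \<in> K" for k k'
    using add[of "fst k" "snd k" "fst k'" "snd k'"] that by simp
  have smultK: "r \<odot>\<^bsub>?Q\<^esub> k \<in> K" if "r \<in> carrier R" "k \<in> K" for r k
    using smult[of r "fst k" "snd k"] that by simp
  \<comment> \<open>The quotient map onto the cosets of \<open>K\<close>, which are sets of pairs
    and still have to be named by elements of the universe.\<close>
  define f0 where "f0 p = {p \<oplus>\<^bsub>?Q\<^esub> k | k. k \<in> K}" for p
  note [simp del] = prod_module_simps
  have f0: "f0 p = f0 q \<longleftrightarrow> (\<exists>k\<in>K. p = q \<oplus>\<^bsub>?Q\<^esub> k)" if "p \<in> carrier ?Q" "q \<in> carrier ?Q" for p q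
  proof
    assume "f0 p = f0 q"
    moreover have "p = p \<oplus>\<^bsub>?Q\<^esub> \<zero>\<^bsub>?Q\<^esub>" using that by simp
    moreover have "\<zero>\<^bsub>?Q\<^esub> \<in> K" using K(2) by (simp add: prod_module_simps(2))
    ultimately have "f0 p = f0 q" "p \<in> f0 p" unfolding f0_def by blast+
    then show "\<exists>k\<in>K. p = q \<oplus>\<^bsub>?Q\<^esub> k" by (auto simp: f0_def)
  next
    have *: "f0 p \<subseteq> f0 q" if pqk: "p = q \<oplus>\<^bsub>?Q\<^esub> k" "k \<in> K" "q \<in> carrier ?Q" for p q k
    proof
      fix x assume "x \<in> f0 p"
      then obtain k' where k': "k' \<in> K" "x = q \<oplus>\<^bsub>?Q\<^esub> k \<oplus>\<^bsub>?Q\<^esub> k'" using pqk by (auto simp: f0_def)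
      then have "x = q \<oplus>\<^bsub>?Q\<^esub> (k \<oplus>\<^bsub>?Q\<^esub> k')"
        using pqk subsetD[OF KQ k'(1)] subsetD[OF KQ pqk(2)] by (simp add: Q.M.a_assoc)
      moreover have "k \<oplus>\<^bsub>?Q\<^esub> k' \<in> K" using addK pqk(2) k'(1) .
      ultimately show "x \<in> f0 q" unfolding f0_def by blast
    qed
    assume "\<exists>k\<in>K. p = q \<oplus>\<^bsub>?Q\<^esub> k"
    then obtain k where k: "k \<in> K" "p = q \<oplus>\<^bsub>?Q\<^esub> k" by blast
    then have "q = p \<oplus>\<^bsub>?Q\<^esub> \<ominus>\<^bsub>?Q\<^esub> k" using that KQ by (auto simp: Q.M.a_assoc Q.M.r_neg)
    then show "f0 p = f0 q" using *[OF k(2,1)] *[of q p "\<ominus>\<^bsub>?Q\<^esub> k"] negK k that by blast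
  qed
  have "|f0 ` carrier ?Q| \<le>o |carrier ?Q|" by (rule card_of_image)
  moreover have "|carrier ?Q| <o |UNIV :: 'u set|"
    using N1 N2 by (simp add: R_Mod_def small_def prod_module_simps small_Times[OF SI])
  ultimately have small: "|f0 ` carrier ?Q| <o |UNIV :: 'u set|" by (rule ordLeq_ordLess_trans)
  let ?j = "\<lambda>n. (n, \<zero>\<^bsub>N2\<^esub>)"
  have j: "?j ` carrier N1 \<subseteq> carrier ?Q" by (auto simp: prod_module_simps)
  \<comment> \<open>By \<open>K0\<close> the relation contains no \<open>(x, 0)\<close> with nonzero
    \<open>x\<close>; so \<open>N1\<close> embeds into the quotient and may keep its names.\<close>
  have "inj_on (f0 \<circ> ?j) (carrier N1)"
  proof (rule inj_onI)
    fix n m assume nm: "n \<in> carrier N1" "m \<in> carrier N1" "(f0 \<circ> ?j) n = (f0 \<circ> ?j) m"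
    then have "?j n \<in> carrier ?Q" "?j m \<in> carrier ?Q" using j by blast+
    from iffD1[OF f0[OF this]] obtain k where k: "k \<in> K" "?j n = ?j m \<oplus>\<^bsub>?Q\<^esub> k"
      using nm(3) unfolding comp_apply by blast
    then have "snd k = \<zero>\<^bsub>N2\<^esub>" "n = m \<oplus>\<^bsub>N1\<^esub> fst k" using K by (auto simp: prod_module_simps)
    with k K0[of "fst k"] nm show "n = m" by (cases k) auto
  qed
  from exists_renaming[OF infinite_universe[OF SI] small this j]
  obtain \<pi> where \<pi>: "\<And>x y. x \<in> carrier ?Q \<Longrightarrow> y \<in> carrier ?Q \<Longrightarrow> \<pi> x = \<pi> y \<longleftrightarrow> f0 x = f0 y"
    and \<pi>j: "\<And>n. n \<in> carrier N1 \<Longrightarrow> \<pi> (n, \<zero>\<^bsub>N2\<^esub>) = n" by blast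
  have \<pi>K: "\<pi> x = \<pi> y \<longleftrightarrow> (\<exists>k\<in>K. x = y \<oplus>\<^bsub>?Q\<^esub> k)" if "x \<in> carrier ?Q" "y \<in> carrier ?Q" for x y
    unfolding \<pi>[OF that] f0[OF that] ..
  let ?P = "image_module ?Q \<pi>"
  have P: "left_module R ?P" "lin_map R ?Q ?P \<pi>"
  proof -
    have 1: "\<pi> (x \<oplus>\<^bsub>?Q\<^esub> y) = \<pi> (x' \<oplus>\<^bsub>?Q\<^esub> y')"
      if xy: "x \<in> carrier ?Q" "x' \<in> carrier ?Q" "y \<in> carrier ?Q" "y' \<in> carrier ?Q"
        and eq: "\<pi> x = \<pi> x'" "\<pi> y = \<pi> y'" for x x' y y'
    proof -
      obtain k l where kl: "k \<in> K" "x = x' \<oplus>\<^bsub>?Q\<^esub> k" "l \<in> K" "y = y' \<oplus>\<^bsub>?Q\<^esub> l"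
        using iffD1[OF \<pi>K[OF xy(1,2)] eq(1)] iffD1[OF \<pi>K[OF xy(3,4)] eq(2)] by blast
      then have "x \<oplus>\<^bsub>?Q\<^esub> y = (x' \<oplus>\<^bsub>?Q\<^esub> y') \<oplus>\<^bsub>?Q\<^esub> (k \<oplus>\<^bsub>?Q\<^esub> l)"
        using xy subsetD[OF KQ kl(1)] subsetD[OF KQ kl(3)] by (simp add: Q.M.a_ac)
      then have "\<exists>k\<in>K. x \<oplus>\<^bsub>?Q\<^esub> y = (x' \<oplus>\<^bsub>?Q\<^esub> y') \<oplus>\<^bsub>?Q\<^esub> k" using addK[OF kl(1,3)] by blast
      then show ?thesis using \<pi>K Q.M.a_closed xy by blast
    qed
    have 2: "\<pi> (r \<odot>\<^bsub>?Q\<^esub> x) = \<pi> (r \<odot>\<^bsub>?Q\<^esub> x')"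
      if xy: "r \<in> carrier R" "x \<in> carrier ?Q" "x' \<in> carrier ?Q" and eq: "\<pi> x = \<pi> x'" for r x x'
    proof -
      obtain k where kl: "k \<in> K" "x = x' \<oplus>\<^bsub>?Q\<^esub> k"
        using iffD1[OF \<pi>K[OF xy(2,3)] eq] by blast
      then have "r \<odot>\<^bsub>?Q\<^esub> x = r \<odot>\<^bsub>?Q\<^esub> x' \<oplus>\<^bsub>?Q\<^esub> r \<odot>\<^bsub>?Q\<^esub> k"
        using xy subsetD[OF KQ kl(1)] by (simp add: Q.smult_r_distr)
      then have "\<exists>k\<in>K. r \<odot>\<^bsub>?Q\<^esub> x = r \<odot>\<^bsub>?Q\<^esub> x' \<oplus>\<^bsub>?Q\<^esub> k" using smultK[OF xy(1) kl(1)] by blast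
      then show ?thesis using \<pi>K Q.smult_closed xy by blast
    qed
    show "left_module R ?P" "lin_map R ?Q ?P \<pi>" by (rule image_module[OF Q 1 2]; assumption)+
  qed
  have N1P: "is_submodule R N1 ?P"
  proof (rule is_submoduleI[OF lm(1) P(1)])
    show "carrier N1 \<subseteq> carrier ?P" using \<pi>j j by force
    show "lin_map R N1 ?P (\<lambda>x. x)"
    proof (rule lin_mapI)
      show "x \<in> carrier ?P" if "x \<in> carrier N1" for x using \<pi>j that j by force
      show "x \<oplus>\<^bsub>N1\<^esub> y = x \<oplus>\<^bsub>?P\<^esub> y" if "x \<in> carrier N1" "y \<in> carrier N1" for x y
        using lin_map_add[OF P(2), of "?j x" "?j y"] that by (simp add: prod_module_simps \<pi>j)
      show "r \<odot>\<^bsub>N1\<^esub> x = r \<odot>\<^bsub>?P\<^esub> x" if "r \<in> carrier R" "x \<in> carrier N1" for r x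
        using lin_map_smult[OF P(2), of r "?j x"] that
        by (simp add: prod_module_simps \<pi>j N2.smult_zero N1.smult_closed)
    qed
  qed
  let ?f = "\<lambda>y. \<pi> (\<zero>\<^bsub>N1\<^esub>, y)"
  have f: "lin_map R N2 ?P ?f"
  proof -
    have "lin_map R N2 ?Q (\<lambda>y. (\<zero>\<^bsub>N1\<^esub>, y))"
      by (rule lin_mapI) (simp_all add: prod_module_simps N1.smult_zero)
    from lin_map_comp[OF this P(2)] show ?thesis by (simp add: comp_def)
  qed
  have sum: "x \<oplus>\<^bsub>?P\<^esub> ?f y = \<pi> (x, y)" if "x \<in> carrier N1" "y \<in> carrier N2" for x y
    using lin_map_add[OF P(2), of "?j x" "(\<zero>\<^bsub>N1\<^esub>, y)"] that by (simp add: prod_module_simps \<pi>j)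
  show ?thesis
  proof (intro exI[of _ ?P] exI[of _ ?f] conjI ballI N1P f)
    have "|\<pi> ` carrier ?Q| <o |UNIV :: 'u set|"
      using card_of_image \<open>|carrier ?Q| <o |UNIV :: 'u set|\<close> by (rule ordLeq_ordLess_trans)
    then show "?P \<in> R_Mod R" using P(1) by (simp add: R_Mod_def small_def)
    show "\<exists>x\<in>carrier N1. \<exists>y\<in>carrier N2. p = x \<oplus>\<^bsub>?P\<^esub> ?f y" if "p \<in> carrier ?P" for p
      using that by (force simp: sum prod_module_simps(1))
    show "x \<oplus>\<^bsub>?P\<^esub> ?f y = \<zero>\<^bsub>?P\<^esub> \<longleftrightarrow> (x, y) \<in> K" if "x \<in> carrier N1" "y \<in> carrier N2" for x y
    proof -
      have "\<zero>\<^bsub>?P\<^esub> = \<pi> \<zero>\<^bsub>?Q\<^esub>" using lin_map_zero[OF Q P] by simp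
      then have "x \<oplus>\<^bsub>?P\<^esub> ?f y = \<zero>\<^bsub>?P\<^esub> \<longleftrightarrow> \<pi> (x, y) = \<pi> \<zero>\<^bsub>?Q\<^esub>"
        using that by (simp add: sum)
      also have "\<dots> \<longleftrightarrow> (\<exists>k\<in>K. (x, y) = \<zero>\<^bsub>?Q\<^esub> \<oplus>\<^bsub>?Q\<^esub> k)"
        using that by (intro \<pi>K) (simp_all add: prod_module_simps(1,2))
      also have "\<dots> \<longleftrightarrow> (\<exists>k\<in>K. (x, y) = k)"
        by (rule bex_cong[OF refl]) (simp add: subsetD[OF KQ])
      also have "\<dots> \<longleftrightarrow> (x, y) \<in> K" by blast
      finally show ?thesis .
    qed
  qed
qed

section \<open>Purity\<close>

lemma linear_system_iff:
  "linear_system R A S \<longleftrightarrow> (\<forall>(c, a)\<in>S. c \<in> coeffs R UNIV \<and> a \<in> carrier A)"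
  by (auto simp: linear_system_def coeffs_def)

lemma solution_iff:
  "solution R M S s \<longleftrightarrow> (\<forall>x. s x \<in> carrier M) \<and> (\<forall>(c, a)\<in>S. lincomb R M c s = a)"
  by (simp add: solution_def lincomb_def)

section \<open>From sets of equations to families over a fixed index set\<close>

definition unknowns :: "('r, 'x) ring_scheme \<Rightarrow> (('u \<Rightarrow> 'r) \<times> 'u) set \<Rightarrow> 'u set" where
  "unknowns R S = (\<Union>(c, a)\<in>S. {x. c x \<noteq> \<zero>\<^bsub>R\<^esub>})"

lemma coeffs_unknowns: "linear_system R A S \<Longrightarrow> (c, a) \<in> S \<Longrightarrow> c \<in> coeffs R (unknowns R S)"
  by (auto simp: linear_system_iff coeffs_def unknowns_def)

lemma card_of_unknowns:
  assumes "linear_system R A S" "infinite L" "|S| \<le>o |L|"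
  shows "|unknowns R S| \<le>o |L|"
  unfolding unknowns_def
proof (rule card_of_UNION_ordLeq_infinite[OF assms(2,3)], safe)
  fix c a assume "(c, a) \<in> S"
  then have "finite {x. c x \<noteq> \<zero>\<^bsub>R\<^esub>}" using assms(1) by (auto simp: linear_system_iff coeffs_def)
  then show "|{x. c x \<noteq> \<zero>\<^bsub>R\<^esub>}| \<le>o |L|"
    using assms(2) finite_ordLess_infinite[OF card_of_Well_order card_of_Well_order]
    by (metis Field_card_of ordLess_imp_ordLeq)
qed

text \<open>Only the unknowns that occur matter, so a solution may be reset elsewhere, for instance
  to zero.\<close>

lemma solution_cong:
  assumes M: "left_module R M" and S: "linear_system R A S" "solution R M S s"
    and t: "\<And>x. t x \<in> carrier M" "\<And>x. x \<in> unknowns R S \<Longrightarrow> t x = s x"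
  shows "solution R M S t"
proof -
  have "lincomb R M c t = lincomb R M c s" if "(c, a) \<in> S" for c a
    by (rule lincomb_cong[OF M coeffs_unknowns[OF S(1) that]]) (use S(2) t in \<open>auto simp: solution_iff\<close>)
  then show ?thesis using S(2) t by (auto simp: solution_iff)
qed

text \<open>Families over a fixed index set replace sets of equations. With coefficients in
  \<open>coeffs R L\<close>, the left-hand sides range over a set that depends neither on the module
  nor on the system.\<close>

definition family_solvable ::
  "('r, 'x) ring_scheme \<Rightarrow> ('r, 'v) module \<Rightarrow> 'i set \<Rightarrow> ('i \<Rightarrow> 'j \<Rightarrow> 'r) \<Rightarrow> ('i \<Rightarrow> 'v) \<Rightarrow> bool" where
  "family_solvable R M L q a \<longleftrightarrow>
     (\<exists>s. (\<forall>x. s x \<in> carrier M) \<and> (\<forall>i\<in>L. lincomb R M (q i) s = a i))"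

definition rename_coeffs :: "('r, 'x) ring_scheme \<Rightarrow> ('i \<Rightarrow> 'j) \<Rightarrow> 'i set \<Rightarrow> ('i \<Rightarrow> 'r) \<Rightarrow> 'j \<Rightarrow> 'r" where
  "rename_coeffs R \<nu> V c y = (if y \<in> \<nu> ` V then c (inv_into V \<nu> y) else \<zero>\<^bsub>R\<^esub>)"

lemma rename_coeffs:
  assumes M: "left_module R M" and \<nu>: "inj_on \<nu> V" "\<nu> ` V \<subseteq> L" and c: "c \<in> coeffs R V"
  shows "rename_coeffs R \<nu> V c \<in> coeffs R L"
    and "(\<And>x. x \<in> V \<Longrightarrow> s (\<nu> x) \<in> carrier M) \<Longrightarrow>
      lincomb R M (rename_coeffs R \<nu> V c) s = lincomb R M c (\<lambda>x. s (\<nu> x))"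
proof -
  interpret M: left_module R M by fact
  have eq: "rename_coeffs R \<nu> V c (\<nu> x) = c x" if "x \<in> V" for x
    using that \<nu>(1) by (simp add: rename_coeffs_def)
  have "{y. rename_coeffs R \<nu> V c y \<noteq> \<zero>\<^bsub>R\<^esub>} = \<nu> ` {x \<in> V. rename_coeffs R \<nu> V c (\<nu> x) \<noteq> \<zero>\<^bsub>R\<^esub>}"
    by (auto simp: rename_coeffs_def split: if_splits)
  also have "{x \<in> V. rename_coeffs R \<nu> V c (\<nu> x) \<noteq> \<zero>\<^bsub>R\<^esub>} = {x. c x \<noteq> \<zero>\<^bsub>R\<^esub>}"
    using c eq by (auto simp: coeffs_def)
  finally have supp: "{y. rename_coeffs R \<nu> V c y \<noteq> \<zero>\<^bsub>R\<^esub>} = \<nu> ` {x. c x \<noteq> \<zero>\<^bsub>R\<^esub>}" .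
  show "rename_coeffs R \<nu> V c \<in> coeffs R L"
  proof -
    have "{y. rename_coeffs R \<nu> V c y \<noteq> \<zero>\<^bsub>R\<^esub>} \<subseteq> L" "finite {y. rename_coeffs R \<nu> V c y \<noteq> \<zero>\<^bsub>R\<^esub>}"
      unfolding supp using c \<nu>(2) by (auto simp: coeffs_def)
    moreover have "rename_coeffs R \<nu> V c y \<in> carrier R" for y
      using c by (simp add: rename_coeffs_def coeffs_def)
    ultimately show ?thesis by (simp add: coeffs_def)
  qed
  assume s: "\<And>x. x \<in> V \<Longrightarrow> s (\<nu> x) \<in> carrier M"
  have V: "{x. c x \<noteq> \<zero>\<^bsub>R\<^esub>} \<subseteq> V" and cR: "\<And>x. c x \<in> carrier R" using c by (auto simp: coeffs_def)
  have "lincomb R M (rename_coeffs R \<nu> V c) s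
      = finsum M (\<lambda>x. rename_coeffs R \<nu> V c (\<nu> x) \<odot>\<^bsub>M\<^esub> s (\<nu> x)) {x. c x \<noteq> \<zero>\<^bsub>R\<^esub>}"
    unfolding lincomb_def supp using s V cR \<nu>(1) eq
    by (intro M.M.finsum_reindex) (auto intro!: M.smult_closed intro: inj_on_subset simp: subset_iff)
  also have "\<dots> = lincomb R M c (\<lambda>x. s (\<nu> x))"
    unfolding lincomb_def using s V cR eq
    by (intro M.M.add.finprod_cong') (auto intro!: M.smult_closed simp: subset_iff)
  finally show "lincomb R M (rename_coeffs R \<nu> V c) s = lincomb R M c (\<lambda>x. s (\<nu> x))" .
qed

text \<open>A system of fewer than \<open>lam\<close> equations has at most \<open>|L|\<close>
  unknowns, so its unknowns can be renamed into \<open>L\<close> and its equations enumerated by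
  \<open>L\<close> with repetitions.\<close>

lemma pp_pureI_family:
  fixes R :: "('r, 'x) ring_scheme" and A B :: "('r, 'u) module" and L :: "'u set"
  assumes AB: "A \<in> R_Mod R" "B \<in> R_Mod R" "is_submodule R A B"
    and L: "infinite L" "lam \<le>o |L|"
    and ext: "\<And>q a. q \<in> Func L (coeffs R L) \<Longrightarrow> a \<in> Func L (carrier A) \<Longrightarrow>
      family_solvable R B L q a \<Longrightarrow> family_solvable R A L q a"
  shows "pp_pure R lam A B"
  unfolding pp_pure_def
proof (intro conjI allI impI AB)
  fix S assume "linear_system R A S \<and> |S| <o lam \<and> (\<exists>s. solution R B S s)"
  then obtain s where S: "linear_system R A S" "|S| <o lam" and s: "solution R B S s" by blast
  have A: "left_module R A" and B: "left_module R B" using AB by (auto simp: R_Mod_def)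
  interpret A: left_module R A by fact
  show "\<exists>s. solution R A S s"
  \<comment> \<open>The empty system cannot be enumerated by the nonempty \<open>L\<close>; any
    assignment solves it.\<close>
  proof (cases "S = {}")
    case True
    then show ?thesis by (auto simp: solution_iff intro!: exI[of _ "\<lambda>_. \<zero>\<^bsub>A\<^esub>"])
  next
    case False
    have SL: "|S| \<le>o |L|" using S(2) L(2) ordLess_imp_ordLeq ordLeq_transitive by blast
    then obtain p where p: "p ` L = S" using False card_of_ordLeq2 by metis
    define V where "V = unknowns R S"
    have "|V| \<le>o |L|" unfolding V_def by (rule card_of_unknowns[OF S(1) L(1) SL])
    then obtain \<nu> where \<nu>: "inj_on \<nu> V" "\<nu> ` V \<subseteq> L" using card_of_ordLeq by metis
    have cV: "c \<in> coeffs R V" if "(c, a) \<in> S" for c a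
      using that S(1) by (auto simp: linear_system_iff coeffs_def V_def unknowns_def)
    have aA: "a \<in> carrier A" if "(c, a) \<in> S" for c a
      using that S(1) by (auto simp: linear_system_iff)
    define q where "q i = (if i \<in> L then rename_coeffs R \<nu> V (fst (p i)) else undefined)" for i
    define a where "a i = (if i \<in> L then snd (p i) else undefined)" for i
    have pS: "(fst (p i), snd (p i)) \<in> S" if "i \<in> L" for i using that p by auto
    have "family_solvable R A L q a"
    proof (rule ext)
      show "q \<in> Func L (coeffs R L)"
        using rename_coeffs(1)[OF A \<nu> cV[OF pS]] by (auto simp: Func_def q_def)
      show "a \<in> Func L (carrier A)" using aA[OF pS] by (auto simp: Func_def a_def)
      show "family_solvable R B L q a"
        unfolding family_solvable_def
      proof (intro exI[of _ "\<lambda>y. s (inv_into V \<nu> y)"] conjI ballI allI)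
        show "s (inv_into V \<nu> y) \<in> carrier B" for y using s by (simp add: solution_iff)
        fix i assume i: "i \<in> L"
        have "lincomb R B (q i) (\<lambda>y. s (inv_into V \<nu> y))
            = lincomb R B (fst (p i)) (\<lambda>x. s (inv_into V \<nu> (\<nu> x)))"
          using rename_coeffs(2)[OF B \<nu> cV[OF pS[OF i]], of "\<lambda>y. s (inv_into V \<nu> y)"] s i
          by (simp add: q_def solution_iff)
        also have "\<dots> = lincomb R B (fst (p i)) s"
          by (rule lincomb_cong[OF B cV[OF pS[OF i]]]) (use s \<nu>(1) in \<open>auto simp: solution_iff\<close>)
        also have "\<dots> = a i" using s pS[OF i] i by (auto simp: solution_iff a_def)
        finally show "lincomb R B (q i) (\<lambda>y. s (inv_into V \<nu> y)) = a i" .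
      qed
    qed
    then obtain t where t: "\<And>x. t x \<in> carrier A" "\<And>i. i \<in> L \<Longrightarrow> lincomb R A (q i) t = a i"
      by (auto simp: family_solvable_def)
    have "solution R A S (\<lambda>x. t (\<nu> x))"
      unfolding solution_iff
    proof (safe intro!: t(1))
      fix c b assume "(c, b) \<in> S"
      then obtain i where i: "i \<in> L" "p i = (c, b)" using p by auto
      then have "lincomb R A (rename_coeffs R \<nu> V c) t = b" using t(2)[OF i(1)] by (simp add: q_def a_def)
      then show "lincomb R A c (\<lambda>x. t (\<nu> x)) = b"
        using rename_coeffs(2)[OF A \<nu> cV[OF \<open>(c, b) \<in> S\<close>], of t] t(1) by simp
    qed
    then show ?thesis by blast
  qed
qed

lemma pp_pureD:
  assumes "pp_pure R lam A B"
  shows "A \<in> R_Mod R" "B \<in> R_Mod R" "is_submodule R A B"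
    "linear_system R A S \<Longrightarrow> |S| <o lam \<Longrightarrow> solution R B S s \<Longrightarrow> \<exists>s. solution R A S s"
  using assms unfolding pp_pure_def by blast+

lemma solution_submodule:
  assumes "is_submodule R A B" "linear_system R A S" "\<And>x. s x \<in> carrier A"
  shows "solution R A S s \<longleftrightarrow> solution R B S s"
proof -
  have "lincomb R A c s = lincomb R B c s" if "(c, a) \<in> S" for c a
    using lincomb_submodule[OF assms(1), of c UNIV s] assms(2,3) that
    by (auto simp: linear_system_iff)
  then show ?thesis using assms(3) is_submoduleD(3)[OF assms(1)] by (auto simp: solution_iff)
qed

lemma linear_system_mono: "linear_system R A S \<Longrightarrow> carrier A \<subseteq> carrier B \<Longrightarrow> linear_system R B S"
  by (auto simp: linear_system_iff)

lemma solution_closed: "solution R A S s \<Longrightarrow> s x \<in> carrier A"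
  by (simp add: solution_iff)

section \<open>Closure properties of purity\<close>

lemma pp_pure_refl: "M \<in> R_Mod R \<Longrightarrow> pp_pure R lam M M"
  by (auto simp: pp_pure_def R_Mod_def is_submodule_refl)

lemma pp_pure_trans:
  assumes "pp_pure R lam A B" "pp_pure R lam B C"
  shows "pp_pure R lam A C"
proof -
  note 1 = pp_pureD[OF assms(1)] and 2 = pp_pureD[OF assms(2)]
  have "\<exists>s. solution R A S s" if "linear_system R A S" "|S| <o lam" "solution R C S s" for S s
    using 1(4) 2(4) that linear_system_mono[OF that(1) is_submoduleD(3)[OF 1(3)]] by blast
  then show ?thesis using 1 2 is_submodule_trans unfolding pp_pure_def by blast
qed

lemma pp_pure_of_subset:
  assumes "pp_pure R lam A C" "B \<in> R_Mod R" "is_submodule R A B" "is_submodule R B C"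
  shows "pp_pure R lam A B"
proof -
  note 1 = pp_pureD[OF assms(1)]
  have "\<exists>s. solution R A S s" if S: "linear_system R A S" "|S| <o lam" "solution R B S s" for S s
  proof -
    have "linear_system R B S" using S(1) is_submoduleD(3)[OF assms(3)] by (rule linear_system_mono)
    then have "solution R C S s"
      using solution_submodule[OF assms(4)] S(3) solution_closed[OF S(3)] by blast
    then show ?thesis using 1(4) S by blast
  qed
  then show ?thesis using 1 assms unfolding pp_pure_def by blast
qed

lemma solution_lin_map:
  assumes "left_module R M" "left_module R N" "lin_map R M N f" "linear_system R A S" "solution R M S s"
  shows "solution R N ((\<lambda>(c, a). (c, f a)) ` S) (\<lambda>x. f (s x))"
  unfolding solution_iff
proof safe
  have s: "s x \<in> carrier M" for x using assms(5) by (simp add: solution_iff)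
  then show "f (s x) \<in> carrier N" for x using lin_map_closed[OF assms(3)] by blast
  fix c a assume "(c, a) \<in> S"
  then show "lincomb R N c (\<lambda>x. f (s x)) = f a"
    using lincomb_lin_map[OF assms(1-3), of c UNIV s] s assms(4,5)
    by (fastforce simp: linear_system_iff solution_iff)
qed

lemma (in abelian_group) diff_eq_diff:
  assumes "x \<in> carrier G" "y \<in> carrier G" "x' \<in> carrier G" "y' \<in> carrier G"
    and "x \<oplus> y = x' \<oplus> y'"
  shows "x \<oplus> \<ominus> x' = y' \<oplus> \<ominus> y"
proof -
  have "x \<oplus> \<ominus> x' = (x \<oplus> y) \<oplus> (\<ominus> x' \<oplus> \<ominus> y)"
    using assms(1-4) by (simp add: a_ac r_neg r_neg2 a_lcomm[of y "\<ominus> x'"])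
  also have "\<dots> = (x' \<oplus> \<ominus> x') \<oplus> (y' \<oplus> \<ominus> y)"
    unfolding assms(5) using assms(1-4) by (simp add: a_ac del: r_neg)
  finally show ?thesis using assms(1-4) by (simp add: r_neg)
qed

text \<open>The projection of a solution to \<open>A\<close> is again a solution: the
  \<open>C\<close>-component of an equation with parameter in \<open>A\<close> lies in both
  summands, so it vanishes.\<close>

lemma pp_pure_direct_summand:
  assumes AB: "A \<in> R_Mod R" "B \<in> R_Mod R" "direct_summand R A B"
  shows "pp_pure R lam A B"
proof -
  obtain C where A: "is_submodule R A B" and C: "is_submodule R C B"
    and AC: "carrier A \<inter> carrier C = {\<zero>\<^bsub>B\<^esub>}"
    and B: "carrier B = {a \<oplus>\<^bsub>B\<^esub> c | a c. a \<in> carrier A \<and> c \<in> carrier C}"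
    using AB(3) by (auto simp: direct_summand_def)
  note DA = is_submoduleD[OF A] and DC = is_submoduleD[OF C]
  interpret B: left_module R B by (rule DA)
  interpret A: left_module R A by (rule DA)
  have "\<exists>t. solution R A S t" if S: "linear_system R A S" "solution R B S s" for S s
  proof -
    have "\<forall>x. \<exists>a c. a \<in> carrier A \<and> c \<in> carrier C \<and> s x = a \<oplus>\<^bsub>B\<^esub> c"
      using solution_closed[OF S(2)] B by blast
    then obtain a c where ac: "\<And>x. a x \<in> carrier A" "\<And>x. c x \<in> carrier C" "\<And>x. s x = a x \<oplus>\<^bsub>B\<^esub> c x"
      by metis
    have inB: "a x \<in> carrier B" "c x \<in> carrier B" for x using ac(1,2) DA(3) DC(3) by auto
    have "lincomb R A q a = d" if qd: "(q, d) \<in> S" for q d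
    proof -
      have q: "q \<in> coeffs R UNIV" and d: "d \<in> carrier A" using S(1) qd by (auto simp: linear_system_iff)
      let ?a = "lincomb R A q a" and ?c = "lincomb R C q c"
      have a: "?a \<in> carrier A" and c: "?c \<in> carrier C"
        using lincomb_closed[OF DA(1) q ac(1)] lincomb_closed[OF DC(1) q ac(2)] by auto
      have dB: "d \<in> carrier B" "?a \<in> carrier B" "?c \<in> carrier B" using a c d DA(3) DC(3) by auto
      have "s = (\<lambda>x. a x \<oplus>\<^bsub>B\<^esub> c x)" using ac(3) by blast
      then have "lincomb R B q a \<oplus>\<^bsub>B\<^esub> lincomb R B q c = d"
        using S(2) qd lincomb_add[OF DA(2) q inB] by (auto simp: solution_iff)
      then have sum: "?a \<oplus>\<^bsub>B\<^esub> ?c = d" by (simp add: lincomb_submodule[OF A q ac(1)] lincomb_submodule[OF C q ac(2)])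
      then have "?c = d \<oplus>\<^bsub>B\<^esub> \<ominus>\<^bsub>B\<^esub> ?a" using dB by (simp add: sum[symmetric] B.M.a_comm[of ?a ?c] B.M.a_assoc B.M.r_neg)
      also have "\<dots> = d \<oplus>\<^bsub>A\<^esub> \<ominus>\<^bsub>A\<^esub> ?a"
        using DA(4)[OF d A.M.a_inv_closed[OF a]] submodule_neg[OF A a] by simp
      finally have "?c \<in> carrier A" using a d by simp
      then have "?c = \<zero>\<^bsub>B\<^esub>" using c AC by blast
      then show ?thesis using sum dB(2) by simp
    qed
    then have "solution R A S a" using ac(1) by (auto simp: solution_iff)
    then show ?thesis by (rule exI[where x = a])
  qed
  then show ?thesis using AB(1,2) A unfolding pp_pure_def by blast
qed

lemma R_Mod_iso:
  fixes N N' :: "('r, 'u) module"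
  assumes "N \<in> R_Mod R" "left_module R N'" "bij_betw f (carrier N) (carrier N')"
  shows "N' \<in> R_Mod R"
proof -
  have "|carrier N'| \<le>o |carrier N|" using assms(3) card_of_image unfolding bij_betw_def by metis
  then have "small (carrier N')"
    using assms(1) by (auto simp: R_Mod_def small_def intro: ordLeq_ordLess_trans)
  then show ?thesis using assms(2) by (simp add: R_Mod_def)
qed

lemma R_Mod_submodule:
  assumes "is_submodule R M N" "N \<in> R_Mod R"
  shows "M \<in> R_Mod R"
proof -
  have "|carrier M| \<le>o |carrier N|" by (rule card_of_mono1[OF is_submoduleD(3)[OF assms(1)]])
  then have "small (carrier M)"
    using assms(2) by (auto simp: R_Mod_def small_def intro: ordLeq_ordLess_trans)
  then show ?thesis using is_submoduleD(1)[OF assms(1)] by (simp add: R_Mod_def)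
qed

text \<open>The parameters are pulled back along the inverse isomorphism, the system is solved in
  \<open>M\<close>, and the solution is pushed forward.\<close>

lemma pp_pure_iso:
  assumes MN: "pp_pure R lam M N" and f: "lin_map R N N' f" "bij_betw f (carrier N) (carrier N')"
    and M': "is_submodule R M' N'" "carrier M' = f ` carrier M"
  shows "pp_pure R lam M' N'"
proof -
  note D = pp_pureD[OF MN] and D' = is_submoduleD[OF M'(1)]
  note DM = is_submoduleD[OF D(3)]
  have N': "N' \<in> R_Mod R" by (rule R_Mod_iso[OF D(2) D'(2) f(2)])
  let ?g = "inv_into (carrier N) f"
  have g: "lin_map R N' N ?g" by (rule lin_map_inv_into[OF DM(2) f])
  have gf: "?g (f x) = x" if "x \<in> carrier N" for x using f(2) that by (simp add: bij_betw_def)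
  have fM: "lin_map R M M' f"
  proof (rule lin_mapI)
    show 1: "f x \<in> carrier M'" if "x \<in> carrier M" for x using that M'(2) by blast
    show "f (x \<oplus>\<^bsub>M\<^esub> y) = f x \<oplus>\<^bsub>M'\<^esub> f y" if "x \<in> carrier M" "y \<in> carrier M" for x y
      using that 1 DM(3) lin_map_add[OF f(1)] by (simp add: DM(4) D'(4) subset_iff)
    show "f (r \<odot>\<^bsub>M\<^esub> x) = r \<odot>\<^bsub>M'\<^esub> f x" if "r \<in> carrier R" "x \<in> carrier M" for r x
      using that 1 DM(3) lin_map_smult[OF f(1)] by (simp add: DM(5) D'(5) subset_iff)
  qed
  have gM: "?g a \<in> carrier M" "f (?g a) = a" if "a \<in> carrier M'" for a
    using that gf DM(3) M'(2) by auto
  have "\<exists>s. solution R M' S s" if S: "linear_system R M' S" "|S| <o lam" "solution R N' S s" for S s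
  proof -
    let ?S = "(\<lambda>(c, a). (c, ?g a)) ` S"
    have "linear_system R M ?S" using S(1) gM(1) by (auto simp: linear_system_iff)
    moreover have "|?S| <o lam" using card_of_image S(2) by (rule ordLeq_ordLess_trans)
    moreover have "solution R N ?S (\<lambda>x. ?g (s x))" by (rule solution_lin_map[OF D'(2) DM(2) g S(1,3)])
    ultimately obtain t where t: "solution R M ?S t" using D(4) by blast
    have "solution R M' ((\<lambda>(c, a). (c, f a)) ` ?S) (\<lambda>x. f (t x))"
      by (rule solution_lin_map[OF DM(1) D'(1) fM \<open>linear_system R M ?S\<close> t])
    moreover have "(\<lambda>(c, a). (c, f a)) ` ?S = S"
    proof -
      have "(\<lambda>(c, a). (c, f a)) ` ?S = (\<lambda>x. x) ` S"
        unfolding image_image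
        by (rule image_cong[OF refl]) (use gM(2) S(1) in \<open>auto simp: linear_system_iff\<close>)
      then show ?thesis by simp
    qed
    ultimately show ?thesis by auto
  qed
  then show ?thesis using N' R_Mod_submodule[OF M'(1) N'] M'(1) unfolding pp_pure_def by blast
qed

text \<open>Each operation is evaluated in a chosen member that contains its arguments; directedness
  makes the value independent of the choice.\<close>

lemma exists_directed_union:
  fixes F :: "'i \<Rightarrow> ('r, 'u) module"
  assumes R: "ring R" and I: "I \<noteq> {}" and F: "\<And>i. i \<in> I \<Longrightarrow> left_module R (F i)"
    and dir: "\<And>i j. i \<in> I \<Longrightarrow> j \<in> I \<Longrightarrow> \<exists>k\<in>I. is_submodule R (F i) (F k) \<and> is_submodule R (F j) (F k)"
  obtains M where "carrier M = (\<Union>i\<in>I. carrier (F i))" "\<And>i. i \<in> I \<Longrightarrow> is_submodule R (F i) M"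
proof -
  define ix where "ix X = (SOME i. i \<in> I \<and> X \<subseteq> carrier (F i))" for X
  define U where "U = (\<Union>i\<in>I. carrier (F i))"
  define M :: "('r, 'u) module" where
    "M = \<lparr>carrier = U, mult = undefined, one = undefined, zero = \<zero>\<^bsub>F (ix {})\<^esub>,
      add = \<lambda>x y. x \<oplus>\<^bsub>F (ix {x, y})\<^esub> y, smult = \<lambda>r x. r \<odot>\<^bsub>F (ix {x})\<^esub> x\<rparr>"
  have ix: "ix X \<in> I" "X \<subseteq> carrier (F (ix X))" if "i \<in> I" "X \<subseteq> carrier (F i)" for i X
    using someI[of "\<lambda>i. i \<in> I \<and> X \<subseteq> carrier (F i)" i] that by (simp_all add: ix_def)
  have cM: "carrier M = U" by (simp add: M_def)
  have zero: "\<zero>\<^bsub>M\<^esub> = \<zero>\<^bsub>F i\<^esub>" if i: "i \<in> I" for i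
  proof -
    obtain k where "k \<in> I" "is_submodule R (F i) (F k)" "is_submodule R (F (ix {})) (F k)"
      using dir[OF i ix(1)[OF i]] by auto
    then show ?thesis using submodule_zero[of R "F i" "F k"] submodule_zero[of R "F (ix {})" "F k"]
      by (simp add: M_def)
  qed
  have add: "x \<oplus>\<^bsub>M\<^esub> y = x \<oplus>\<^bsub>F i\<^esub> y" if i: "i \<in> I" and xy: "x \<in> carrier (F i)" "y \<in> carrier (F i)" for i x y
  proof -
    have *: "ix {x, y} \<in> I" "{x, y} \<subseteq> carrier (F (ix {x, y}))" using ix[OF i, of "{x, y}"] xy by auto
    obtain k where "is_submodule R (F i) (F k)" "is_submodule R (F (ix {x, y})) (F k)"
      using dir[OF i *(1)] by auto
    then show ?thesis using * xy by (simp add: M_def is_submoduleD(4))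
  qed
  have smult: "r \<odot>\<^bsub>M\<^esub> x = r \<odot>\<^bsub>F i\<^esub> x"
    if i: "i \<in> I" and rx: "r \<in> carrier R" "x \<in> carrier (F i)" for i r x
  proof -
    have *: "ix {x} \<in> I" "{x} \<subseteq> carrier (F (ix {x}))" using ix[OF i, of "{x}"] rx by auto
    obtain k where "is_submodule R (F i) (F k)" "is_submodule R (F (ix {x})) (F k)"
      using dir[OF i *(1)] by auto
    then show ?thesis using * rx by (simp add: M_def is_submoduleD(5))
  qed
  have ex1: "\<exists>i\<in>I. x \<in> carrier (F i)" if "x \<in> carrier M" for x using that by (auto simp: cM U_def)
  have ex2: "\<exists>i\<in>I. x \<in> carrier (F i) \<and> y \<in> carrier (F i)" if xy: "x \<in> carrier M" "y \<in> carrier M" for x y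
  proof -
    obtain i j where ij: "i \<in> I" "x \<in> carrier (F i)" "j \<in> I" "y \<in> carrier (F j)" using xy ex1 by meson
    then obtain k where "k \<in> I" "is_submodule R (F i) (F k)" "is_submodule R (F j) (F k)"
      using dir by meson
    then show ?thesis using ij by (auto dest: is_submoduleD(3))
  qed
  have ex3: "\<exists>i\<in>I. x \<in> carrier (F i) \<and> y \<in> carrier (F i) \<and> z \<in> carrier (F i)"
    if xyz: "x \<in> carrier M" "y \<in> carrier M" "z \<in> carrier M" for x y z
  proof -
    obtain i j where ij: "i \<in> I" "x \<in> carrier (F i) \<and> y \<in> carrier (F i)" "j \<in> I" "z \<in> carrier (F j)"
      using ex2[OF xyz(1,2)] ex1[OF xyz(3)] by meson
    then obtain k where "k \<in> I" "is_submodule R (F i) (F k)" "is_submodule R (F j) (F k)"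
      using dir by meson
    then show ?thesis using ij by (auto dest: is_submoduleD(3))
  qed
  have in_M: "x \<in> carrier M" if "i \<in> I" "x \<in> carrier (F i)" for i x using that by (auto simp: cM U_def)
  have closed: "\<zero>\<^bsub>F i\<^esub> \<in> carrier (F i)"
    "x \<in> carrier (F i) \<Longrightarrow> y \<in> carrier (F i) \<Longrightarrow> x \<oplus>\<^bsub>F i\<^esub> y \<in> carrier (F i)"
    "r \<in> carrier R \<Longrightarrow> x \<in> carrier (F i) \<Longrightarrow> r \<odot>\<^bsub>F i\<^esub> x \<in> carrier (F i)"
    if i: "i \<in> I" for i x y r
  proof -
    interpret left_module R "F i" by (rule F[OF i])
    show "\<zero>\<^bsub>F i\<^esub> \<in> carrier (F i)"
      "x \<in> carrier (F i) \<Longrightarrow> y \<in> carrier (F i) \<Longrightarrow> x \<oplus>\<^bsub>F i\<^esub> y \<in> carrier (F i)"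
      "r \<in> carrier R \<Longrightarrow> x \<in> carrier (F i) \<Longrightarrow> r \<odot>\<^bsub>F i\<^esub> x \<in> carrier (F i)"
      by (simp_all add: smult_closed)
  qed
  interpret R: ring R by (rule R)
  have M: "left_module R M"
  proof (rule left_moduleI[OF R])
    fix x y z assume xyz: "x \<in> carrier M" "y \<in> carrier M" "z \<in> carrier M"
    then obtain i where i: "i \<in> I" "x \<in> carrier (F i)" "y \<in> carrier (F i)" "z \<in> carrier (F i)"
      using ex3 by meson
    interpret left_module R "F i" by (rule F[OF i(1)])
    show "x \<oplus>\<^bsub>M\<^esub> y \<in> carrier M" using i in_M closed by (simp add: add)
    show "x \<oplus>\<^bsub>M\<^esub> y \<oplus>\<^bsub>M\<^esub> z = x \<oplus>\<^bsub>M\<^esub> (y \<oplus>\<^bsub>M\<^esub> z)"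
      using i closed by (simp add: add[OF i(1)] M.a_assoc)
    show "x \<oplus>\<^bsub>M\<^esub> y = y \<oplus>\<^bsub>M\<^esub> x" using i by (simp add: add[OF i(1)] M.a_comm)
  next
    obtain i where "i \<in> I" using I by blast
    then show "\<zero>\<^bsub>M\<^esub> \<in> carrier M" using in_M closed by (simp add: zero)
  next
    fix x assume "x \<in> carrier M"
    then obtain i where i: "i \<in> I" "x \<in> carrier (F i)" using ex1 by meson
    interpret left_module R "F i" by (rule F[OF i(1)])
    show "\<zero>\<^bsub>M\<^esub> \<oplus>\<^bsub>M\<^esub> x = x" using i closed by (simp add: zero[OF i(1)] add[OF i(1)])
    show "\<one>\<^bsub>R\<^esub> \<odot>\<^bsub>M\<^esub> x = x" using i by (simp add: smult[OF i(1)] smult_one)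
    show "\<exists>y\<in>carrier M. y \<oplus>\<^bsub>M\<^esub> x = \<zero>\<^bsub>M\<^esub>"
      using i in_M by (intro bexI[of _ "\<ominus>\<^bsub>F i\<^esub> x"]) (auto simp: zero[OF i(1)] add[OF i(1)] M.l_neg)
  next
    fix r s x y assume rs: "r \<in> carrier R" "s \<in> carrier R" and xy: "x \<in> carrier M" "y \<in> carrier M"
    then obtain i where i: "i \<in> I" "x \<in> carrier (F i)" "y \<in> carrier (F i)" using ex2 by meson
    interpret left_module R "F i" by (rule F[OF i(1)])
    note [simp] = smult[OF i(1)] add[OF i(1)]
    show "r \<odot>\<^bsub>M\<^esub> (x \<oplus>\<^bsub>M\<^esub> y) = r \<odot>\<^bsub>M\<^esub> x \<oplus>\<^bsub>M\<^esub> r \<odot>\<^bsub>M\<^esub> y"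
      using i rs closed by (simp add: smult_r_distr)
  next
    fix r s x assume rs: "r \<in> carrier R" "s \<in> carrier R" and "x \<in> carrier M"
    then obtain i where i: "i \<in> I" "x \<in> carrier (F i)" using ex1 by meson
    interpret left_module R "F i" by (rule F[OF i(1)])
    note [simp] = smult[OF i(1)] add[OF i(1)]
    show "r \<odot>\<^bsub>M\<^esub> x \<in> carrier M" using i rs in_M closed by simp
    show "(r \<oplus>\<^bsub>R\<^esub> s) \<odot>\<^bsub>M\<^esub> x = r \<odot>\<^bsub>M\<^esub> x \<oplus>\<^bsub>M\<^esub> s \<odot>\<^bsub>M\<^esub> x"
      using i rs closed by (simp add: smult_l_distr)
    show "(r \<otimes>\<^bsub>R\<^esub> s) \<odot>\<^bsub>M\<^esub> x = r \<odot>\<^bsub>M\<^esub> (s \<odot>\<^bsub>M\<^esub> x)"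
      using i rs closed by (simp add: smult_assoc)
  qed
  show thesis
  proof (rule that)
    show "carrier M = (\<Union>i\<in>I. carrier (F i))" by (simp add: cM U_def)
    show "is_submodule R (F i) M" if "i \<in> I" for i
      using that F[OF that] M in_M add smult by (auto simp: is_submodule_def)
  qed
qed

section \<open>Purity yields admissible relations\<close>

lemma infinite_cardinal_Field:
  fixes lam :: "'u rel"
  assumes "infinite_cardinal lam"
  shows "infinite (Field lam)" "|Field lam| =o lam" "|Field lam| <o |UNIV :: 'u set|"
proof -
  have C: "Cinfinite lam" and s: "lam <o |UNIV :: 'u set|"
    using assms by (auto simp: infinite_cardinal_def cardinal_def)
  show "infinite (Field lam)" using C by (simp add: cinfinite_def)
  show *: "|Field lam| =o lam" by (rule card_of_Field_ordIso[OF conjunct2[OF C]])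
  show "|Field lam| <o |UNIV :: 'u set|" using * s by (rule ordIso_ordLess_trans)
qed

text \<open>\<open>cardSuc lam\<close> lives on a type of sets, so a copy on the universe type has
  to be found. It is small because the successor is at most the size of the power set.\<close>

lemma exists_successor_cardinal:
  fixes lam :: "'u rel"
  assumes SI: "strongly_inaccessible |UNIV :: 'u set|" and lam: "infinite_cardinal lam"
  obtains \<mu> :: "'u rel" where "infinite_cardinal \<mu>" "regularCard \<mu>" "\<mu> =o cardSuc lam"
proof -
  have C: "Cinfinite lam" and s: "lam <o |UNIV :: 'u set|"
    using lam by (auto simp: infinite_cardinal_def cardinal_def)
  let ?s = "cardSuc lam"
  have Cs: "Cinfinite ?s" by (rule Cinfinite_cardSuc[OF C])
  have Fl: "|Field lam| =o lam" by (rule card_of_Field_ordIso[OF conjunct2[OF C]])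
  have Fs: "|Field ?s| =o ?s" by (rule card_of_Field_ordIso[OF conjunct2[OF Cs]])
  have "lam <o |Pow (Field lam)|" by (rule Card_order_Pow[OF conjunct2[OF C]])
  then have "?s \<le>o |Pow (Field lam)|" using C by (simp add: cardSuc_least card_of_Card_order)
  moreover have "|Pow (Field lam)| <o |UNIV :: 'u set|"
    by (rule small_Pow[OF SI ordIso_ordLess_trans[OF Fl s]])
  ultimately have "?s <o |UNIV :: 'u set|" by (rule ordLeq_ordLess_trans)
  from ordIso_ordLess_trans[OF Fs this] obtain U :: "'u set"
    where U: "small U" "|Field ?s| =o |U|" by (rule small_copy[OF SI])
  have iso: "?s =o |U|" using ordIso_transitive[OF ordIso_symmetric[OF Fs] U(2)] .
  show thesis
  proof (rule that)
    show "|U| =o ?s" by (rule ordIso_symmetric[OF iso])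
    show "infinite_cardinal |U|"
      using U(1) Cinfinite_cong[OF iso Cs] by (simp add: infinite_cardinal_def cardinal_def small_def)
    show "regularCard |U|" by (rule regularCard_ordIso[OF iso Cs regularCard_cardSuc[OF C]])
  qed
qed

lemma ordLess_successor_iff:
  assumes "Card_order lam" "\<mu> =o cardSuc lam" "Card_order \<eta>"
  shows "\<eta> <o \<mu> \<longleftrightarrow> \<eta> \<le>o lam"
proof -
  have "\<eta> <o \<mu> \<longleftrightarrow> \<eta> <o cardSuc lam"
    using ordLess_ordIso_trans[OF _ assms(2)] ordLess_ordIso_trans[OF _ ordIso_symmetric[OF assms(2)]]
    by (rule iffI)
  also have "\<dots> \<longleftrightarrow> \<eta> \<le>o lam" by (rule cardSuc_ordLeq_ordLess[OF assms(1,3)])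
  finally show ?thesis .
qed

text \<open>With the successor as \<open>\<mu>\<close>, directedness bounds families of size up to
  and including \<open>lam\<close>, which covers all unknowns and all parameters of one
  system.\<close>

lemma directed_poset_upper_bound:
  assumes "directed_poset \<mu> I r" "Card_order lam" "\<mu> =o cardSuc lam" "|J| \<le>o lam" "f ` J \<subseteq> I"
  shows "\<exists>u\<in>I. \<forall>j\<in>J. (f j, u) \<in> r"
proof -
  have "|f ` J| \<le>o lam" using card_of_image assms(4) by (rule ordLeq_transitive)
  then have "|f ` J| <o \<mu>" by (rule iffD2[OF ordLess_successor_iff[OF assms(2,3) card_of_Card_order]])
  then have "\<exists>u\<in>I. \<forall>x\<in>f ` J. (x, u) \<in> r" using assms(1,5) unfolding directed_poset_def by blast
  then show ?thesis by blast
qed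

lemma directed_system_mono:
  assumes "directed_system K prec \<mu> I r F" "\<And>M. M \<in> K \<Longrightarrow> prec M M" "(i, j) \<in> r"
  shows "prec (F i) (F j)" "i \<in> I" "j \<in> I"
proof -
  have "r \<subseteq> I \<times> I" using assms(1)
    by (auto simp: directed_system_def directed_poset_def partial_order_on_def preorder_on_def refl_on_def)
  then show ij: "i \<in> I" "j \<in> I" using assms(3) by auto
  show "prec (F i) (F j)" using assms ij unfolding directed_system_def by (cases "i = j") auto
qed

locale pp_setting =
  fixes R :: "('r, 'x) ring_scheme" and lam \<mu> :: "'u rel"
  assumes SI: "strongly_inaccessible |UNIV :: 'u set|" and R: "ring R"
    and R_small: "|carrier R| <o |UNIV :: 'u set|"
    and lam: "infinite_cardinal lam" and \<mu>: "\<mu> =o cardSuc lam"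
begin

lemma Cinfinite_lam: "Cinfinite lam"
  using lam by (simp add: infinite_cardinal_def cardinal_def)

lemmas infinite_Field_lam = infinite_cardinal_Field(1)[OF lam]
  and card_of_Field_lam = infinite_cardinal_Field(2)[OF lam]
  and small_Field_lam = infinite_cardinal_Field(3)[OF lam]

lemma card_of_le_Field_lam_iff: "|X| \<le>o |Field lam| \<longleftrightarrow> |X| \<le>o lam"
  using ordLeq_ordIso_trans[OF _ card_of_Field_lam]
    ordLeq_ordIso_trans[OF _ ordIso_symmetric[OF card_of_Field_lam]] by (rule iffI)

lemma card_of_unknowns_lam:
  assumes "linear_system R A S" "|S| <o lam"
  shows "|unknowns R S| \<le>o lam"
  using card_of_unknowns[OF assms(1) infinite_Field_lam] ordLess_imp_ordLeq[OF assms(2)]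
  by (simp add: card_of_le_Field_lam_iff)

lemma directed_poset_small_upper_bound:
  assumes "directed_poset \<mu> I r" "|J| \<le>o lam" "f ` J \<subseteq> I"
  shows "\<exists>u\<in>I. \<forall>j\<in>J. (f j, u) \<in> r"
  using directed_poset_upper_bound[OF assms(1) conjunct2[OF Cinfinite_lam] \<mu> assms(2,3)] .

lemma pp_pure_directed_system:
  fixes F :: "'u \<Rightarrow> ('r, 'u) module"
  assumes sys: "directed_system (R_Mod R) (pp_pure R lam) \<mu> I r F"
  shows "I \<noteq> {}" "\<And>i j. i \<in> I \<Longrightarrow> j \<in> I \<Longrightarrow> \<exists>k\<in>I. pp_pure R lam (F i) (F k) \<and> pp_pure R lam (F j) (F k)"
    "\<And>i j. (i, j) \<in> r \<Longrightarrow> pp_pure R lam (F i) (F j)"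
proof -
  have dir: "directed_poset \<mu> I r" using sys by (simp add: directed_system_def)
  show mono: "pp_pure R lam (F i) (F j)" if "(i, j) \<in> r" for i j
    using directed_system_mono(1)[OF sys pp_pure_refl that] .
  have fin: "|J| \<le>o lam" if "finite J" for J :: "'u set"
    using that infinite_Field_lam finite_ordLess_infinite[OF card_of_Well_order card_of_Well_order, of J "Field lam"]
    by (simp add: Field_card_of ordLess_imp_ordLeq card_of_le_Field_lam_iff[symmetric])
  show "I \<noteq> {}"
    using directed_poset_small_upper_bound[OF dir fin[of "{}"], of "\<lambda>x. x"] by auto
  fix i j assume "i \<in> I" "j \<in> I"
  then obtain u where "u \<in> I" "\<And>k. k \<in> {i, j} \<Longrightarrow> (k, u) \<in> r"
    using directed_poset_small_upper_bound[OF dir fin[of "{i, j}"], of "\<lambda>x. x"] by auto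
  then show "\<exists>k\<in>I. pp_pure R lam (F i) (F k) \<and> pp_pure R lam (F j) (F k)" using mono by blast
qed

text \<open>A solution in the union uses few elements: the values at the unknowns lie in one member
  \<open>F u\<close> above \<open>F i\<close>, and there the purity of \<open>F i\<close> in
  \<open>F u\<close> applies.\<close>

lemma pp_pure_continuous:
  fixes F :: "'u \<Rightarrow> ('r, 'u) module"
  assumes sys: "directed_system (R_Mod R) (pp_pure R lam) \<mu> I r F"
  shows "\<exists>M. is_union R I F M"
    and "is_union R I F M \<Longrightarrow> M \<in> R_Mod R" "is_union R I F M \<Longrightarrow> i \<in> I \<Longrightarrow> pp_pure R lam (F i) M"
proof -
  note D = pp_pure_directed_system[OF sys]
  have F: "F i \<in> R_Mod R" if "i \<in> I" for i using sys that by (simp add: directed_system_def)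
  have lm: "left_module R (F i)" if "i \<in> I" for i using F[OF that] by (simp add: R_Mod_def)
  show "\<exists>M. is_union R I F M"
  proof -
    have dir: "\<exists>k\<in>I. is_submodule R (F i) (F k) \<and> is_submodule R (F j) (F k)" if "i \<in> I" "j \<in> I" for i j
      using D(2)[OF that] pp_pureD(3) by blast
    obtain M where "carrier M = (\<Union>i\<in>I. carrier (F i))" "\<And>i. i \<in> I \<Longrightarrow> is_submodule R (F i) M"
      using exists_directed_union[OF R D(1) lm dir] by blast
    then show ?thesis by (auto simp: is_union_def)
  qed
  assume M: "is_union R I F M"
  then have cM: "carrier M = (\<Union>i\<in>I. carrier (F i))" and sub: "\<And>i. i \<in> I \<Longrightarrow> is_submodule R (F i) M"
    by (auto simp: is_union_def)
  obtain i0 where "i0 \<in> I" using D(1) by blast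
  then have lmM: "left_module R M" using is_submoduleD(2)[OF sub] by blast
  have "|I| <o |UNIV :: 'u set|" using sys by (simp add: directed_system_def small_def)
  then have "small (carrier M)"
    unfolding cM small_def by (rule small_UNION[OF SI]) (use F in \<open>auto simp: R_Mod_def small_def\<close>)
  then show MR: "M \<in> R_Mod R" using lmM by (simp add: R_Mod_def)
  assume i: "i \<in> I"
  have "\<exists>t. solution R (F i) S t" if S: "linear_system R (F i) S" "|S| <o lam" "solution R M S s" for S s
  proof -
    let ?V = "unknowns R S"
    have "\<exists>j\<in>I. s x \<in> carrier (F j)" for x using solution_closed[OF S(3), of x] by (simp add: cM)
    then obtain j where j: "\<And>x. j x \<in> I" "\<And>x. s x \<in> carrier (F (j x))" by metis
    have dir: "directed_poset \<mu> I r" using sys by (simp add: directed_system_def)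
    have "|insert i (j ` ?V)| \<le>o |Field lam|"
    proof -
      have "|j ` ?V| \<le>o |Field lam|"
        using ordLeq_transitive[OF card_of_image card_of_unknowns_lam[OF S(1,2)]]
        by (simp add: card_of_le_Field_lam_iff)
      moreover have "|{i}| \<le>o |Field lam|"
        using infinite_Field_lam by (intro card_of_singl_ordLeq) auto
      ultimately have "|{i} \<union> j ` ?V| \<le>o |Field lam|"
        using infinite_Field_lam by (intro Un_Cinfinite_bound) (simp_all add: Cinfinite_card_of)
      then show ?thesis by simp
    qed
    then have card: "|insert i (j ` ?V)| \<le>o lam" by (simp add: card_of_le_Field_lam_iff)
    have "(\<lambda>x. x) ` insert i (j ` ?V) \<subseteq> I" using i j(1) by auto
    then have "\<exists>u\<in>I. \<forall>k\<in>insert i (j ` ?V). (k, u) \<in> r"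
      by (rule directed_poset_small_upper_bound[OF dir card])
    then obtain u where u1: "u \<in> I" "\<forall>k\<in>insert i (j ` ?V). (k, u) \<in> r" by (rule bexE)
    note u = u1(1) bspec[OF u1(2)]
    interpret u: left_module R "F u" by (rule lm[OF u(1)])
    \<comment> \<open>Off the unknowns \<open>s\<close> may leave \<open>F u\<close>, so it is reset
      to zero there.\<close>
    define t where "t x = (if x \<in> ?V then s x else \<zero>\<^bsub>F u\<^esub>)" for x
    have t: "t x \<in> carrier (F u)" for x
    proof (cases "x \<in> ?V")
      case True
      then have "is_submodule R (F (j x)) (F u)" by (intro pp_pureD(3)[OF D(3)] u(2)) simp
      from subsetD[OF is_submoduleD(3)[OF this] j(2)] show ?thesis using True by (simp add: t_def)
    qed (simp add: t_def)
    have iu: "pp_pure R lam (F i) (F u)" by (intro D(3) u(2)) simp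
    have tM: "t x \<in> carrier M" for x by (rule subsetD[OF is_submoduleD(3)[OF sub[OF u(1)]] t])
    have "solution R M S t" by (rule solution_cong[OF lmM S(1,3) tM]) (simp add: t_def)
    moreover have "linear_system R (F u) S"
      using S(1) is_submoduleD(3)[OF pp_pureD(3)[OF iu]] by (rule linear_system_mono)
    ultimately have "solution R (F u) S t" using iffD2[OF solution_submodule[OF sub[OF u(1)], where s = t]] t by blast
    with pp_pureD(4)[OF iu S(1,2)] show ?thesis .
  qed
  then show "pp_pure R lam (F i) M" using F[OF i] MR sub[OF i] unfolding pp_pure_def by blast
qed

text \<open>Here it is the parameters that are gathered in one member \<open>F u\<close>; the purity
  of \<open>F u\<close> in \<open>N\<close> then places a solution inside
  \<open>F u\<close>.\<close>

lemma pp_pure_smooth: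
  fixes F :: "'u \<Rightarrow> ('r, 'u) module"
  assumes sys: "directed_system (R_Mod R) (pp_pure R lam) \<mu> I r F"
    and N: "\<And>i. i \<in> I \<Longrightarrow> pp_pure R lam (F i) N"
    and M: "M \<in> R_Mod R" "is_union R I F M" "is_submodule R M N"
  shows "pp_pure R lam M N"
proof -
  note D = pp_pure_directed_system[OF sys]
  have cM: "carrier M = (\<Union>i\<in>I. carrier (F i))" and sub: "\<And>i. i \<in> I \<Longrightarrow> is_submodule R (F i) M"
    using M(2) by (auto simp: is_union_def)
  have dir: "directed_poset \<mu> I r" using sys by (simp add: directed_system_def)
  have "\<exists>t. solution R M S t" if S: "linear_system R M S" "|S| <o lam" "solution R N S s" for S s
  proof -
    have "\<exists>j. j \<in> I \<and> snd e \<in> carrier (F j)" if "e \<in> S" for e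
      using S(1) that by (cases e) (auto simp: linear_system_iff cM)
    then obtain j where j: "\<And>e. e \<in> S \<Longrightarrow> j e \<in> I" "\<And>e. e \<in> S \<Longrightarrow> snd e \<in> carrier (F (j e))" by metis
    then obtain u where u: "u \<in> I" "\<And>e. e \<in> S \<Longrightarrow> (j e, u) \<in> r"
      using directed_poset_small_upper_bound[OF dir ordLess_imp_ordLeq[OF S(2)], of j] by blast
    have "snd e \<in> carrier (F u)" if "e \<in> S" for e
      using is_submoduleD(3)[OF pp_pureD(3)[OF D(3)[OF u(2)[OF that]]]] j(2)[OF that] by blast
    then have Su: "linear_system R (F u) S" using S(1) by (fastforce simp: linear_system_iff)
    from pp_pureD(4)[OF N[OF u(1)] Su S(2,3)] obtain t where t: "solution R (F u) S t" ..
    have "solution R M S t"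
      using iffD1[OF solution_submodule[OF sub[OF u(1)] Su solution_closed[OF t]] t] .
    then show ?thesis by (rule exI[where x = t])
  qed
  moreover have "N \<in> R_Mod R" using D(1) pp_pureD(2)[OF N] by blast
  ultimately show ?thesis using M unfolding pp_pure_def by blast
qed

section \<open>The Loewenheim-Skolem property of purity\<close>

lemma small_module_language: "|module_language R| <o |UNIV :: 'u set|"
proof -
  have "|Scalar_sym ` carrier R| <o |UNIV :: 'u set|"
    using card_of_image R_small by (rule ordLeq_ordLess_trans)
  moreover have "|{Zero_sym, Plus_sym, Minus_sym} :: 'r module_symbol set| <o |UNIV :: 'u set|"
    by (rule small_finite[OF SI]) simp
  ultimately show ?thesis
    unfolding module_language_def using infinite_universe[OF SI] by (intro card_of_Un_ordLess_infinite)
qed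

text \<open>A coefficient vector is zero off \<open>L\<close>, so its restriction to
  \<open>L\<close> determines it.\<close>

lemma small_coeffs:
  assumes "|L :: 'l set| <o |UNIV :: 'u set|"
  shows "|coeffs R L| <o |UNIV :: 'u set|"
proof -
  have "|coeffs R L| \<le>o |Func L (carrier R)|"
  proof (rule card_of_ordLeqI)
    show "inj_on (\<lambda>c x. if x \<in> L then c x else undefined) (coeffs R L)"
    proof (intro inj_onI ext)
      fix c d x assume cd: "c \<in> coeffs R L" "d \<in> coeffs R L"
        and eq: "(\<lambda>x. if x \<in> L then c x else undefined) = (\<lambda>x. if x \<in> L then d x else undefined)"
      show "c x = d x"
      proof (cases "x \<in> L")
        case True then show ?thesis using fun_cong[OF eq, of x] by simp
      next
        case False
        then have "c x = \<zero>\<^bsub>R\<^esub>" "d x = \<zero>\<^bsub>R\<^esub>" using cd by (auto simp: coeffs_def)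
        then show ?thesis by simp
      qed
    qed
  qed (auto simp: coeffs_def Func_def)
  then show ?thesis using small_Func[OF SI assms R_small] by (rule ordLeq_ordLess_trans)
qed

end

text \<open>The base is nonempty because of the empty exponent: it gives one function into any set,
  while a nonempty set has no function into the empty set.\<close>

lemma Func_le_of_Field_le:
  assumes "A \<noteq> {}" "Card_order \<eta>" "\<eta> \<le>o lam"
  shows "|Func (Field \<eta>) A| \<le>o |Func (Field lam) A|"
proof (cases "Field \<eta> = {}")
  case True
  then have "Func (Field \<eta>) A = {\<lambda>x. undefined}" by (simp add: Func_empty)
  moreover have "Func (Field lam) A \<noteq> {}" using assms(1) Func_non_emp by blast
  ultimately show ?thesis by (simp add: card_of_singl_ordLeq)
next
  case False
  then show ?thesis
    using cexp_mono2'[OF assms(3) card_of_Card_order[of A]] by (simp add: cexp_def Field_card_of)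
qed

context pp_setting
begin

lemma card_of_Times_le:
  assumes "infinite K" "|A| \<le>o |K|" "|B| \<le>o |K|"
  shows "|A \<times> B| \<le>o |K|"
  by (rule card_of_Times_ordLeq_infinite_Field[of "|K|"])
    (use assms in \<open>simp_all add: Field_card_of card_of_card_order_on\<close>)

text \<open>A Skolem hull: \<open>A\<close> is closed under the module operations and under one
  chosen solution for each solvable \<open>L\<close>-family of equations with right-hand sides in
  the hull. \<open>K\<close> has a type of its own because it is later instantiated also by a set of
  functions.\<close>

lemma pp_pure_Loewenheim_Skolem:
  fixes K :: "'k set" and M :: "('r, 'u) module"
  defines "L \<equiv> Field lam"
  assumes K: "infinite K" "|L| \<le>o |K|" "|carrier R| \<le>o |K|" "|Func L (coeffs R L)| \<le>o |K|"
      "|Func L K| \<le>o |K|"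
    and M: "M \<in> R_Mod R" and A: "A \<subseteq> carrier M" "|A| \<le>o |K|"
  shows "\<exists>M0. A \<subseteq> carrier M0 \<and> pp_pure R lam M0 M \<and> |carrier M0| \<le>o |K|"
proof -
  have lmM: "left_module R M" using M by (simp add: R_Mod_def)
  interpret M: left_module R M by (rule lmM)
  have L: "infinite L" unfolding L_def by (rule infinite_Field_lam)
  define sol where "sol q a = (SOME s. (\<forall>x. s x \<in> carrier M) \<and> (\<forall>i\<in>L. lincomb R M (q i) s = a i))"
    for q :: "'u \<Rightarrow> 'u \<Rightarrow> 'r" and a :: "'u \<Rightarrow> 'u"
  \<comment> \<open>The family \<open>f\<close> plays two roles: one or two of its entries are the
    operands of a module operation, or all of it is the right-hand side of a system.\<close>
  define H where "H f = ((\<lambda>(i, j). f i \<oplus>\<^bsub>M\<^esub> f j) ` (L \<times> L)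
      \<union> (\<lambda>(r, i). r \<odot>\<^bsub>M\<^esub> f i) ` (carrier R \<times> L))
      \<union> (\<lambda>(q, x). sol q f x) ` (Func L (coeffs R L) \<times> L)" for f
  have H_add: "f i \<oplus>\<^bsub>M\<^esub> f j \<in> H f" if "i \<in> L" "j \<in> L" for f i j
    unfolding H_def by (intro UnI1 image_eqI[where x = "(i, j)"]) (use that in simp_all)
  have H_smult: "r \<odot>\<^bsub>M\<^esub> f i \<in> H f" if "r \<in> carrier R" "i \<in> L" for f r i
    unfolding H_def by (rule UnI1, rule UnI2, rule image_eqI[where x = "(r, i)"]) (use that in simp_all)
  have H_sol: "sol q f x \<in> H f" if "q \<in> Func L (coeffs R L)" "x \<in> L" for f q x
    unfolding H_def by (rule UnI2, rule image_eqI[where x = "(q, x)"]) (use that in simp_all)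
  have U: "|X \<union> Y| \<le>o |K|" if "|X| \<le>o |K|" "|Y| \<le>o |K|" for X Y :: "'u set"
    using that K(1) by (intro Un_Cinfinite_bound) (simp_all add: Cinfinite_card_of)
  have I: "|insert x X| \<le>o |K|" if "|X| \<le>o |K|" for x and X :: "'u set"
    using U[of "{x}" X] that K(1) card_of_singl_ordLeq[of K x] by force
  have H: "|H f| \<le>o |K|" for f
    unfolding H_def
    by (intro U ordLeq_transitive[OF card_of_image] card_of_Times_le K(1-4))
  from exists_closed_superset[of L K "insert \<zero>\<^bsub>M\<^esub> A" H, OF L K(1) I[OF A(2)] K(5) H]
  obtain X where X: "insert \<zero>\<^bsub>M\<^esub> A \<subseteq> X" "|X| \<le>o |K|" "\<forall>f\<in>Func L X. H f \<subseteq> X"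
    by blast
  \<comment> \<open>For an unsolvable system \<open>sol\<close> is an arbitrary value that may lie
    outside \<open>M\<close>; the intersection discards such points.\<close>
  define Y where "Y = X \<inter> carrier M"
  have Y: "Y \<subseteq> carrier M" "A \<subseteq> Y" "|Y| \<le>o |K|"
    using X(1,2) A(1) ordLeq_transitive[OF card_of_mono1, of Y X] by (auto simp: Y_def)
  have HY: "y \<in> Y" if "f \<in> Func L Y" "y \<in> H f" "y \<in> carrier M" for f y
  proof -
    have "f \<in> Func L X" using that(1) by (auto simp: Func_def Y_def)
    then have "H f \<subseteq> X" using X(3) by blast
    then show ?thesis using that(2,3) by (auto simp: Y_def)
  qed
  obtain i0 where i0: "i0 \<in> L" using L by fastforce
  obtain j0 where j0: "j0 \<in> L" "i0 \<noteq> j0"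
    using L infinite_imp_nonempty[of "L - {i0}"] by auto
  \<comment> \<open>Closure under the operations is read off from closure under families by placing
    the operands at the indices \<open>i0\<close> and \<open>j0\<close>.\<close>
  define c where "c x y = (\<lambda>i. if i \<in> L then if i = i0 then x else y else undefined)" for x y :: 'u
  have c: "c x y \<in> Func L Y" "c x y i0 = x" "c x y j0 = y" if "x \<in> Y" "y \<in> Y" for x y
    using that i0 j0 by (auto simp: c_def Func_def)
  have zero: "\<zero>\<^bsub>M\<^esub> \<in> Y" using X(1) M.M.zero_closed unfolding Y_def by blast
  have add: "x \<oplus>\<^bsub>M\<^esub> y \<in> Y" if xy: "x \<in> Y" "y \<in> Y" for x y
  proof (rule HY[OF c(1)[OF xy]])
    show "x \<oplus>\<^bsub>M\<^esub> y \<in> H (c x y)" using H_add[OF i0 j0(1), of "c x y"] by (simp add: c(2,3)[OF xy])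
    show "x \<oplus>\<^bsub>M\<^esub> y \<in> carrier M" using xy Y(1) by blast
  qed
  have smult: "r \<odot>\<^bsub>M\<^esub> x \<in> Y" if rx: "r \<in> carrier R" "x \<in> Y" for r x
  proof (rule HY[OF c(1)[OF rx(2,2)]])
    show "r \<odot>\<^bsub>M\<^esub> x \<in> H (c x x)" using H_smult[OF rx(1) i0, of "c x x"] by (simp add: c(2)[OF rx(2,2)])
    show "r \<odot>\<^bsub>M\<^esub> x \<in> carrier M" using rx Y(1) M.smult_closed by blast
  qed
  let ?N = "M\<lparr>carrier := Y\<rparr>"
  have N: "is_submodule R ?N M" by (rule restrict_carrier_module(2)[OF lmM Y(1) zero add smult])
  have "pp_pure R lam ?N M"
  proof (rule pp_pureI_family[OF R_Mod_submodule[OF N M] M N L])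
    show "lam \<le>o |L|" unfolding L_def
      by (rule ordIso_imp_ordLeq[OF ordIso_symmetric[OF card_of_Field_lam]])
    fix q a assume q: "q \<in> Func L (coeffs R L)" and a: "a \<in> Func L (carrier ?N)"
      and "family_solvable R M L q a"
    then have "\<exists>s. (\<forall>x. s x \<in> carrier M) \<and> (\<forall>i\<in>L. lincomb R M (q i) s = a i)"
      by (simp add: family_solvable_def)
    from someI_ex[OF this]
    have "(\<forall>x. sol q a x \<in> carrier M) \<and> (\<forall>i\<in>L. lincomb R M (q i) (sol q a) = a i)"
      unfolding sol_def .
    then have sol: "\<And>x. sol q a x \<in> carrier M" "\<And>i. i \<in> L \<Longrightarrow> lincomb R M (q i) (sol q a) = a i"
      by simp_all
    have solY: "sol q a x \<in> Y" if "x \<in> L" for x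
    proof (rule HY)
      show "a \<in> Func L Y" using a by simp
      show "sol q a x \<in> H a" by (rule H_sol[OF q that])
    qed (rule sol(1))
    let ?t = "\<lambda>x. if x \<in> L then sol q a x else \<zero>\<^bsub>M\<^esub>"
    have t: "?t x \<in> carrier ?N" for x using solY zero by simp
    have "lincomb R ?N (q i) ?t = a i" if i: "i \<in> L" for i
    proof -
      have qi: "q i \<in> coeffs R L" using q i by (auto simp: Func_def)
      have "lincomb R ?N (q i) ?t = lincomb R M (q i) ?t" by (rule lincomb_submodule[OF N qi t])
      also have "\<dots> = lincomb R M (q i) (sol q a)"
        by (rule lincomb_cong[OF lmM qi]) (simp_all add: sol(1))
      finally show ?thesis using sol(2)[OF i] by simp
    qed
    then show "family_solvable R ?N L q a"
      unfolding family_solvable_def by (intro exI[of _ ?t] conjI allI ballI t)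
  qed
  then show ?thesis using Y(2,3) by (intro exI[of _ ?N]) simp
qed

text \<open>The law \<open>(\<kappa>^lam)^lam = \<kappa>^(lam \<cdot> lam)\<close> together with
  \<open>lam \<cdot> lam = lam\<close>. It allows \<open>Func (Field lam) A\<close> to serve as
  \<open>K\<close> when \<open>A\<close> is large.\<close>

lemma Func_Func_Field_lam:
  "|Func (Field lam) (Func (Field lam) A)| \<le>o |Func (Field lam) A|"
proof -
  have LL: "|Field lam \<times> Field lam| =o |Field lam|"
    by (rule card_of_Times_same_infinite[OF infinite_Field_lam])
  have "( |A| ^c |Field lam| ) ^c |Field lam| =o |A| ^c ( |Field lam| *c |Field lam| )"
    by (rule cexp_cprod[OF card_of_Card_order])
  also have "|A| ^c ( |Field lam| *c |Field lam| ) =o |A| ^c |Field lam|"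
    by (rule cexp_cong2[OF _ card_of_Card_order Card_order_cprod])
      (use LL in \<open>simp add: cprod_def Field_card_of\<close>)
  finally show ?thesis by (simp add: cexp_def Field_card_of ordIso_imp_ordLeq)
qed

lemma card_of_le_Func:
  "|A| \<le>o |Func (Field lam) A|"
proof (rule card_of_ordLeqI)
  obtain i where i: "i \<in> Field lam" using infinite_Field_lam by fastforce
  show "inj_on (\<lambda>x i. if i \<in> Field lam then x else undefined) A"
  proof (rule inj_onI)
    fix x y assume "(\<lambda>i. if i \<in> Field lam then x else undefined) = (\<lambda>i. if i \<in> Field lam then y else undefined)"
    from fun_cong[OF this, of i] i show "x = y" by simp
  qed
qed (auto simp: Func_def)

lemma cexp_le_theta:
  fixes K :: "'u set"
  assumes K: "infinite K" "|Func (Field lam) K| \<le>o |K|" and \<eta>: "Card_order \<eta>" "\<eta> <o \<mu>"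
  shows "|K| ^c \<eta> \<le>o |K|"
proof -
  have "K \<noteq> {}" using K(1) by auto
  moreover have "\<eta> \<le>o lam"
    using ordLess_successor_iff[OF conjunct2[OF Cinfinite_lam] \<mu> \<eta>(1)] \<eta>(2) by simp
  ultimately have "|Func (Field \<eta>) K| \<le>o |Func (Field lam) K|"
    by (intro Func_le_of_Field_le \<eta>(1))
  from ordLeq_transitive[OF this K(2)] show ?thesis by (simp add: cexp_def Field_card_of)
qed

lemma lam_less: "lam <o \<mu>"
  using ordLess_successor_iff[OF conjunct2[OF Cinfinite_lam] \<mu> conjunct2[OF Cinfinite_lam]]
    ordLeq_refl[OF conjunct2[OF Cinfinite_lam]] by simp

text \<open>The exponent \<open>lam\<close> is the largest one below its successor
  \<open>\<mu>\<close>, so a cardinal that absorbs this exponent is its own weak power.\<close>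

lemma is_weak_power_theta:
  fixes K :: "'u set"
  assumes K: "infinite K" "|Func (Field lam) K| \<le>o |K|"
  shows "is_weak_power |K| \<mu> |K|"
  unfolding is_weak_power_def
proof (intro conjI allI impI card_of_Card_order)
  show "|K| ^c \<eta> \<le>o |K|" if "Card_order \<eta> \<and> \<eta> <o \<mu>" for \<eta> :: "'u rel"
    using cexp_le_theta[OF K] that by blast
  fix \<sigma> :: "'u rel"
  assume "Card_order \<sigma> \<and> (\<forall>\<eta> :: 'u rel. Card_order \<eta> \<and> \<eta> <o \<mu> \<longrightarrow> |K| ^c \<eta> \<le>o \<sigma>)"
  from spec[OF conjunct2[OF this], of lam] have "|K| ^c lam \<le>o \<sigma>" using lam_less Cinfinite_lam by simp
  then have "|Func (Field lam) K| \<le>o \<sigma>" by (simp add: cexp_def Field_card_of)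
  with card_of_le_Func show "|K| \<le>o \<sigma>" by (rule ordLeq_transitive)
qed

text \<open>\<open>is_weak_power\<close> describes a least upper bound, whose existence has to be
  shown: a copy of a function space bounds all the powers, and cardinals are well ordered.\<close>

lemma exists_weak_power:
  fixes A :: "'u set"
  assumes "|A| <o |UNIV :: 'u set|"
  shows "\<exists>\<rho> :: 'u rel. is_weak_power |A| \<mu> \<rho> \<and> |Func (Field lam) A| \<le>o \<rho>"
proof -
  \<comment> \<open>An element is added to make the base nonempty: for empty \<open>A\<close>, the
    exponent zero gives a larger power than the exponent \<open>lam\<close>.\<close>
  obtain x :: 'u where True by simp
  let ?U = "{\<sigma> :: 'u rel. Card_order \<sigma> \<and> (\<forall>\<eta> :: 'u rel. Card_order \<eta> \<and> \<eta> <o \<mu> \<longrightarrow> |A| ^c \<eta> \<le>o \<sigma>)}"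
  have "|insert x A| <o |UNIV :: 'u set|"
    using card_of_Un_ordLess_infinite[OF infinite_universe[OF SI] small_finite[OF SI, of "{x}"] assms] by simp
  from small_Func[OF SI small_Field_lam this] obtain V :: "'u set"
    where V: "small V" "|Func (Field lam) (insert x A)| =o |V|" by (rule small_copy[OF SI])
  have "|V| \<in> ?U"
  proof (intro CollectI conjI allI impI card_of_Card_order)
    fix \<eta> :: "'u rel" assume \<eta>: "Card_order \<eta> \<and> \<eta> <o \<mu>"
    have "|A| ^c \<eta> \<le>o |insert x A| ^c \<eta>" using \<eta> by (intro cexp_mono1 card_of_mono1) auto
    moreover have "|Func (Field \<eta>) (insert x A)| \<le>o |Func (Field lam) (insert x A)|"
      using \<eta> ordLess_successor_iff[OF conjunct2[OF Cinfinite_lam] \<mu>]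
      by (intro Func_le_of_Field_le) auto
    then have "|insert x A| ^c \<eta> \<le>o |V|"
      using ordLeq_ordIso_trans[OF _ V(2)] by (simp add: cexp_def Field_card_of)
    ultimately show "|A| ^c \<eta> \<le>o |V|" by (rule ordLeq_transitive)
  qed
  then have "?U \<noteq> {}" by blast
  moreover have "\<forall>\<sigma>\<in>?U. Card_order \<sigma>" by simp
  ultimately obtain \<rho> where \<rho>: "\<rho> \<in> ?U" "\<forall>\<sigma>\<in>?U. \<rho> \<le>o \<sigma>"
    using exists_minim_Card_order[of ?U] by blast
  have "is_weak_power |A| \<mu> \<rho>" unfolding is_weak_power_def using \<rho> by simp
  moreover have "|A| ^c lam \<le>o \<rho>" using \<rho>(1) lam_less Cinfinite_lam by simp
  then have "|Func (Field lam) A| \<le>o \<rho>" by (simp add: cexp_def Field_card_of)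
  ultimately show ?thesis by blast
qed

text \<open>\<open>\<theta>\<close> is chosen to absorb \<open>\<mu>\<close>, the language, the
  \<open>lam\<close>-families of coefficient vectors and the exponent \<open>lam\<close>. For a set
  \<open>A\<close> larger than \<open>\<theta>\<close> the hull is built with \<open>|A|^lam\<close>
  instead, which the weak power of \<open>|A|\<close> dominates because
  \<open>lam < \<mu>\<close>.\<close>

lemma pp_pure_Loewenheim_Skolem_number:
  assumes \<mu>_card: "infinite_cardinal \<mu>"
  shows "\<exists>\<theta> :: 'u rel. cardinal \<theta> \<and> is_weak_power \<theta> \<mu> \<theta> \<and> |module_language R| +c \<mu> \<le>o \<theta> \<and>
    (\<forall>M\<in>R_Mod R. \<forall>A\<subseteq>carrier M. \<exists>M0\<in>R_Mod R. A \<subseteq> carrier M0 \<and> pp_pure R lam M0 M \<and>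
      (\<exists>\<rho>. is_weak_power |A| \<mu> \<rho> \<and> |carrier M0| \<le>o \<rho> +c \<theta>))"
proof -
  let ?L = "Field lam"
  let ?W = "(Field \<mu> <+> module_language R) <+> Func ?L (coeffs R ?L)"
  have F\<mu>: "|Field \<mu>| =o \<mu>" and \<mu>s: "\<mu> <o |UNIV :: 'u set|"
    using \<mu>_card by (auto simp: infinite_cardinal_def cardinal_def card_of_Field_ordIso)
  have small_W: "|?W| <o |UNIV :: 'u set|"
    by (intro small_Plus[OF SI] small_Func[OF SI] small_coeffs small_Field_lam
        small_module_language ordIso_ordLess_trans[OF F\<mu> \<mu>s])
  obtain K :: "'u set" where K: "small K" "infinite K" "|?L| <o |K|" "|?W| \<le>o |K|" "|Func ?L K| \<le>o |K|"
    using exists_cardinal_Func_closed[OF SI small_Field_lam small_W infinite_Field_lam] by metis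
  have W1: "|Field \<mu> <+> module_language R| \<le>o |K|" and KC: "|Func ?L (coeffs R ?L)| \<le>o |K|"
    using ordLeq_transitive[OF card_of_Plus1 K(4)] ordLeq_transitive[OF card_of_Plus2 K(4)] by auto
  have Kl: "|module_language R| \<le>o |K|" by (rule ordLeq_transitive[OF card_of_Plus2 W1])
  have "|carrier R| \<le>o |module_language R|"
    by (rule card_of_ordLeqI[where f = Scalar_sym]) (auto simp: inj_on_def module_language_def)
  then have KR: "|carrier R| \<le>o |K|" using Kl by (rule ordLeq_transitive)
  have CK: "Cinfinite |K|" using K(2) by (simp add: Cinfinite_card_of)
  have K\<mu>: "\<mu> \<le>o |K|"
    by (rule ordIso_ordLeq_trans[OF ordIso_symmetric[OF F\<mu>] ordLeq_transitive[OF card_of_Plus1 W1]])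
  have "\<exists>M0\<in>R_Mod R. A \<subseteq> carrier M0 \<and> pp_pure R lam M0 M \<and>
      (\<exists>\<rho>. is_weak_power |A| \<mu> \<rho> \<and> |carrier M0| \<le>o \<rho> +c |K| )"
    if M: "M \<in> R_Mod R" and A: "A \<subseteq> carrier M" for M A
  proof -
    have "|carrier M| <o |UNIV :: 'u set|" using M by (simp add: R_Mod_def small_def)
    with card_of_mono1[OF A] have "|A| <o |UNIV :: 'u set|" by (rule ordLeq_ordLess_trans)
    then obtain \<rho> :: "'u rel" where \<rho>: "is_weak_power |A| \<mu> \<rho>" "|Func ?L A| \<le>o \<rho>"
      using exists_weak_power by blast
    have c\<rho>: "Card_order \<rho>" using \<rho>(1) by (simp add: is_weak_power_def)
    have "\<exists>M0. A \<subseteq> carrier M0 \<and> pp_pure R lam M0 M \<and> |carrier M0| \<le>o \<rho> +c |K|"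
    proof (cases "|A| \<le>o |K|")
      case True
      obtain M0 where M0: "A \<subseteq> carrier M0" "pp_pure R lam M0 M" "|carrier M0| \<le>o |K|"
        using pp_pure_Loewenheim_Skolem[OF K(2) ordLess_imp_ordLeq[OF K(3)] KR KC K(5) M A True] by blast
      have "|carrier M0| \<le>o \<rho> +c |K|"
        by (rule ordLeq_transitive[OF M0(3) ordLeq_csum2[OF card_of_Card_order]])
      with M0(1,2) show ?thesis by blast
    next
      case False
      then have "|K| \<le>o |A|" using ordLeq_total[OF card_of_Well_order card_of_Well_order] by blast
      then have KF: "|K| \<le>o |Func ?L A|" using card_of_le_Func by (rule ordLeq_transitive)
      then have "infinite (Func ?L A)" using K(2) card_of_ordLeq_infinite by blast
      from pp_pure_Loewenheim_Skolem[OF this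
          ordLeq_transitive[OF ordLess_imp_ordLeq[OF K(3)] KF] ordLeq_transitive[OF KR KF]
          ordLeq_transitive[OF KC KF] Func_Func_Field_lam M A card_of_le_Func]
      obtain M0 where M0: "A \<subseteq> carrier M0" "pp_pure R lam M0 M" "|carrier M0| \<le>o |Func ?L A|" by blast
      have "|carrier M0| \<le>o \<rho> +c |K|"
        by (rule ordLeq_transitive[OF ordLeq_transitive[OF M0(3) \<rho>(2)] ordLeq_csum1[OF c\<rho>]])
      with M0(1,2) show ?thesis by blast
    qed
    then show ?thesis using \<rho>(1) pp_pureD(1) by blast
  qed
  moreover have "cardinal |K|" using K(1) by (simp add: cardinal_def small_def card_of_card_order_on Field_card_of)
  moreover have "|module_language R| +c \<mu> \<le>o |K|"
    by (rule csum_cinfinite_bound[OF Kl K\<mu> card_of_Card_order _ CK])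
      (use \<mu>_card in \<open>simp add: infinite_cardinal_def cardinal_def\<close>)
  ultimately show ?thesis
    using is_weak_power_theta[OF K(2,5)] by blast
qed

lemma R_Mod_nonempty: "R_Mod R \<noteq> ({} :: ('r, 'u) module set)"
proof -
  interpret R: ring R by (rule R)
  obtain z :: 'u where True by simp
  let ?Z = "\<lparr>carrier = {z}, mult = undefined, one = undefined, zero = z,
      add = \<lambda>_ _. z, smult = \<lambda>_ _. z\<rparr> :: ('r, 'u) module"
  have "left_module R ?Z" by (rule left_moduleI[OF R]) auto
  moreover have "small {z}" unfolding small_def by (rule small_finite[OF SI]) simp
  ultimately have "?Z \<in> R_Mod R" by (simp add: R_Mod_def)
  then show ?thesis by blast
qed

lemma abstract_class_pp_pure: "abstract_class R (R_Mod R) (pp_pure R lam)"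
  unfolding abstract_class_def
proof (intro conjI allI impI ballI subset_refl R_Mod_nonempty)
  fix N N' :: "('r, 'u) module" and f
  assume N: "N \<in> R_Mod R" and *: "left_module R N' \<and> f \<in> left_module_iso R N N'"
  then have f: "lin_map R N N' f" "bij_betw f (carrier N) (carrier N')"
    by (auto simp: left_module_iso_def left_module_hom_iff)
  show "N' \<in> R_Mod R" using R_Mod_iso[OF N _ f(2)] * by blast
  fix M M' assume M: "pp_pure R lam M N \<and> is_submodule R M' N' \<and> carrier M' = f ` carrier M"
  show "pp_pure R lam M' N'"
    by (rule pp_pure_iso[OF conjunct1[OF M] f]) (use M in simp_all)
  then show "M' \<in> R_Mod R" by (rule pp_pureD(1))
qed (auto intro: pp_pure_refl pp_pure_trans dest: pp_pureD)

lemma mu_AEC_pp_pure: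
  assumes "infinite_cardinal \<mu>"
  shows "mu_AEC R (R_Mod R) (pp_pure R lam) \<mu>"
  unfolding mu_AEC_def
proof (intro conjI allI impI ballI abstract_class_pp_pure pp_pure_Loewenheim_Skolem_number[OF assms])
  fix M0 M1 M2 :: "('r, 'u) module"
  assume "M1 \<in> R_Mod R" "pp_pure R lam M0 M2 \<and> is_submodule R M0 M1 \<and> pp_pure R lam M1 M2"
  then show "pp_pure R lam M0 M1" using pp_pure_of_subset pp_pureD(3) by blast
next
  fix I r and F :: "'u \<Rightarrow> ('r, 'u) module"
  assume sys: "directed_system (R_Mod R) (pp_pure R lam) \<mu> I r F"
  show "\<exists>M. is_union R I F M" by (rule pp_pure_continuous(1)[OF sys])
  fix M assume "is_union R I F M"
  then show "M \<in> R_Mod R" "\<And>i. i \<in> I \<Longrightarrow> pp_pure R lam (F i) M"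
    using pp_pure_continuous(2,3)[OF sys] by blast+
next
  fix N M :: "('r, 'u) module" and I r F
  assume F: "directed_system (R_Mod R) (pp_pure R lam) \<mu> I r F \<and> (\<forall>i\<in>I. pp_pure R lam (F i) N)"
    and M: "M \<in> R_Mod R" "is_union R I F M \<and> is_submodule R M N"
  show "pp_pure R lam M N"
    by (rule pp_pure_smooth[OF conjunct1[OF F] _ M(1)]) (use F M(2) in simp_all)
qed

end

lemma pp_pure_admissible:
  fixes R :: "('r, 'x) ring_scheme" and lam :: "'u rel"
  assumes SI: "strongly_inaccessible |UNIV :: 'u set|" and "ring R"
    and "|carrier R| <o |UNIV :: 'u set|" and lam: "infinite_cardinal lam"
  shows "pp_pure R lam \<in> admissible_relations R"
proof -
  obtain \<mu> :: "'u rel" where m: "infinite_cardinal \<mu>" "regularCard \<mu>" "\<mu> =o cardSuc lam"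
    using exists_successor_cardinal[OF SI lam] .
  interpret pp_setting R lam \<mu> by (rule pp_setting.intro) (use assms m in auto)
  have "refines_direct_summands R (pp_pure R lam)"
    using pp_pure_direct_summand by (auto simp: refines_direct_summands_def)
  moreover have "strong_coherence R (R_Mod R) (pp_pure R lam)"
    using pp_pure_of_subset by (auto simp: strong_coherence_def)
  ultimately show ?thesis using mu_AEC_pp_pure[OF m(1)] m unfolding admissible_relations_def by blast
qed

section \<open>Cofinality of the purity relations\<close>

text \<open>Sums over different supports are compared on a common finite set, where the additional
  terms have coefficient zero.\<close>

lemma lincomb_eq_finsum:
  assumes M: "left_module R M" and c: "\<And>x. c x \<in> carrier R"
    and X: "finite X" "{x. c x \<noteq> \<zero>\<^bsub>R\<^esub>} \<subseteq> X" and s: "\<And>x. x \<in> X \<Longrightarrow> s x \<in> carrier M"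
  shows "lincomb R M c s = finsum M (\<lambda>x. c x \<odot>\<^bsub>M\<^esub> s x) X"
proof -
  interpret M: left_module R M by fact
  show ?thesis unfolding lincomb_def
    by (rule M.M.add.finprod_mono_neutral_cong_left)
      (use X s c in \<open>auto simp: M.zero_smult intro!: M.smult_closed\<close>)
qed

section \<open>Homomorphisms as solutions of linear systems\<close>

definition single :: "('r, 'x) ring_scheme \<Rightarrow> 'r \<Rightarrow> 'i \<Rightarrow> 'i \<Rightarrow> 'r" where
  "single R r x = (\<lambda>y. if y = x then r else \<zero>\<^bsub>R\<^esub>)"

lemma single_coeffs: "ring R \<Longrightarrow> r \<in> carrier R \<Longrightarrow> single R r x \<in> coeffs R UNIV"
  by (auto simp: single_def coeffs_def ring.ring_simprules)

lemma lincomb_single: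
  assumes "left_module R M" "r \<in> carrier R" "s x \<in> carrier M"
  shows "lincomb R M (single R r x) s = r \<odot>\<^bsub>M\<^esub> s x"
proof -
  interpret M: left_module R M by fact
  have "lincomb R M (single R r x) s = finsum M (\<lambda>y. single R r x y \<odot>\<^bsub>M\<^esub> s y) {x}"
    by (rule lincomb_eq_finsum) (use assms in \<open>auto simp: single_def\<close>)
  then show ?thesis using assms by (simp add: single_def M.smult_closed)
qed

lemma coeffs_plus:
  assumes "ring R" "c \<in> coeffs R L" "d \<in> coeffs R L"
  shows "(\<lambda>x. c x \<oplus>\<^bsub>R\<^esub> d x) \<in> coeffs R L"
proof -
  interpret ring R by fact
  have "{x. c x \<oplus>\<^bsub>R\<^esub> d x \<noteq> \<zero>\<^bsub>R\<^esub>} \<subseteq> {x. c x \<noteq> \<zero>\<^bsub>R\<^esub>} \<union> {x. d x \<noteq> \<zero>\<^bsub>R\<^esub>}" by auto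
  moreover from this have "finite {x. c x \<oplus>\<^bsub>R\<^esub> d x \<noteq> \<zero>\<^bsub>R\<^esub>}"
    by (rule finite_subset) (use assms(2,3) in \<open>simp add: coeffs_def\<close>)
  ultimately show ?thesis using assms(2,3) unfolding coeffs_def by blast
qed

lemma lincomb_plus:
  assumes M: "left_module R M" and cd: "c \<in> coeffs R L" "d \<in> coeffs R L"
    and s: "\<And>x. s x \<in> carrier M"
  shows "lincomb R M (\<lambda>x. c x \<oplus>\<^bsub>R\<^esub> d x) s = lincomb R M c s \<oplus>\<^bsub>M\<^esub> lincomb R M d s"
proof -
  interpret M: left_module R M by fact
  let ?X = "{x. c x \<noteq> \<zero>\<^bsub>R\<^esub>} \<union> {x. d x \<noteq> \<zero>\<^bsub>R\<^esub>}"
  have cR: "c x \<in> carrier R" "d x \<in> carrier R" for x using cd by (auto simp: coeffs_def)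
  have X: "finite ?X" using cd by (auto simp: coeffs_def)
  have "lincomb R M (\<lambda>x. c x \<oplus>\<^bsub>R\<^esub> d x) s = finsum M (\<lambda>x. (c x \<oplus>\<^bsub>R\<^esub> d x) \<odot>\<^bsub>M\<^esub> s x) ?X"
    by (rule lincomb_eq_finsum[OF M _ X]) (use cR s in auto)
  also have "\<dots> = finsum M (\<lambda>x. c x \<odot>\<^bsub>M\<^esub> s x \<oplus>\<^bsub>M\<^esub> d x \<odot>\<^bsub>M\<^esub> s x) ?X"
    using cR s by (intro M.M.add.finprod_cong') (auto simp: M.smult_l_distr M.smult_closed)
  also have "\<dots> = finsum M (\<lambda>x. c x \<odot>\<^bsub>M\<^esub> s x) ?X \<oplus>\<^bsub>M\<^esub> finsum M (\<lambda>x. d x \<odot>\<^bsub>M\<^esub> s x) ?X"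
    using cR s by (intro M.M.finsum_addf) (auto simp: M.smult_closed)
  also have "finsum M (\<lambda>x. c x \<odot>\<^bsub>M\<^esub> s x) ?X = lincomb R M c s"
    by (rule lincomb_eq_finsum[OF M _ X, symmetric]) (use cR s in auto)
  also have "finsum M (\<lambda>x. d x \<odot>\<^bsub>M\<^esub> s x) ?X = lincomb R M d s"
    by (rule lincomb_eq_finsum[OF M _ X, symmetric]) (use cR s in auto)
  finally show ?thesis .
qed

text \<open>The equations that make an assignment of the unknowns \<open>x \<in> C\<close> a homomorphism that is
  the identity on \<open>X\<close>.\<close>

definition hom_system ::
  "('r, 'x) ring_scheme \<Rightarrow> ('r, 'u) module \<Rightarrow> 'u set \<Rightarrow> (('u \<Rightarrow> 'r) \<times> 'u) set" where
  "hom_system R C X =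
     (\<lambda>(x, y). ((\<lambda>z. (single R \<one>\<^bsub>R\<^esub> x z \<oplus>\<^bsub>R\<^esub> single R \<one>\<^bsub>R\<^esub> y z) \<oplus>\<^bsub>R\<^esub>
        single R (\<ominus>\<^bsub>R\<^esub> \<one>\<^bsub>R\<^esub>) (x \<oplus>\<^bsub>C\<^esub> y) z), \<zero>\<^bsub>C\<^esub>)) ` (carrier C \<times> carrier C) \<union>
     (\<lambda>(r, x). ((\<lambda>z. single R r x z \<oplus>\<^bsub>R\<^esub> single R (\<ominus>\<^bsub>R\<^esub> \<one>\<^bsub>R\<^esub>) (r \<odot>\<^bsub>C\<^esub> x) z), \<zero>\<^bsub>C\<^esub>)) `
       (carrier R \<times> carrier C) \<union>
     (\<lambda>x. (single R \<one>\<^bsub>R\<^esub> x, x)) ` X"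

lemma linear_system_hom_system:
  assumes "ring R" "\<zero>\<^bsub>C\<^esub> \<in> carrier A" "X \<subseteq> carrier A"
  shows "linear_system R A (hom_system R C X)"
proof -
  interpret ring R by fact
  note [simp] = single_coeffs[OF assms(1)] coeffs_plus[OF assms(1)]
  show ?thesis using assms(2,3) by (auto simp: linear_system_iff hom_system_def)
qed

text \<open>One block of equations for each condition: \<open>s x + s y - s (x + y) = 0\<close>,
  then \<open>r s x - s (r x) = 0\<close>, then \<open>s x = x\<close>. The system carries the zero
  of \<open>C\<close> as its constant, hence the hypothesis that it is the zero of
  \<open>M\<close>.\<close>

lemma solution_hom_system_iff:
  assumes M: "left_module R M" and z: "\<zero>\<^bsub>C\<^esub> = \<zero>\<^bsub>M\<^esub>" and s: "\<And>x. s x \<in> carrier M"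
  shows "solution R M (hom_system R C X) s \<longleftrightarrow>
    (\<forall>x\<in>carrier C. \<forall>y\<in>carrier C. s (x \<oplus>\<^bsub>C\<^esub> y) = s x \<oplus>\<^bsub>M\<^esub> s y) \<and>
    (\<forall>r\<in>carrier R. \<forall>x\<in>carrier C. s (r \<odot>\<^bsub>C\<^esub> x) = r \<odot>\<^bsub>M\<^esub> s x) \<and> (\<forall>x\<in>X. s x = x)"
proof -
  interpret M: left_module R M by fact
  note R = M.R.ring_axioms
  have sub: "x \<oplus>\<^bsub>M\<^esub> \<ominus>\<^bsub>M\<^esub> y = \<zero>\<^bsub>M\<^esub> \<longleftrightarrow> y = x" if "x \<in> carrier M" "y \<in> carrier M" for x y
    using that M.M.minus_equality[of x "\<ominus>\<^bsub>M\<^esub> y"] by (auto simp: M.M.r_neg)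
  have add: "lincomb R M (\<lambda>z. (single R \<one>\<^bsub>R\<^esub> x z \<oplus>\<^bsub>R\<^esub> single R \<one>\<^bsub>R\<^esub> y z) \<oplus>\<^bsub>R\<^esub>
        single R (\<ominus>\<^bsub>R\<^esub> \<one>\<^bsub>R\<^esub>) w z) s = \<zero>\<^bsub>M\<^esub> \<longleftrightarrow> s w = s x \<oplus>\<^bsub>M\<^esub> s y" for x y w
    using s by (simp add: lincomb_plus[OF M coeffs_plus[OF R single_coeffs[OF R] single_coeffs[OF R]] single_coeffs[OF R] s]
        lincomb_plus[OF M single_coeffs[OF R] single_coeffs[OF R] s] lincomb_single[OF M]
        M.smult_one M.minus_one_smult sub)
  have smult: "lincomb R M (\<lambda>z. single R r x z \<oplus>\<^bsub>R\<^esub> single R (\<ominus>\<^bsub>R\<^esub> \<one>\<^bsub>R\<^esub>) w z) s = \<zero>\<^bsub>M\<^esub> \<longleftrightarrow>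
      s w = r \<odot>\<^bsub>M\<^esub> s x" if "r \<in> carrier R" for r x w
    using s that by (simp add: lincomb_plus[OF M single_coeffs[OF R] single_coeffs[OF R] s]
        lincomb_single[OF M] M.smult_one M.minus_one_smult M.smult_closed sub)
  have id: "lincomb R M (single R \<one>\<^bsub>R\<^esub> x) s = s x" for x
    using s by (simp add: lincomb_single[OF M] M.smult_one)
  show ?thesis unfolding solution_iff hom_system_def z ball_Un
    by (simp add: s add smult id conj_assoc)
qed

lemma card_of_hom_system:
  assumes K: "Cinfinite \<theta>" "|carrier R| \<le>o \<theta>" "|carrier C| \<le>o \<theta>" "|X| \<le>o \<theta>"
  shows "|hom_system R C X| \<le>o \<theta>"
proof -
  have T: "|Y \<times> Z| \<le>o \<theta>" if "|Y| \<le>o \<theta>" "|Z| \<le>o \<theta>" for Y :: "'y set" and Z :: "'z set"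
    using that K(1) by (intro card_of_Times_ordLeq_infinite_Field) (auto simp: cinfinite_def)
  show ?thesis unfolding hom_system_def
    by (intro Un_Cinfinite_bound ordLeq_transitive[OF card_of_image] T card_of_Times_ordLeq_infinite_Field K)
     (use K(1) in \<open>auto simp: cinfinite_def\<close>)
qed

section \<open>An admissible relation with a fixed Loewenheim-Skolem number\<close>

locale admissible_relation =
  fixes R :: "('r, 'x) ring_scheme" and prec :: "('r, 'u) module \<Rightarrow> ('r, 'u) module \<Rightarrow> bool"
    and \<mu> \<theta> :: "'u rel"
  assumes SI: "strongly_inaccessible |UNIV :: 'u set|" and R: "ring R"
    and summands: "refines_direct_summands R prec"
    and \<mu>: "infinite_cardinal \<mu>"
    and AEC: "mu_AEC R (R_Mod R) prec \<mu>"
    and strong: "strong_coherence R (R_Mod R) prec"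
    and \<theta>: "cardinal \<theta>" "is_weak_power \<theta> \<mu> \<theta>" "|module_language R| +c \<mu> \<le>o \<theta>"
    and LS: "\<forall>M\<in>R_Mod R. \<forall>A\<subseteq>carrier M. \<exists>M0\<in>R_Mod R. A \<subseteq> carrier M0 \<and> prec M0 M \<and>
           (\<exists>\<rho>. is_weak_power |A| \<mu> \<rho> \<and> |carrier M0| \<le>o \<rho> +c \<theta>)"
begin

lemma abstract_class_prec: "abstract_class R (R_Mod R) prec"
  using AEC unfolding mu_AEC_def by (elim conjE)

lemma precD:
  assumes "prec M N"
  shows "M \<in> R_Mod R" "N \<in> R_Mod R" "is_submodule R M N"
proof -
  have "\<forall>M N. prec M N \<longrightarrow> M \<in> R_Mod R \<and> N \<in> R_Mod R \<and> is_submodule R M N"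
    using abstract_class_prec unfolding abstract_class_def by (elim conjE)
  then show "M \<in> R_Mod R" "N \<in> R_Mod R" "is_submodule R M N" using assms by simp_all
qed

lemma prec_refl: "M \<in> R_Mod R \<Longrightarrow> prec M M"
proof -
  have "\<forall>M\<in>R_Mod R. prec M M"
    using abstract_class_prec unfolding abstract_class_def by (elim conjE)
  then show "M \<in> R_Mod R \<Longrightarrow> prec M M" by simp
qed

lemma prec_trans:
  assumes "prec M N" "prec N P"
  shows "prec M P"
proof -
  have "\<forall>M N P. prec M N \<and> prec N P \<longrightarrow> prec M P"
    using abstract_class_prec unfolding abstract_class_def by (elim conjE)
  from mp[OF spec[OF spec[OF spec[OF this]]] conjI[OF assms]] show ?thesis .
qed

lemma prec_iso:
  assumes "prec M N" "left_module R N'" "lin_map R N N' f" "bij_betw f (carrier N) (carrier N')"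
    "is_submodule R M' N'" "carrier M' = f ` carrier M"
  shows "prec M' N'"
proof -
  have "f \<in> left_module_iso R N N'" using assms(3,4) by (simp add: left_module_iso_def left_module_hom_iff)
  moreover have "\<forall>N\<in>R_Mod R. \<forall>N' f. left_module R N' \<and> f \<in> left_module_iso R N N' \<longrightarrow>
        N' \<in> R_Mod R \<and>
        (\<forall>M M'. prec M N \<and> is_submodule R M' N' \<and> carrier M' = f ` carrier M \<longrightarrow>
           M' \<in> R_Mod R \<and> prec M' N')"
    using abstract_class_prec unfolding abstract_class_def by (elim conjE)
  ultimately show ?thesis using assms(1,2,5,6) precD(2)[OF assms(1)] by blast
qed

text \<open>Records with the same carrier may differ in meaningless fields. Closure under
  isomorphism, applied to the identity of \<open>N\<close>, makes \<open>prec\<close> insensitive to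
  this in its first argument.\<close>

lemma prec_cong:
  assumes "prec M N" "is_submodule R M' N" "carrier M' = carrier M"
  shows "prec M' N"
  by (rule prec_iso[OF assms(1) is_submoduleD(2)[OF assms(2)], where f = "\<lambda>x. x"])
    (use assms in \<open>simp_all add: lin_map_def bij_betw_def\<close>)

lemma prec_of_subset:
  assumes "prec A C" "B \<in> R_Mod R" "is_submodule R A B" "is_submodule R B C"
  shows "prec A B"
  using strong assms precD[OF assms(1)] unfolding strong_coherence_def by blast

lemma Cinfinite_\<theta>: "Cinfinite \<theta>"
proof -
  have "Card_order \<theta>" using \<theta>(1) by (simp add: cardinal_def)
  moreover have "Cinfinite \<mu>" using \<mu> by (simp add: infinite_cardinal_def cardinal_def)
  then have "\<mu> \<le>o \<theta>" using ordLeq_csum2 \<theta>(3) ordLeq_transitive by blast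
  then have "cinfinite \<theta>" by (rule cinfinite_mono) (use \<open>Cinfinite \<mu>\<close> in blast)
  ultimately show ?thesis by blast
qed

lemma \<mu>_le: "\<mu> \<le>o \<theta>"
  using ordLeq_transitive[OF ordLeq_csum2 \<theta>(3)] \<mu> by (simp add: infinite_cardinal_def cardinal_def)

lemma card_of_ring_le: "|carrier R| \<le>o \<theta>"
proof -
  have "|carrier R| \<le>o |module_language R|"
    by (rule card_of_ordLeqI[where f = Scalar_sym]) (auto simp: inj_on_def module_language_def)
  then show ?thesis
    by (rule ordLeq_transitive[OF _ ordLeq_transitive[OF ordLeq_csum1[OF card_of_Card_order] \<theta>(3)]])
qed

text \<open>Since \<open>\<theta>\<close> is its own weak power, the Loewenheim-Skolem bound
  collapses to \<open>\<theta>\<close> for sets of size at most \<open>\<theta>\<close>.\<close>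

lemma exists_small_submodel:
  assumes M: "M \<in> R_Mod R" and A: "A \<subseteq> carrier M" "|A| \<le>o \<theta>"
  shows "\<exists>M0. A \<subseteq> carrier M0 \<and> prec M0 M \<and> |carrier M0| \<le>o \<theta>"
proof -
  obtain M0 \<rho> where M0: "A \<subseteq> carrier M0" "prec M0 M" "is_weak_power |A| \<mu> \<rho>" "|carrier M0| \<le>o \<rho> +c \<theta>"
    using LS M A(1) by blast
  have pow: "|A| ^c \<eta> \<le>o \<theta>" if \<eta>: "Card_order \<eta> \<and> \<eta> <o \<mu>" for \<eta> :: "'u rel"
  proof -
    have "|A| ^c \<eta> \<le>o \<theta> ^c \<eta>" by (rule cexp_mono1[OF A(2) conjunct1[OF \<eta>]])
    moreover have "\<theta> ^c \<eta> \<le>o \<theta>" using \<theta>(2) \<eta> unfolding is_weak_power_def by blast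
    ultimately show ?thesis by (rule ordLeq_transitive)
  qed
  then have "\<rho> \<le>o \<theta>" using M0(3) Cinfinite_\<theta> unfolding is_weak_power_def by blast
  moreover have "Card_order \<rho>" using M0(3) by (simp add: is_weak_power_def)
  ultimately have "\<rho> +c \<theta> \<le>o \<theta>"
    using csum_cinfinite_bound[OF _ ordLeq_refl _ _ Cinfinite_\<theta>] Cinfinite_\<theta> by blast
  then have "|carrier M0| \<le>o \<theta>" by (rule ordLeq_transitive[OF M0(4)])
  then show ?thesis using M0(1,2) by blast
qed

text \<open>
  The map \<open>h\<close> makes the pushout \<open>P\<close> of \<open>A\<close> and \<open>C\<close> over \<open>A0\<close> retract onto \<open>A\<close>, so that
  \<open>prec A P\<close> and then \<open>prec A0 P\<close>; strong coherence gives \<open>prec A0 C\<close> for the copy of \<open>C\<close> in \<open>P\<close>.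
\<close>

lemma prec_of_retraction:
  assumes A0: "prec A0 A" and C: "C \<in> R_Mod R" "is_submodule R A0 C"
    and h: "lin_map R C A h" "\<And>a. a \<in> carrier A0 \<Longrightarrow> h a = a"
  shows "prec A0 C"
proof -
  note pD = precD[OF A0]
  note D = is_submoduleD[OF pD(3)] and E = is_submoduleD[OF C(2)]
  interpret A: left_module R A by (rule D)
  interpret C: left_module R C by (rule E)
  interpret A0: left_module R A0 by (rule D)
  \<comment> \<open>The sign is due to the form of the kernel in the pushout: \<open>(a, -a)\<close>
    in the relation means \<open>a + f (-a) = 0\<close>, that is \<open>f a = a\<close>.\<close>
  let ?K = "(\<lambda>a. (a, \<ominus>\<^bsub>C\<^esub> a)) ` carrier A0"
  have neg_zero: "\<ominus>\<^bsub>C\<^esub> \<zero>\<^bsub>C\<^esub> = \<zero>\<^bsub>C\<^esub>" using C.M.minus_equality[of "\<zero>\<^bsub>C\<^esub>" "\<zero>\<^bsub>C\<^esub>"] by simp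
  have inA: "a \<in> carrier A" and inC: "a \<in> carrier C" if "a \<in> carrier A0" for a using that D(3) E(3) by auto
  have "\<exists>P f. P \<in> R_Mod R \<and> is_submodule R A P \<and> lin_map R C P f \<and>
    (\<forall>p\<in>carrier P. \<exists>x\<in>carrier A. \<exists>y\<in>carrier C. p = x \<oplus>\<^bsub>P\<^esub> f y) \<and>
    (\<forall>x\<in>carrier A. \<forall>y\<in>carrier C. x \<oplus>\<^bsub>P\<^esub> f y = \<zero>\<^bsub>P\<^esub> \<longleftrightarrow> (x, y) \<in> ?K)"
  proof (rule exists_pushout[OF SI pD(2) C(1), of ?K])
    show "?K \<subseteq> carrier A \<times> carrier C" using inA inC by auto
    have "\<zero>\<^bsub>C\<^esub> \<in> carrier A0" "\<zero>\<^bsub>A\<^esub> = \<zero>\<^bsub>C\<^esub>"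
      using submodule_zero[OF pD(3)] submodule_zero[OF C(2)] A0.M.zero_closed by simp_all
    then show "(\<zero>\<^bsub>A\<^esub>, \<zero>\<^bsub>C\<^esub>) \<in> ?K" by (intro image_eqI[where x = "\<zero>\<^bsub>C\<^esub>"]) (simp_all add: neg_zero)
  next
    fix x y x' y' assume "(x, y) \<in> ?K" "(x', y') \<in> ?K"
    then have *: "x \<in> carrier A0" "y = \<ominus>\<^bsub>C\<^esub> x" "x' \<in> carrier A0" "y' = \<ominus>\<^bsub>C\<^esub> x'" by auto
    then have "x \<oplus>\<^bsub>A\<^esub> x' \<in> carrier A0" "x \<oplus>\<^bsub>A\<^esub> x' = x \<oplus>\<^bsub>C\<^esub> x'"
      using A0.M.a_closed[of x x'] D(4)[of x x'] E(4)[of x x'] by simp_all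
    then show "(x \<oplus>\<^bsub>A\<^esub> x', y \<oplus>\<^bsub>C\<^esub> y') \<in> ?K"
      by (intro image_eqI[where x = "x \<oplus>\<^bsub>A\<^esub> x'"]) (simp_all add: * inC C.M.minus_add)
  next
    fix r x y assume r: "r \<in> carrier R" and "(x, y) \<in> ?K"
    then have *: "x \<in> carrier A0" "y = \<ominus>\<^bsub>C\<^esub> x" by auto
    then have "r \<odot>\<^bsub>A\<^esub> x \<in> carrier A0" "r \<odot>\<^bsub>A\<^esub> x = r \<odot>\<^bsub>C\<^esub> x"
      using A0.smult_closed[OF r *(1)] D(5)[OF r *(1)] E(5)[OF r *(1)] by simp_all
    then show "(r \<odot>\<^bsub>A\<^esub> x, r \<odot>\<^bsub>C\<^esub> y) \<in> ?K"
      by (intro image_eqI[where x = "r \<odot>\<^bsub>A\<^esub> x"]) (simp_all add: * inC r C.smult_r_neg)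
  next
    fix x assume "(x, \<zero>\<^bsub>C\<^esub>) \<in> ?K"
    then have *: "x \<in> carrier A0" "\<zero>\<^bsub>C\<^esub> = \<ominus>\<^bsub>C\<^esub> x" by auto
    have "x = \<ominus>\<^bsub>C\<^esub> (\<ominus>\<^bsub>C\<^esub> x)" using C.M.minus_minus[OF inC[OF *(1)]] by (rule sym)
    then have "x = \<zero>\<^bsub>C\<^esub>" unfolding *(2)[symmetric] neg_zero .
    then show "x = \<zero>\<^bsub>A\<^esub>" using submodule_zero[OF pD(3)] submodule_zero[OF C(2)] by simp
  qed
  then obtain P f where P: "P \<in> R_Mod R" "is_submodule R A P" "lin_map R C P f"
    and dec: "\<forall>p\<in>carrier P. \<exists>x\<in>carrier A. \<exists>y\<in>carrier C. p = x \<oplus>\<^bsub>P\<^esub> f y"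
    and ker: "\<forall>x\<in>carrier A. \<forall>y\<in>carrier C. x \<oplus>\<^bsub>P\<^esub> f y = \<zero>\<^bsub>P\<^esub> \<longleftrightarrow> (x, y) \<in> ?K"
    by (elim exE conjE)
  note F = is_submoduleD[OF P(2)]
  interpret P: left_module R P by (rule F)
  have inP: "x \<in> carrier P" if "x \<in> carrier A" for x using that F(3) by blast
  have fP: "f c \<in> carrier P" if "c \<in> carrier C" for c using lin_map_closed[OF P(3) that] .
  have hA: "h c \<in> carrier A" if "c \<in> carrier C" for c using lin_map_closed[OF h(1) that] .
  have eqP: "y = x" if "x \<oplus>\<^bsub>P\<^esub> \<ominus>\<^bsub>P\<^esub> y = \<zero>\<^bsub>P\<^esub>" "x \<in> carrier P" "y \<in> carrier P" for x y
    using that P.M.minus_equality[of x "\<ominus>\<^bsub>P\<^esub> y"] by simp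
  have f_id: "f a = a" if a: "a \<in> carrier A0" for a
  proof (rule eqP)
    have "a \<oplus>\<^bsub>P\<^esub> f (\<ominus>\<^bsub>C\<^esub> a) = \<zero>\<^bsub>P\<^esub>" using bspec[OF bspec[OF ker inA[OF a]] C.M.a_inv_closed[OF inC[OF a]]] a by simp
    then show "a \<oplus>\<^bsub>P\<^esub> \<ominus>\<^bsub>P\<^esub> f a = \<zero>\<^bsub>P\<^esub>"
      using lin_map_neg[OF E(2) F(2) P(3) inC[OF a]] by simp
  qed (use a inA inP inC fP in auto)
  have inj: "inj_on f (carrier C)"
  proof (rule inj_on_lin_mapI[OF E(2) F(2) P(3)])
    fix c assume c: "c \<in> carrier C" "f c = \<zero>\<^bsub>P\<^esub>"
    then have "\<zero>\<^bsub>A\<^esub> \<oplus>\<^bsub>P\<^esub> f c = \<zero>\<^bsub>P\<^esub>" by (simp add: submodule_zero[OF P(2)])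
    then have "(\<zero>\<^bsub>A\<^esub>, c) \<in> ?K" using bspec[OF bspec[OF ker A.M.zero_closed] c(1)] by simp
    then have "c = \<ominus>\<^bsub>C\<^esub> \<zero>\<^bsub>A\<^esub>" by auto
    also have "\<zero>\<^bsub>A\<^esub> = \<zero>\<^bsub>C\<^esub>" using submodule_zero[OF pD(3)] submodule_zero[OF C(2)] by simp
    finally show "c = \<zero>\<^bsub>C\<^esub>" by (simp add: neg_zero)
  qed
  \<comment> \<open>The retraction in mind sends \<open>x + f y\<close> to \<open>x + h y\<close>;
    its kernel, the complement of \<open>A\<close>, consists of the elements
    \<open>f c - h c\<close>.\<close>
  define g where "g c = f c \<oplus>\<^bsub>P\<^esub> \<ominus>\<^bsub>P\<^esub> h c" for c
  have g: "lin_map R C P g"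
  proof (rule lin_mapI)
    fix x assume x: "x \<in> carrier C"
    then show "g x \<in> carrier P" using fP hA inP by (simp add: g_def)
    fix r assume r: "r \<in> carrier R"
    have "h (r \<odot>\<^bsub>C\<^esub> x) = r \<odot>\<^bsub>P\<^esub> h x" using lin_map_smult[OF h(1) r x] F(5)[OF r hA[OF x]] by simp
    then show "g (r \<odot>\<^bsub>C\<^esub> x) = r \<odot>\<^bsub>P\<^esub> g x"
      using x r fP hA inP
      by (simp add: g_def lin_map_smult[OF P(3)] P.smult_r_distr P.smult_r_neg)
  next
    fix x y assume xy: "x \<in> carrier C" "y \<in> carrier C"
    have "h (x \<oplus>\<^bsub>C\<^esub> y) = h x \<oplus>\<^bsub>P\<^esub> h y" using lin_map_add[OF h(1) xy] F(4)[OF hA hA] xy by simp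
    then show "g (x \<oplus>\<^bsub>C\<^esub> y) = g x \<oplus>\<^bsub>P\<^esub> g y"
      using xy fP hA inP by (simp add: g_def lin_map_add[OF P(3)] P.M.minus_add P.M.a_ac)
  qed
  have "direct_summand R A P"
    unfolding direct_summand_def
  proof (intro conjI exI P(2))
    let ?X = "P\<lparr>carrier := g ` carrier C\<rparr>"
    show "is_submodule R ?X P" by (rule lin_map_image_submodule(1)[OF E(2) F(2) g])
    show "carrier A \<inter> carrier ?X = {\<zero>\<^bsub>P\<^esub>}"
    proof (intro equalityI subsetI)
      fix a assume "a \<in> carrier A \<inter> carrier ?X"
      then obtain c where a: "a \<in> carrier A" and c: "c \<in> carrier C" "a = f c \<oplus>\<^bsub>P\<^esub> \<ominus>\<^bsub>P\<^esub> h c"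
        by (auto simp: g_def)
      \<comment> \<open>From \<open>a = f c - h c\<close> follows
        \<open>-(a + h c) + f c = 0\<close>. So the pair lies in the relation and \<open>c\<close>
        comes from \<open>A0\<close>, where \<open>f\<close> and \<open>h\<close> are both the
        identity; hence \<open>a\<close> vanishes.\<close>
      let ?b = "\<ominus>\<^bsub>A\<^esub> (a \<oplus>\<^bsub>A\<^esub> h c)"
      have b: "?b \<in> carrier A" using a hA c(1) by simp
      have fc: "a \<oplus>\<^bsub>A\<^esub> h c = f c"
        using a hA[OF c(1)] inP fP[OF c(1)] by (simp add: F(4) c(2) P.M.a_assoc P.M.l_neg)
      then have "?b = \<ominus>\<^bsub>P\<^esub> f c" using submodule_neg[OF P(2) A.M.a_closed[OF a hA[OF c(1)]]] by (simp only: fc)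
      then have "?b \<oplus>\<^bsub>P\<^esub> f c = \<zero>\<^bsub>P\<^esub>" using fP[OF c(1)] by (simp add: P.M.l_neg)
      then have "(?b, c) \<in> ?K" using bspec[OF bspec[OF ker b] c(1)] by simp
      then have *: "?b \<in> carrier A0" "c = \<ominus>\<^bsub>C\<^esub> ?b" by auto
      then have "c = \<ominus>\<^bsub>A0\<^esub> ?b" using submodule_neg[OF C(2) *(1)] by simp
      then have "c \<in> carrier A0" using A0.M.a_inv_closed[OF *(1)] by simp
      then have "a = \<zero>\<^bsub>P\<^esub>" using c(2) f_id h(2) inA inP by (simp add: P.M.r_neg)
      then show "a \<in> {\<zero>\<^bsub>P\<^esub>}" by simp
    next
      fix a assume "a \<in> {\<zero>\<^bsub>P\<^esub>}"
      moreover have "\<zero>\<^bsub>P\<^esub> \<in> carrier A" using submodule_zero[OF P(2)] A.M.zero_closed by simp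
      moreover have "\<zero>\<^bsub>P\<^esub> \<in> g ` carrier C"
        using lin_map_zero[OF E(2) F(2) g] C.M.zero_closed by (metis imageI)
      ultimately show "a \<in> carrier A \<inter> carrier ?X" by simp
    qed
    show "carrier P = {a \<oplus>\<^bsub>P\<^esub> c |a c. a \<in> carrier A \<and> c \<in> carrier ?X}"
    proof (intro equalityI subsetI)
      fix p assume "p \<in> carrier P"
      then obtain x y where xy: "x \<in> carrier A" "y \<in> carrier C" "p = x \<oplus>\<^bsub>P\<^esub> f y" using dec by blast
      have "p = (x \<oplus>\<^bsub>A\<^esub> h y) \<oplus>\<^bsub>P\<^esub> g y"
      proof -
        have "(x \<oplus>\<^bsub>A\<^esub> h y) \<oplus>\<^bsub>P\<^esub> g y = x \<oplus>\<^bsub>P\<^esub> (h y \<oplus>\<^bsub>P\<^esub> (f y \<oplus>\<^bsub>P\<^esub> \<ominus>\<^bsub>P\<^esub> h y))"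
          using xy(1) hA[OF xy(2)] fP[OF xy(2)] inP by (simp add: F(4) g_def P.M.a_assoc)
        also have "h y \<oplus>\<^bsub>P\<^esub> (f y \<oplus>\<^bsub>P\<^esub> \<ominus>\<^bsub>P\<^esub> h y) = f y"
          using hA[OF xy(2)] fP[OF xy(2)] inP
          by (simp add: P.M.a_comm[of "f y"] P.M.r_neg2)
        finally show ?thesis using xy(3) by simp
      qed
      moreover have "x \<oplus>\<^bsub>A\<^esub> h y \<in> carrier A" using xy hA by simp
      ultimately show "p \<in> {a \<oplus>\<^bsub>P\<^esub> c |a c. a \<in> carrier A \<and> c \<in> carrier ?X}" using xy(2) by auto
    next
      fix p assume "p \<in> {a \<oplus>\<^bsub>P\<^esub> c |a c. a \<in> carrier A \<and> c \<in> carrier ?X}"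
      then show "p \<in> carrier P" using inP lin_map_closed[OF g] by auto
    qed
  qed
  then have "prec A P" using summands pD(2) P(1) unfolding refines_direct_summands_def by blast
  then have A0P: "prec A0 P" using A0 prec_trans by blast
  \<comment> \<open>Strong coherence needs a submodule of \<open>P\<close>, so it is applied to the
    copy of \<open>C\<close>; the inverse of \<open>f\<close>, which fixes \<open>A0\<close>,
    carries the result back.\<close>
  let ?C = "P\<lparr>carrier := f ` carrier C\<rparr>"
  have CP: "is_submodule R ?C P" and fC: "lin_map R C ?C f"
    by (rule lin_map_image_submodule[OF E(2) F(2) P(3)])+
  have "carrier A0 \<subseteq> carrier ?C" using f_id inC by force
  then have A0C: "is_submodule R A0 ?C" by (rule is_submodule_of_subset[OF precD(3)[OF A0P] CP])
  have *: "prec A0 ?C" by (rule prec_of_subset[OF A0P R_Mod_submodule[OF CP P(1)] A0C CP])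
  have bij: "bij_betw f (carrier C) (carrier ?C)" using inj by (simp add: bij_betw_def)
  show ?thesis
  proof (rule prec_iso[OF * E(2) lin_map_inv_into[OF E(2) fC bij] bij_betw_inv_into[OF bij] C(2)])
    have "inv_into (carrier C) f a = a" if "a \<in> carrier A0" for a
      using inv_into_f_f[OF inj inC[OF that]] f_id[OF that] by simp
    then show "carrier A0 = inv_into (carrier C) f ` carrier A0" by simp
  qed
qed

lemma prec_of_small_submodel:
  assumes AB: "pp_pure R lam A B" and lam: "\<theta> <o lam"
    and A0: "prec A0 A" "|carrier A0| \<le>o \<theta>"
  shows "prec A0 B"
proof -
  note pD = pp_pureD[OF AB]
  have A0B: "is_submodule R A0 B" by (rule is_submodule_trans[OF precD(3)[OF A0(1)] pD(3)])
  obtain C where C: "carrier A0 \<subseteq> carrier C" "prec C B" "|carrier C| \<le>o \<theta>"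
    using exists_small_submodel[OF pD(2) is_submoduleD(3)[OF A0B] A0(2)] by blast
  note CB = precD(3)[OF C(2)]
  note D = is_submoduleD[OF CB]
  have A0C: "is_submodule R A0 C" by (rule is_submodule_of_subset[OF A0B CB C(1)])
  let ?S = "hom_system R C (carrier A0)"
  have lmA: "left_module R A" using is_submoduleD(1)[OF pD(3)] .
  interpret B: left_module R B by (rule D)
  have zA: "\<zero>\<^bsub>C\<^esub> = \<zero>\<^bsub>A\<^esub>"
    using submodule_zero[OF A0C] submodule_zero[OF precD(3)[OF A0(1)]] by simp
  have zB: "\<zero>\<^bsub>C\<^esub> = \<zero>\<^bsub>B\<^esub>" by (rule submodule_zero[OF CB])
  have "\<zero>\<^bsub>A\<^esub> \<in> carrier A"
    using abelian_group.axioms(1)[OF left_module.axioms(2)[OF lmA]] by (rule abelian_monoid.zero_closed)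
  then have S: "linear_system R A ?S"
    using is_submoduleD(3)[OF precD(3)[OF A0(1)]] zA by (intro linear_system_hom_system[OF R]) auto
  have "|?S| \<le>o \<theta>" by (rule card_of_hom_system[OF Cinfinite_\<theta> card_of_ring_le C(3) A0(2)])
  then have card: "|?S| <o lam" using lam by (rule ordLeq_ordLess_trans)
  \<comment> \<open>The inclusion of \<open>C\<close> solves the system in \<open>B\<close>;
    unknowns outside \<open>C\<close> do not occur and get the value zero.\<close>
  let ?s = "\<lambda>x. if x \<in> carrier C then x else \<zero>\<^bsub>B\<^esub>"
  have s: "?s x \<in> carrier B" for x using D(3) by auto
  interpret C: left_module R C by (rule D)
  have closed_add: "x \<oplus>\<^bsub>B\<^esub> y \<in> carrier C" if "x \<in> carrier C" "y \<in> carrier C" for x y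
    using C.M.a_closed[OF that] D(4)[OF that] by simp
  have closed_smult: "r \<odot>\<^bsub>B\<^esub> x \<in> carrier C" if "r \<in> carrier R" "x \<in> carrier C" for x r
    using C.smult_closed[OF that] D(5)[OF that] by simp
  have "solution R B ?S ?s"
    unfolding solution_hom_system_iff[OF D(2) zB s] using C(1) by (auto simp: D(4,5) closed_add closed_smult)
  then obtain t where t: "solution R A ?S t" using pD(4)[OF S card] by blast
  have tA: "\<And>x. t x \<in> carrier A" using solution_closed[OF t] .
  have hom: "lin_map R C A t" "\<And>a. a \<in> carrier A0 \<Longrightarrow> t a = a"
    using t tA unfolding solution_hom_system_iff[OF lmA zA tA] by (auto simp: lin_map_def)
  have "prec A0 C" by (rule prec_of_retraction[OF A0(1) precD(1)[OF C(2)] A0C hom])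
  then show ?thesis using C(2) prec_trans by blast
qed

lemma prec_of_pp_pure:
  assumes AB: "pp_pure R lam A B" and lam: "\<theta> <o lam"
  shows "prec A B"
proof -
  note pD = pp_pureD[OF AB]
  have lmA: "left_module R A" using is_submoduleD(1)[OF pD(3)] .
  \<comment> \<open>Submodels are counted by their carriers: distinct records with one carrier would
    break antisymmetry under inclusion, and there may be too many of them for a small index
    set.\<close>
  define J where "J = {carrier A0 | A0. prec A0 A \<and> |carrier A0| \<le>o \<theta>}"
  have "J \<subseteq> Pow (carrier A)" using precD(3) is_submoduleD(3) by (fastforce simp: J_def)
  then have "|J| \<le>o |Pow (carrier A)|" by (rule card_of_mono1)
  moreover have "|Pow (carrier A)| <o |UNIV :: 'u set|"
    using pD(1) by (intro small_Pow[OF SI]) (simp add: R_Mod_def small_def)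
  ultimately have "|J| <o |UNIV :: 'u set|" by (rule ordLeq_ordLess_trans)
  \<comment> \<open>The indices of a directed system are elements of the universe, so the set
    \<open>J\<close> of carriers is recoded.\<close>
  then obtain I :: "'u set" where I: "small I" "|J| =o |I|" by (rule small_copy[OF SI])
  from ordIso_symmetric[OF I(2)] obtain e where e: "bij_betw e I J" using card_of_ordIso by blast
  define F where "F i = A\<lparr>carrier := e i\<rparr>" for i
  define r where "r = {(i, j). i \<in> I \<and> j \<in> I \<and> e i \<subseteq> e j}"
  have eJ: "\<exists>A0. prec A0 A \<and> |carrier A0| \<le>o \<theta> \<and> e i = carrier A0" if "i \<in> I" for i
    using bij_betwE[OF e] that by (auto simp: J_def)
  have eI: "\<exists>i\<in>I. e i = carrier A0" if "prec A0 A" "|carrier A0| \<le>o \<theta>" for A0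
  proof -
    have "carrier A0 \<in> e ` I" using that e by (auto simp: bij_betw_def J_def)
    then show ?thesis by blast
  qed
  have F: "prec (F i) A" "|carrier (F i)| \<le>o \<theta>" if "i \<in> I" for i
  proof -
    obtain A0 where A0: "prec A0 A" "|carrier A0| \<le>o \<theta>" "e i = carrier A0" using eJ[OF \<open>i \<in> I\<close>] by blast
    then show "prec (F i) A" "|carrier (F i)| \<le>o \<theta>"
      using prec_cong[OF A0(1) submodule_restrict_carrier[OF precD(3)[OF A0(1)]]] by (auto simp: F_def)
  qed
  have "directed_poset \<mu> I r"
    unfolding directed_poset_def
  proof (intro conjI allI impI)
    show "partial_order_on I r"
      using e by (auto simp: partial_order_on_def preorder_on_def refl_on_def trans_def antisym_def r_def
          bij_betw_def inj_on_def)
    fix X assume X: "X \<subseteq> I" "|X| <o \<mu>"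
    \<comment> \<open>At most \<open>\<theta>\<close> sets of size at most \<open>\<theta>\<close>:
      one more small submodel encloses their union and serves as upper bound.\<close>
    have "|\<Union>i\<in>X. e i| \<le>o \<theta>"
    proof (rule UNION_Cinfinite_bound[OF _ _ Cinfinite_\<theta>])
      show "|X| \<le>o \<theta>" by (rule ordLeq_transitive[OF ordLess_imp_ordLeq[OF X(2)] \<mu>_le])
      show "\<forall>i\<in>X. |e i| \<le>o \<theta>" using eJ X(1) by fastforce
    qed
    moreover have "(\<Union>i\<in>X. e i) \<subseteq> carrier A"
      using X(1) F(1) precD(3) is_submoduleD(3) by (fastforce simp: F_def)
    ultimately obtain M0 where M0: "(\<Union>i\<in>X. e i) \<subseteq> carrier M0" "prec M0 A" "|carrier M0| \<le>o \<theta>"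
      using exists_small_submodel[OF pD(1)] by blast
    obtain u where u: "u \<in> I" "e u = carrier M0" using eI[OF M0(2,3)] by blast
    then have "\<forall>x\<in>X. (x, u) \<in> r" using X(1) M0(1) unfolding r_def by blast
    with u(1) show "\<exists>u\<in>I. \<forall>x\<in>X. (x, u) \<in> r" by blast
  qed
  moreover have "prec (F i) (F j)" if ij: "(i, j) \<in> r" for i j
  proof -
    have I: "i \<in> I" "j \<in> I" and sub: "carrier (F i) \<subseteq> carrier (F j)" using ij by (auto simp: r_def F_def)
    note i = precD[OF F(1)[OF I(1)]] and j = precD[OF F(1)[OF I(2)]]
    show ?thesis
      by (rule prec_of_subset[OF F(1)[OF I(1)] j(1) is_submodule_of_subset[OF i(3) j(3) sub] j(3)])
  qed
  moreover have "F i \<in> R_Mod R" if "i \<in> I" for i using precD(1)[OF F(1)[OF that]] .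
  ultimately have sys: "directed_system (R_Mod R) prec \<mu> I r F"
    using I(1) by (simp add: directed_system_def)
  have "carrier A \<subseteq> (\<Union>i\<in>I. carrier (F i))"
  proof
    fix a assume a: "a \<in> carrier A"
    have "|{a}| \<le>o \<theta>"
      using Cinfinite_\<theta> by (intro Card_order_singl_ordLeq) (auto simp: cinfinite_def)
    then obtain M0 where M0: "{a} \<subseteq> carrier M0" "prec M0 A" "|carrier M0| \<le>o \<theta>"
      using exists_small_submodel[OF pD(1)] a by (metis empty_subsetI insert_subset)
    then show "a \<in> (\<Union>i\<in>I. carrier (F i))" using eI[OF M0(2,3)] by (auto simp: F_def)
  qed
  moreover have "(\<Union>i\<in>I. carrier (F i)) \<subseteq> carrier A" using is_submoduleD(3)[OF precD(3)[OF F(1)]] by blast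
  ultimately have "is_union R I F A"
    unfolding is_union_def using precD(3)[OF F(1)] by blast
  moreover have "\<forall>i\<in>I. prec (F i) B" using prec_of_small_submodel[OF AB lam] F by blast
  moreover have "\<forall>N\<in>R_Mod R. \<forall>I r F. directed_system (R_Mod R) prec \<mu> I r F \<and> (\<forall>i\<in>I. prec (F i) N) \<longrightarrow>
        (\<forall>M\<in>R_Mod R. is_union R I F M \<and> is_submodule R M N \<longrightarrow> prec M N)"
    using AEC unfolding mu_AEC_def by (elim conjE)
  ultimately show ?thesis using sys pD(1-3) by blast
qed

end

lemma admissible_relation_obtain:
  assumes SI: "strongly_inaccessible |UNIV :: 'u set|" and R: "ring R"
    and prec: "(prec :: ('r, 'u) module \<Rightarrow> _) \<in> admissible_relations R"
  shows "\<exists>\<mu> \<theta>. admissible_relation R prec \<mu> \<theta>"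
proof -
  obtain \<mu> :: "'u rel" where 1: "refines_direct_summands R prec" "strong_coherence R (R_Mod R) prec"
    "infinite_cardinal \<mu>" "mu_AEC R (R_Mod R) prec \<mu>"
    using prec by (auto simp: admissible_relations_def)
  have "\<exists>\<theta>. cardinal \<theta> \<and> is_weak_power \<theta> \<mu> \<theta> \<and> |module_language R| +c \<mu> \<le>o \<theta> \<and>
        (\<forall>M\<in>R_Mod R. \<forall>A\<subseteq>carrier M. \<exists>M0\<in>R_Mod R. A \<subseteq> carrier M0 \<and> prec M0 M \<and>
           (\<exists>\<rho>. is_weak_power |A| \<mu> \<rho> \<and> |carrier M0| \<le>o \<rho> +c \<theta>))"
    using 1(4) unfolding mu_AEC_def by (elim conjE)
  then obtain \<theta> where 2: "cardinal \<theta>" "is_weak_power \<theta> \<mu> \<theta>" "|module_language R| +c \<mu> \<le>o \<theta>"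
    "\<forall>M\<in>R_Mod R. \<forall>A\<subseteq>carrier M. \<exists>M0\<in>R_Mod R. A \<subseteq> carrier M0 \<and> prec M0 M \<and>
           (\<exists>\<rho>. is_weak_power |A| \<mu> \<rho> \<and> |carrier M0| \<le>o \<rho> +c \<theta>)"
    by (elim exE conjE)
  show ?thesis
    by (intro exI) (rule admissible_relation.intro[OF SI R 1(1,3,4,2) 2])
qed

text \<open>With \<open>\<theta>^+\<close> as \<open>lam\<close>, purity covers systems of up to
  \<open>\<theta>\<close> equations, which is the size of the system that describes a small
  submodel.\<close>

lemma pp_pure_cofinal:
  assumes SI: "strongly_inaccessible |UNIV :: 'u set|" and R: "ring R"
    and prec: "(prec :: ('r, 'u) module \<Rightarrow> _) \<in> admissible_relations R"
  obtains lam :: "'u rel" where "infinite_cardinal lam" "\<And>A B. pp_pure R lam A B \<Longrightarrow> prec A B"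
proof -
  obtain \<mu> \<theta> where "admissible_relation R prec \<mu> \<theta>" using admissible_relation_obtain[OF assms] by blast
  then interpret admissible_relation R prec \<mu> \<theta> .
  have \<theta>i: "infinite_cardinal \<theta>" using \<theta>(1) Cinfinite_\<theta> by (simp add: infinite_cardinal_def)
  from SI \<theta>i obtain lam :: "'u rel" where lam: "infinite_cardinal lam" "regularCard lam" "lam =o cardSuc \<theta>"
    by (rule exists_successor_cardinal)
  have "\<theta> <o lam"
    using cardSuc_greater[OF conjunct2[OF Cinfinite_\<theta>]] ordIso_symmetric[OF lam(3)] by (rule ordLess_ordIso_trans)
  then show thesis using that lam(1) prec_of_pp_pure by blast
qed

section \<open>Orbital types\<close>

lemma E_at_sym: "(p, q) \<in> E_at R K prec \<Longrightarrow> (q, p) \<in> E_at R K prec"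
  unfolding E_at_def by (auto; metis)

text \<open>By symmetry of \<open>E_at\<close>, a chain that starts at one triple is prolonged by
  one step to a chain that starts at the other, so both triples reach the same set.\<close>

lemma ortp_eqI:
  assumes "((b, A, N), (b', A', N')) \<in> E_at R K prec"
  shows "ortp R K prec b A N = ortp R K prec b' A' N'"
  unfolding ortp_def
proof (intro equalityI subsetI)
  fix x assume "x \<in> (E_at R K prec)\<^sup>+ `` {(b, A, N)}"
  then show "x \<in> (E_at R K prec)\<^sup>+ `` {(b', A', N')}"
    using trancl_into_trancl2[OF E_at_sym[OF assms]] by auto
next
  fix x assume "x \<in> (E_at R K prec)\<^sup>+ `` {(b', A', N')}"
  then show "x \<in> (E_at R K prec)\<^sup>+ `` {(b, A, N)}"
    using trancl_into_trancl2[OF assms] by auto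
qed

text \<open>On \<open>X\<close> the map \<open>f\<close> factors through \<open>g\<close>. With
  \<open>g\<close> the pp type and \<open>f\<close> the orbital type, this transfers the count of pp
  types.\<close>

lemma card_of_image_factor:
  assumes "\<And>x y. x \<in> X \<Longrightarrow> y \<in> X \<Longrightarrow> g x = g y \<Longrightarrow> f x = f y"
  shows "|f ` X| \<le>o |g ` X|"
proof -
  have "f ` X = (\<lambda>z. f (inv_into X g z)) ` g ` X"
    unfolding image_image
  proof (rule image_cong[OF refl])
    fix x assume x: "x \<in> X"
    have "inv_into X g (g x) \<in> X" "g (inv_into X g (g x)) = g x"
      using x by (auto intro: inv_into_into f_inv_into_f)
    then show "f x = f (inv_into X g (g x))" using assms[OF _ x] by simp
  qed
  then show ?thesis using card_of_image by metis
qed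

text \<open>A pp formula in the variable \<open>c\<close> with parameters \<open>m\<close> and bound
  unknowns \<open>s\<close>: the equations \<open>q_i s = m_i + r_i c\<close> for \<open>i\<close>
  in \<open>L\<close>. Only the coefficients \<open>(q, r)\<close> make up \<open>\<phi>\<close>, so
  the same formulas serve all modules.\<close>

definition realizes ::
  "('r, 'x) ring_scheme \<Rightarrow> 'u set \<Rightarrow> ('r, 'u) module \<Rightarrow> 'u \<Rightarrow>
   ('u \<Rightarrow> 'u \<Rightarrow> 'r) \<times> ('u \<Rightarrow> 'r) \<Rightarrow> ('u \<Rightarrow> 'u) \<Rightarrow> bool" where
  "realizes R L N c \<phi> m \<longleftrightarrow>
     family_solvable R N L (fst \<phi>) (\<lambda>i. m i \<oplus>\<^bsub>N\<^esub> snd \<phi> i \<odot>\<^bsub>N\<^esub> c)"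

definition pp_formulas ::
  "('r, 'x) ring_scheme \<Rightarrow> 'u set \<Rightarrow> (('u \<Rightarrow> 'u \<Rightarrow> 'r) \<times> ('u \<Rightarrow> 'r)) set" where
  "pp_formulas R L = Func L (coeffs R L) \<times> Func L (carrier R)"

text \<open>
  The parameters for which \<open>c\<close> realizes a formula form a coset of a subgroup that does not depend
  on \<open>c\<close>; so one representative per formula determines the whole type.
\<close>

definition pp_type ::
  "('r, 'x) ring_scheme \<Rightarrow> 'u set \<Rightarrow> ('r, 'u) module \<Rightarrow> ('r, 'u) module \<Rightarrow> 'u \<Rightarrow>
   ('u \<Rightarrow> 'u \<Rightarrow> 'r) \<times> ('u \<Rightarrow> 'r) \<Rightarrow> ('u \<Rightarrow> 'u) option" where
  "pp_type R L M N c \<phi> =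
     (if \<phi> \<in> pp_formulas R L then
        if \<exists>m\<in>Func L (carrier M). realizes R L N c \<phi> m
        then Some (SOME m. m \<in> Func L (carrier M) \<and> realizes R L N c \<phi> m) else None
      else undefined)"

text \<open>The witness is \<open>s - s0 + s1\<close>, for solutions \<open>s\<close>,
  \<open>s0\<close>, \<open>s1\<close> that belong to \<open>(c, m)\<close>, \<open>(c, m0)\<close>,
  \<open>(c', m0)\<close>: in the right-hand sides the terms \<open>m0\<close> and
  \<open>r c\<close> cancel.\<close>

lemma realizes_transfer:
  fixes N (structure)
  assumes N: "left_module R N" and MN: "carrier M \<subseteq> carrier N"
    and c: "c \<in> carrier N" "c' \<in> carrier N" and \<phi>: "\<phi> \<in> pp_formulas R L"
    and m: "m \<in> Func L (carrier M)" "m0 \<in> Func L (carrier M)"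
    and real: "realizes R L N c \<phi> m" "realizes R L N c \<phi> m0" "realizes R L N c' \<phi> m0"
  shows "realizes R L N c' \<phi> m"
proof -
  interpret N: left_module R N by fact
  obtain q r where qr: "\<phi> = (q, r)" by (cases \<phi>)
  have q: "q i \<in> coeffs R L" and r: "r i \<in> carrier R" if "i \<in> L" for i
    using \<phi> that by (auto simp: qr pp_formulas_def Func_def)
  have mN: "m i \<in> carrier N" "m0 i \<in> carrier N" if "i \<in> L" for i
    using m MN that by (auto simp: Func_def)
  obtain s where s: "\<forall>x. s x \<in> carrier N" "\<forall>i\<in>L. lincomb R N (q i) s = m i \<oplus> r i \<odot> c"
    using real(1) by (auto simp: realizes_def family_solvable_def qr)
  obtain s0 where s0: "\<forall>x. s0 x \<in> carrier N" "\<forall>i\<in>L. lincomb R N (q i) s0 = m0 i \<oplus> r i \<odot> c"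
    using real(2) by (auto simp: realizes_def family_solvable_def qr)
  obtain s1 where s1: "\<forall>x. s1 x \<in> carrier N" "\<forall>i\<in>L. lincomb R N (q i) s1 = m0 i \<oplus> r i \<odot> c'"
    using real(3) by (auto simp: realizes_def family_solvable_def qr)
  have "lincomb R N (q i) (\<lambda>x. (s x \<oplus> \<ominus> s0 x) \<oplus> s1 x) = m i \<oplus> r i \<odot> c'"
    if i: "i \<in> L" for i
  proof -
    have "lincomb R N (q i) (\<lambda>x. (s x \<oplus> \<ominus> s0 x) \<oplus> s1 x)
        = ((m i \<oplus> r i \<odot> c) \<oplus> \<ominus> (m0 i \<oplus> r i \<odot> c)) \<oplus> (m0 i \<oplus> r i \<odot> c')"
      using s s0 s1 i
      by (simp add: lincomb_add[OF N q[OF i]] lincomb_neg[OF N q[OF i]])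
    also have "(m i \<oplus> r i \<odot> c) \<oplus> \<ominus> (m0 i \<oplus> r i \<odot> c) = m i \<oplus> \<ominus> m0 i"
      using mN[OF i] r[OF i] c
      by (intro N.M.diff_eq_diff[symmetric]) (auto simp: N.smult_closed N.M.a_ac)
    also have "(m i \<oplus> \<ominus> m0 i) \<oplus> (m0 i \<oplus> r i \<odot> c') = m i \<oplus> r i \<odot> c'"
      using mN[OF i] r[OF i] c by (simp add: N.smult_closed N.M.a_assoc N.M.r_neg1)
    finally show ?thesis .
  qed
  then show ?thesis
    unfolding realizes_def family_solvable_def qr using s(1) s0(1) s1(1)
    by (intro exI[of _ "\<lambda>x. (s x \<oplus> \<ominus> s0 x) \<oplus> s1 x"]) simp
qed

text \<open>Equal types store the same representative \<open>m0\<close>, so both elements realize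
  the formula at \<open>m0\<close>; from there the transfer reaches every other parameter that
  \<open>c\<close> realizes.\<close>

lemma pp_type_eqD:
  assumes N: "left_module R N" and MN: "carrier M \<subseteq> carrier N"
    and c: "c \<in> carrier N" "c' \<in> carrier N" and eq: "pp_type R L M N c = pp_type R L M N c'"
    and \<phi>: "\<phi> \<in> pp_formulas R L" and m: "m \<in> Func L (carrier M)" and real: "realizes R L N c \<phi> m"
  shows "realizes R L N c' \<phi> m"
proof -
  define m0 where "m0 = (SOME m. m \<in> Func L (carrier M) \<and> realizes R L N c \<phi> m)"
  have "\<exists>m. m \<in> Func L (carrier M) \<and> realizes R L N c \<phi> m" using m real by blast
  from someI_ex[OF this] have m0: "m0 \<in> Func L (carrier M)" "realizes R L N c \<phi> m0"
    unfolding m0_def by simp_all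
  have "pp_type R L M N c \<phi> = Some m0"
    unfolding pp_type_def m0_def using \<phi> m real by auto
  then have *: "pp_type R L M N c' \<phi> = Some m0" using eq by simp
  then have ex: "\<exists>m. m \<in> Func L (carrier M) \<and> realizes R L N c' \<phi> m"
    unfolding pp_type_def using \<phi> by (auto split: if_splits)
  then have "m0 = (SOME m. m \<in> Func L (carrier M) \<and> realizes R L N c' \<phi> m)"
    using * \<phi> unfolding pp_type_def by (auto split: if_splits)
  with someI_ex[OF ex] have "realizes R L N c' \<phi> m0" by simp
  then show ?thesis by (rule realizes_transfer[OF N MN c \<phi> m m0(1) real m0(2)])
qed

locale pure_admissible_relation = admissible_relation R prec \<mu> \<theta>
  for R :: "('r, 'x) ring_scheme" and prec :: "('r, 'u) module \<Rightarrow> ('r, 'u) module \<Rightarrow> bool"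
    and \<mu> \<theta> +
  fixes lam :: "'u rel"
  assumes R_small: "|carrier R| <o |UNIV :: 'u set|"
    and lam: "infinite_cardinal lam"
    and pure: "\<And>A B. pp_pure R lam A B \<Longrightarrow> prec A B"
begin

abbreviation (input) L where "L \<equiv> Field lam"

lemmas infinite_L = infinite_cardinal_Field(1)[OF lam]
  and card_L = infinite_cardinal_Field(2)[OF lam]
  and small_L = infinite_cardinal_Field(3)[OF lam]

lemma K_embedding_prec:
  assumes "prec M N"
  shows "K_embedding R (R_Mod R) prec M N (\<lambda>x. x)"
proof -
  note D = precD[OF assms]
  have "prec (N\<lparr>carrier := carrier M\<rparr>) N"
    by (rule prec_cong[OF assms submodule_restrict_carrier[OF D(3)]]) simp
  then show ?thesis
    using D is_submodule_lin_map[OF D(3)] by (simp add: K_embedding_def left_module_hom_iff)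
qed

text \<open>
  Amalgamate two copies of \<open>N\<close> over \<open>M\<close> by identifying \<open>c\<close> in the first copy with \<open>c'\<close> in the
  second. Equality of pp-types makes the identification well defined and both copies pure: a
  solution in the pushout splits into its two components, and the one in the other copy can be
  pulled back because \<open>c\<close> and \<open>c'\<close> realize the same formulas.
\<close>

lemma E_at_of_realizes:
  fixes N :: "('r, 'u) module" (structure)
  assumes MN: "is_submodule R M N" and N: "N \<in> R_Mod R"
    and c: "c \<in> carrier N" "c' \<in> carrier N"
    and eq: "\<And>\<phi> m. \<phi> \<in> pp_formulas R L \<Longrightarrow> m \<in> Func L (carrier M) \<Longrightarrow>
      realizes R L N c \<phi> m \<longleftrightarrow> realizes R L N c' \<phi> m"
  shows "((c, carrier M, N), (c', carrier M, N)) \<in> E_at R (R_Mod R) prec"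
proof -
  note D = is_submoduleD[OF MN]
  interpret M: left_module R M by (rule D)
  interpret N: left_module R N by (rule D)
  have inN: "x \<in> carrier N" if "x \<in> carrier M" for x using that D(3) by blast
  have zM: "\<zero> \<in> carrier M" using submodule_zero[OF MN] M.M.zero_closed by simp
  obtain i0 where i0: "i0 \<in> L" using infinite_L by fastforce
  let ?p = "\<lambda>m r. m \<oplus> r \<odot> c" and ?p' = "\<lambda>m r. m \<oplus> r \<odot> c'"
  have p: "?p m r \<in> carrier N" "?p' m r \<in> carrier N" if "m \<in> carrier M" "r \<in> carrier R" for m r
    using that inN c by (simp_all add: N.smult_closed)
  \<comment> \<open>An instance of \<open>eq\<close> in which all left-hand sides vanish. It says
    that \<open>m + r c \<mapsto> m + r c'\<close> is well defined and injective.\<close>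
  have zero: "?p m r = \<zero> \<longleftrightarrow> ?p' m r = \<zero>" if m: "m \<in> carrier M" and r: "r \<in> carrier R" for m r
  proof -
    let ?q = "\<lambda>i. if i \<in> L then \<lambda>_. \<zero>\<^bsub>R\<^esub> else undefined"
    let ?r = "\<lambda>i. if i \<in> L then r else undefined" and ?m = "\<lambda>i. if i \<in> L then m else undefined"
    have zero_comb: "lincomb R N (\<lambda>_. \<zero>\<^bsub>R\<^esub>) s = \<zero>" for s :: "'u \<Rightarrow> 'u" by (simp add: lincomb_def)
    have *: "realizes R L N d (?q, ?r) ?m \<longleftrightarrow> m \<oplus> r \<odot> d = \<zero>" for d
      unfolding realizes_def family_solvable_def fst_conv snd_conv using i0
      by (auto simp: zero_comb intro!: exI[of _ "\<lambda>_. \<zero>"])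
    have "(?q, ?r) \<in> pp_formulas R L" using r by (auto simp: pp_formulas_def Func_def coeffs_def)
    moreover have "?m \<in> Func L (carrier M)" using m by (simp add: Func_def)
    ultimately show ?thesis using eq unfolding * [symmetric] by blast
  qed
  \<comment> \<open>The form in which equal pp types enter both purity proofs: in the right-hand
    sides \<open>c\<close> may be traded for \<open>c'\<close>, and back.\<close>
  have solve: "\<exists>t. (\<forall>x. t x \<in> carrier N) \<and> (\<forall>i\<in>L. lincomb R N (q i) t = m i \<oplus> r i \<odot> d')"
    if q: "q \<in> Func L (coeffs R L)" and mr: "\<And>i. i \<in> L \<Longrightarrow> m i \<in> carrier M \<and> r i \<in> carrier R"
      and t: "\<And>x. t x \<in> carrier N" "\<And>i. i \<in> L \<Longrightarrow> lincomb R N (q i) t = m i \<oplus> r i \<odot> d"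
      and d: "d = c \<and> d' = c' \<or> d = c' \<and> d' = c" for q m r t d d'
  proof -
    let ?r = "\<lambda>i. if i \<in> L then r i else undefined" and ?m = "\<lambda>i. if i \<in> L then m i else undefined"
    have "(q, ?r) \<in> pp_formulas R L" "?m \<in> Func L (carrier M)"
      using q mr by (auto simp: pp_formulas_def Func_def)
    then have "realizes R L N c (q, ?r) ?m \<longleftrightarrow> realizes R L N c' (q, ?r) ?m" by (rule eq)
    moreover have "realizes R L N d (q, ?r) ?m"
      unfolding realizes_def family_solvable_def using t by auto
    ultimately have "realizes R L N d' (q, ?r) ?m" using d by blast
    then show ?thesis unfolding realizes_def family_solvable_def by simp
  qed
  \<comment> \<open>The graph of \<open>m + r c \<mapsto> m + r c'\<close> with a sign, so that the
    pushout glues \<open>m + r c\<close> to \<open>f (m + r c')\<close>; in particular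
    \<open>f c' = c\<close>, and \<open>f\<close> fixes \<open>M\<close>.\<close>
  let ?K = "{(?p m r, \<ominus> ?p' m r) | m r. m \<in> carrier M \<and> r \<in> carrier R}"
  have neg0: "\<ominus> \<zero> = \<zero>" using N.M.minus_equality[of "\<zero>" "\<zero>"] by simp
  have neg0D: "x = \<zero>" if "\<ominus> x = \<zero>" "x \<in> carrier N" for x
    using N.M.minus_minus[OF that(2)] that(1) neg0 by simp
  have "\<exists>P f. P \<in> R_Mod R \<and> is_submodule R N P \<and> lin_map R N P f \<and>
    (\<forall>p\<in>carrier P. \<exists>x\<in>carrier N. \<exists>y\<in>carrier N. p = x \<oplus>\<^bsub>P\<^esub> f y) \<and>
    (\<forall>x\<in>carrier N. \<forall>y\<in>carrier N. x \<oplus>\<^bsub>P\<^esub> f y = \<zero>\<^bsub>P\<^esub> \<longleftrightarrow> (x, y) \<in> ?K)"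
  proof (rule exists_pushout[OF SI N N, of ?K])
    show "?K \<subseteq> carrier N \<times> carrier N" using p by auto
    have "?p \<zero> \<zero>\<^bsub>R\<^esub> = \<zero>" "\<ominus> ?p' \<zero> \<zero>\<^bsub>R\<^esub> = \<zero>"
      using c by (simp_all add: N.zero_smult neg0)
    then show "(\<zero>, \<zero>) \<in> ?K" using zM M.R.zero_closed by (intro CollectI exI[of _ "\<zero>"] exI[of _ "\<zero>\<^bsub>R\<^esub>"]) simp
  next
    fix x y x' y' assume "(x, y) \<in> ?K" "(x', y') \<in> ?K"
    then obtain m r m' r' where *: "m \<in> carrier M" "r \<in> carrier R" "m' \<in> carrier M" "r' \<in> carrier R"
      "x = ?p m r" "y = \<ominus> ?p' m r" "x' = ?p m' r'" "y' = \<ominus> ?p' m' r'" by blast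
    have mm: "m \<oplus> m' \<in> carrier M" using M.M.a_closed[OF *(1,3)] D(4)[OF *(1,3)] by simp
    have rr: "r \<oplus>\<^bsub>R\<^esub> r' \<in> carrier R" using *(2,4) by simp
    have "x \<oplus> x' = ?p (m \<oplus> m') (r \<oplus>\<^bsub>R\<^esub> r')"
      using * inN c by (simp add: N.smult_l_distr N.smult_closed N.M.a_ac)
    moreover have "y \<oplus> y' = \<ominus> ?p' (m \<oplus> m') (r \<oplus>\<^bsub>R\<^esub> r')"
      using * inN c by (simp add: N.smult_l_distr N.smult_closed N.M.a_ac N.M.minus_add)
    ultimately show "(x \<oplus> x', y \<oplus> y') \<in> ?K" using mm rr by blast
  next
    fix s x y assume s: "s \<in> carrier R" and "(x, y) \<in> ?K"
    then obtain m r where *: "m \<in> carrier M" "r \<in> carrier R" "x = ?p m r" "y = \<ominus> ?p' m r" by blast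
    have mm: "s \<odot> m \<in> carrier M" using M.smult_closed[OF s *(1)] D(5)[OF s *(1)] by simp
    have rr: "s \<otimes>\<^bsub>R\<^esub> r \<in> carrier R" using s *(2) by simp
    have "s \<odot> x = ?p (s \<odot> m) (s \<otimes>\<^bsub>R\<^esub> r)"
      using * inN c s by (simp add: N.smult_r_distr N.smult_closed N.smult_assoc)
    moreover have "s \<odot> y = \<ominus> ?p' (s \<odot> m) (s \<otimes>\<^bsub>R\<^esub> r)"
      using * inN c s by (simp add: N.smult_r_neg N.smult_r_distr N.smult_closed N.smult_assoc)
    ultimately show "(s \<odot> x, s \<odot> y) \<in> ?K" using mm rr by blast
  next
    fix x assume "(x, \<zero>) \<in> ?K"
    then obtain m r where *: "m \<in> carrier M" "r \<in> carrier R" "x = ?p m r" "\<zero> = \<ominus> ?p' m r" by blast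
    then show "x = \<zero>" using neg0D[OF *(4)[symmetric] p(2)[OF *(1,2)]] zero[OF *(1,2)] by simp
  qed
  then obtain P f where P: "P \<in> R_Mod R" "is_submodule R N P" "lin_map R N P f"
    and dec: "\<forall>p\<in>carrier P. \<exists>x\<in>carrier N. \<exists>y\<in>carrier N. p = x \<oplus>\<^bsub>P\<^esub> f y"
    and ker: "\<forall>x\<in>carrier N. \<forall>y\<in>carrier N. x \<oplus>\<^bsub>P\<^esub> f y = \<zero>\<^bsub>P\<^esub> \<longleftrightarrow> (x, y) \<in> ?K"
    by (elim exE conjE)
  note F = is_submoduleD[OF P(2)]
  interpret P: left_module R P by (rule F)
  have inP: "x \<in> carrier P" if "x \<in> carrier N" for x using that F(3) by blast
  have fP: "f y \<in> carrier P" if "y \<in> carrier N" for y using lin_map_closed[OF P(3) that] .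
  have kerD: "\<exists>m r. m \<in> carrier M \<and> r \<in> carrier R \<and> x = ?p m r \<and> y = \<ominus> ?p' m r"
    if "x \<in> carrier N" "y \<in> carrier N" "x \<oplus>\<^bsub>P\<^esub> f y = \<zero>\<^bsub>P\<^esub>" for x y
  proof -
    have "(x, y) \<in> ?K" using bspec[OF bspec[OF ker that(1)] that(2)] that(3) by simp
    then show ?thesis by blast
  qed
  have glue: "?p m r = f (?p' m r)" if "m \<in> carrier M" "r \<in> carrier R" for m r
  proof -
    have "(?p m r, \<ominus> ?p' m r) \<in> ?K" using that by blast
    then have "?p m r \<oplus>\<^bsub>P\<^esub> f (\<ominus> ?p' m r) = \<zero>\<^bsub>P\<^esub>"
      using bspec[OF bspec[OF ker p(1)[OF that]] N.M.a_inv_closed[OF p(2)[OF that]]] by simp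
    then have "?p m r \<oplus>\<^bsub>P\<^esub> \<ominus>\<^bsub>P\<^esub> f (?p' m r) = \<zero>\<^bsub>P\<^esub>"
      by (simp only: lin_map_neg[OF D(2) F(2) P(3) p(2)[OF that]])
    from P.M.minus_equality[OF this] show ?thesis
      using inP[OF p(1)[OF that]] fP[OF p(2)[OF that]] by simp
  qed
  have f_M: "f m = m" if "m \<in> carrier M" for m
    using glue[OF that M.R.zero_closed] that inN c by (simp add: N.zero_smult)
  have f_c: "f c' = c" using glue[OF zM M.R.one_closed] c by (simp add: N.smult_one)
  have inj: "inj_on f (carrier N)"
  proof (rule inj_on_lin_mapI[OF D(2) F(2) P(3)])
    fix y assume y: "y \<in> carrier N" "f y = \<zero>\<^bsub>P\<^esub>"
    then have "\<zero> \<oplus>\<^bsub>P\<^esub> f y = \<zero>\<^bsub>P\<^esub>" by (simp add: submodule_zero[OF P(2)])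
    from kerD[OF N.M.zero_closed y(1) this] obtain m r
      where *: "m \<in> carrier M" "r \<in> carrier R" "\<zero> = ?p m r" "y = \<ominus> ?p' m r" by blast
    have "?p' m r = \<zero>" using zero[OF *(1,2)] *(3) by simp
    then show "y = \<zero>" using *(4) neg0 by simp
  qed
  have split: "\<exists>n t. (\<forall>x. n x \<in> carrier N) \<and> (\<forall>x. t x \<in> carrier N) \<and> (\<forall>x. s x = n x \<oplus>\<^bsub>P\<^esub> f (t x))"
    if "\<And>x. s x \<in> carrier P" for s :: "'u \<Rightarrow> 'u"
  proof -
    have "\<forall>x. \<exists>n t. n \<in> carrier N \<and> t \<in> carrier N \<and> s x = n \<oplus>\<^bsub>P\<^esub> f t"
      using dec that by blast
    then show ?thesis by metis
  qed
  have comb: "lincomb R P q (\<lambda>x. n x \<oplus>\<^bsub>P\<^esub> f (t x)) = lincomb R N q n \<oplus>\<^bsub>P\<^esub> f (lincomb R N q t)"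
    if q: "q \<in> coeffs R L" and n: "\<And>x. n x \<in> carrier N" and t: "\<And>x. t x \<in> carrier N"
    for q :: "'u \<Rightarrow> 'r" and n t
    using lincomb_add[OF F(2) q, of n "\<lambda>x. f (t x)"] inP[OF n] fP[OF t]
      lincomb_submodule[OF P(2) q n] lincomb_lin_map[OF D(2) F(2) P(3) q t] by simp
  have lam_le: "lam \<le>o |L|" by (rule ordIso_imp_ordLeq[OF ordIso_symmetric[OF card_L]])
  have "pp_pure R lam N P"
  proof (rule pp_pureI_family[OF N P(1,2) infinite_L lam_le])
    fix q a assume q: "q \<in> Func L (coeffs R L)" and a: "a \<in> Func L (carrier N)"
      and solv: "family_solvable R P L q a"
    from solv obtain s where s0: "\<forall>x. s x \<in> carrier P" "\<forall>i\<in>L. lincomb R P (q i) s = a i"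
      unfolding family_solvable_def by (elim exE conjE)
    note s = spec[OF s0(1)] bspec[OF s0(2)]
    from split[of s, OF s(1)] obtain n t
      where nt: "\<forall>x. n x \<in> carrier N" "\<forall>x. t x \<in> carrier N" "\<forall>x. s x = n x \<oplus>\<^bsub>P\<^esub> f (t x)"
      by (elim exE conjE)
    have qi: "q i \<in> coeffs R L" and ai: "a i \<in> carrier N" if "i \<in> L" for i using q a that by (auto simp: Func_def)
    have closed: "lincomb R N (q i) n \<in> carrier N" "lincomb R N (q i) t \<in> carrier N" if "i \<in> L" for i
      using lincomb_closed[OF D(2) qi[OF that]] nt(1,2) by auto
    \<comment> \<open>For \<open>s = n + f t\<close> an equation says that
      \<open>(q n - a, q t)\<close> lies in the relation. By the second entry, \<open>-t\<close>
      solves the system with right-hand sides \<open>m + r c'\<close>; it is traded for a solution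
      \<open>t'\<close> with right-hand sides \<open>m + r c = q n - a\<close>, and then
      \<open>n - t'\<close> has the right-hand sides \<open>a\<close>.\<close>
    have "\<exists>m r. m \<in> carrier M \<and> r \<in> carrier R \<and> lincomb R N (q i) n \<oplus> \<ominus> a i = ?p m r \<and>
      lincomb R N (q i) t = \<ominus> ?p' m r" if i: "i \<in> L" for i
    proof (rule kerD)
      have "s = (\<lambda>x. n x \<oplus>\<^bsub>P\<^esub> f (t x))" using nt(3) by blast
      then have "lincomb R N (q i) n \<oplus>\<^bsub>P\<^esub> f (lincomb R N (q i) t) = a i"
        using s(2)[OF i] comb[OF qi[OF i]] nt(1,2) by simp
      moreover have "lincomb R N (q i) n \<oplus> \<ominus> a i = lincomb R N (q i) n \<oplus>\<^bsub>P\<^esub> \<ominus>\<^bsub>P\<^esub> a i"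
        using F(4)[OF closed(1)[OF i] N.M.a_inv_closed[OF ai[OF i]]] submodule_neg[OF P(2) ai[OF i]] by simp
      ultimately show "(lincomb R N (q i) n \<oplus> \<ominus> a i) \<oplus>\<^bsub>P\<^esub> f (lincomb R N (q i) t) = \<zero>\<^bsub>P\<^esub>"
        using inP[OF closed(1)[OF i]] fP[OF closed(2)[OF i]] inP[OF ai[OF i]]
        by (metis P.M.a_assoc P.M.a_comm P.M.a_inv_closed P.M.r_neg)
    qed (use closed ai i in simp_all)
    then obtain m r where mr: "\<And>i. i \<in> L \<Longrightarrow> m i \<in> carrier M \<and> r i \<in> carrier R"
      "\<And>i. i \<in> L \<Longrightarrow> lincomb R N (q i) n \<oplus> \<ominus> a i = ?p (m i) (r i)"
      "\<And>i. i \<in> L \<Longrightarrow> lincomb R N (q i) t = \<ominus> ?p' (m i) (r i)" by metis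
    have "lincomb R N (q i) (\<lambda>x. \<ominus> t x) = ?p' (m i) (r i)" if i: "i \<in> L" for i
      using lincomb_neg[OF D(2) qi[OF i], of t] nt(2) mr(3)[OF i] p(2) mr(1)[OF i] by simp
    with nt(2) have "\<exists>t'. (\<forall>x. t' x \<in> carrier N) \<and> (\<forall>i\<in>L. lincomb R N (q i) t' = ?p (m i) (r i))"
      by (intro solve[where t = "\<lambda>x. \<ominus> t x" and d = c' and d' = c, OF q mr(1)]) simp_all
    then obtain t' where t': "\<forall>x. t' x \<in> carrier N"
      "\<forall>i\<in>L. lincomb R N (q i) t' = ?p (m i) (r i)" by (elim exE conjE)
    have "lincomb R N (q i) (\<lambda>x. n x \<oplus> \<ominus> t' x) = a i" if i: "i \<in> L" for i
    proof -
      let ?n = "lincomb R N (q i) n"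
      have "lincomb R N (q i) (\<lambda>x. n x \<oplus> \<ominus> t' x) = ?n \<oplus> \<ominus> ?p (m i) (r i)"
        using nt(1) t' i by (simp add: lincomb_add[OF D(2) qi[OF i]] lincomb_neg[OF D(2) qi[OF i]])
      also have "\<dots> = ?n \<oplus> \<ominus> (?n \<oplus> \<ominus> a i)" by (simp only: mr(2)[OF i])
      also have "\<dots> = a i" using closed(1)[OF i] ai[OF i] by (simp add: N.M.minus_add N.M.r_neg2)
      finally show ?thesis .
    qed
    then show "family_solvable R N L q a"
      unfolding family_solvable_def using nt(1) t'(1)
      by (intro exI[of _ "\<lambda>x. n x \<oplus> \<ominus> t' x"]) simp
  qed
  then have NP: "prec N P" by (rule pure)
  let ?N = "P\<lparr>carrier := f ` carrier N\<rparr>"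
  have N': "is_submodule R ?N P" and fN: "lin_map R N ?N f"
    by (rule lin_map_image_submodule[OF D(2) F(2) P(3)])+
  have "pp_pure R lam ?N P"
  proof (rule pp_pureI_family[OF R_Mod_submodule[OF N' P(1)] P(1) N' infinite_L lam_le])
    fix q a assume q: "q \<in> Func L (coeffs R L)" and a: "a \<in> Func L (carrier ?N)"
      and solv: "family_solvable R P L q a"
    from solv obtain s where s0: "\<forall>x. s x \<in> carrier P" "\<forall>i\<in>L. lincomb R P (q i) s = a i"
      unfolding family_solvable_def by (elim exE conjE)
    note s = spec[OF s0(1)] bspec[OF s0(2)]
    from split[of s, OF s(1)] obtain n t
      where nt: "\<forall>x. n x \<in> carrier N" "\<forall>x. t x \<in> carrier N" "\<forall>x. s x = n x \<oplus>\<^bsub>P\<^esub> f (t x)"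
      by (elim exE conjE)
    have qi: "q i \<in> coeffs R L" if "i \<in> L" for i using q that by (auto simp: Func_def)
    have "\<forall>i\<in>L. \<exists>b. b \<in> carrier N \<and> a i = f b" using a by (auto simp: Func_def)
    then obtain b where b: "\<And>i. i \<in> L \<Longrightarrow> b i \<in> carrier N" "\<And>i. i \<in> L \<Longrightarrow> a i = f (b i)" by metis
    have closed: "lincomb R N (q i) n \<in> carrier N" "lincomb R N (q i) t \<in> carrier N" if "i \<in> L" for i
      using lincomb_closed[OF D(2) qi[OF that]] nt(1,2) by auto
    \<comment> \<open>The mirror image: now \<open>n\<close> solves the system with
      \<open>c\<close>, the traded \<open>t'\<close> solves it with \<open>c'\<close>, and
      \<open>t + t'\<close> has the right-hand sides \<open>b\<close>, whose images under
      \<open>f\<close> are the parameters.\<close>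
    have "\<exists>m r. m \<in> carrier M \<and> r \<in> carrier R \<and> lincomb R N (q i) n = ?p m r \<and>
      lincomb R N (q i) t \<oplus> \<ominus> b i = \<ominus> ?p' m r" if i: "i \<in> L" for i
    proof (rule kerD)
      have "s = (\<lambda>x. n x \<oplus>\<^bsub>P\<^esub> f (t x))" using nt(3) by blast
      then have "lincomb R N (q i) n \<oplus>\<^bsub>P\<^esub> f (lincomb R N (q i) t) = f (b i)"
        using s(2)[OF i] comb[OF qi[OF i]] nt(1,2) b(2)[OF i] by simp
      moreover have "f (lincomb R N (q i) t \<oplus> \<ominus> b i) = f (lincomb R N (q i) t) \<oplus>\<^bsub>P\<^esub> \<ominus>\<^bsub>P\<^esub> f (b i)"
        using lin_map_add[OF P(3) closed(2)[OF i] N.M.a_inv_closed[OF b(1)[OF i]]]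
          lin_map_neg[OF D(2) F(2) P(3) b(1)[OF i]] by simp
      ultimately show "lincomb R N (q i) n \<oplus>\<^bsub>P\<^esub> f (lincomb R N (q i) t \<oplus> \<ominus> b i) = \<zero>\<^bsub>P\<^esub>"
        using inP[OF closed(1)[OF i]] fP[OF closed(2)[OF i]] fP[OF b(1)[OF i]]
        by (metis P.M.a_assoc P.M.a_inv_closed P.M.r_neg)
    qed (use closed b i in simp_all)
    then obtain m r where mr: "\<And>i. i \<in> L \<Longrightarrow> m i \<in> carrier M \<and> r i \<in> carrier R"
      "\<And>i. i \<in> L \<Longrightarrow> lincomb R N (q i) n = ?p (m i) (r i)"
      "\<And>i. i \<in> L \<Longrightarrow> lincomb R N (q i) t \<oplus> \<ominus> b i = \<ominus> ?p' (m i) (r i)" by metis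
    have "\<exists>t'. (\<forall>x. t' x \<in> carrier N) \<and> (\<forall>i\<in>L. lincomb R N (q i) t' = ?p' (m i) (r i))"
      by (rule solve[where t = n and d = c and d' = c', OF q mr(1) _ mr(2)]) (use nt(1) in simp_all)
    then obtain t' where t': "\<forall>x. t' x \<in> carrier N"
      "\<forall>i\<in>L. lincomb R N (q i) t' = ?p' (m i) (r i)" by (elim exE conjE)
    have "lincomb R ?N (q i) (\<lambda>x. f (t x \<oplus> t' x)) = a i" if i: "i \<in> L" for i
    proof -
      let ?t = "lincomb R N (q i) t"
      have p': "?p' (m i) (r i) \<in> carrier N" using p(2) mr(1)[OF i] by blast
      have "?t \<oplus> ?p' (m i) (r i) = b i"
      proof -
        have "?p' (m i) (r i) = \<ominus> (?t \<oplus> \<ominus> b i)"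
          unfolding mr(3)[OF i] using p' by simp
        then show ?thesis using closed(2)[OF i] b(1)[OF i] by (simp add: N.M.minus_add N.M.r_neg2)
      qed
      then have "lincomb R N (q i) (\<lambda>x. t x \<oplus> t' x) = b i"
        using nt(2) t' i by (simp add: lincomb_add[OF D(2) qi[OF i]])
      then show ?thesis
        using lincomb_lin_map[OF D(2) is_submoduleD(1)[OF N'] fN qi[OF i], of "\<lambda>x. t x \<oplus> t' x"]
          nt(2) t'(1) b(2)[OF i] by simp
    qed
    then show "family_solvable R ?N L q a"
      unfolding family_solvable_def using nt(2) t'(1)
      by (intro exI[of _ "\<lambda>x. f (t x \<oplus> t' x)"]) simp
  qed
  then have N'P: "prec ?N P" by (rule pure)
  have e2: "K_embedding R (R_Mod R) prec N P f"
    unfolding K_embedding_def left_module_hom_iff using N P(1,3) inj N'P by simp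
  have e1: "K_embedding R (R_Mod R) prec N P (\<lambda>x. x)" by (rule K_embedding_prec[OF NP])
  have "\<exists>Q f1 f2. K_embedding R (R_Mod R) prec N Q f1 \<and> K_embedding R (R_Mod R) prec N Q f2 \<and>
      f1 c = f2 c' \<and> (\<forall>a\<in>carrier M. f1 a = a \<and> f2 a = a)"
    using e1 e2 f_c f_M by (intro exI[of _ P] exI[of _ "\<lambda>x. x"] exI[of _ f]) simp
  then show ?thesis unfolding E_at_def using N c D(3) by blast
qed

end

section \<open>Stability\<close>

lemma card_of_Func_mono_index:
  assumes "|A| \<le>o |B|" "Y \<noteq> {}"
  shows "|Func A Y| \<le>o |Func B Y|"
  using Func_le_of_Field_le[OF assms(2) card_of_Card_order assms(1)] by (simp add: Field_card_of)

context pure_admissible_relation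
begin

lemma small_pp_formulas: "|pp_formulas R L| <o |UNIV :: 'u set|"
proof -
  \<comment> \<open>The successor serves to enter the locale in which coefficient sets were shown to
    be small.\<close>
  obtain \<nu> :: "'u rel" where \<nu>: "infinite_cardinal \<nu>" "regularCard \<nu>" "\<nu> =o cardSuc lam"
    using exists_successor_cardinal[OF SI lam] .
  interpret pp_setting R lam \<nu> by (rule pp_setting.intro[OF SI R R_small lam \<nu>(3)])
  show ?thesis
    unfolding pp_formulas_def
    by (intro small_Times[OF SI] small_Func[OF SI] small_L R_small small_coeffs)
qed

text \<open>\<open>\<kappa>\<close> absorbs the exponent \<open>|L|\<close>, which bounds the
  parameter families over \<open>M\<close>, and the exponent \<open>|\<Phi>|\<close>, which bounds
  the choices of one such family or \<open>None\<close> for each formula; the sum \<open>?I\<close>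
  handles both. The bound speaks of submodules, so that it also applies to the amalgams in the proof
  of stability.\<close>

lemma exists_type_bound:
  fixes \<alpha> :: "'u rel"
  assumes \<alpha>: "cardinal \<alpha>"
  shows "\<exists>\<kappa> :: 'u rel. infinite_cardinal \<kappa> \<and> \<alpha> \<le>o \<kappa> \<and>
    (\<forall>M N. N \<in> R_Mod R \<and> is_submodule R M N \<and> |carrier M| =o \<kappa> \<longrightarrow>
       |types_in R (R_Mod R) prec M N| \<le>o \<kappa>)"
proof -
  let ?I = "pp_formulas R L <+> L"
  have small_I: "|?I| <o |UNIV :: 'u set|" by (rule small_Plus[OF SI small_pp_formulas small_L])
  have inf_I: "infinite ?I" using infinite_L by simp
  have F\<alpha>: "|Field \<alpha>| =o \<alpha>" and \<alpha>s: "\<alpha> <o |UNIV :: 'u set|"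
    using \<alpha> by (auto simp: cardinal_def card_of_Field_ordIso)
  from exists_cardinal_Func_closed[OF SI small_I ordIso_ordLess_trans[OF F\<alpha> \<alpha>s] inf_I]
  obtain K :: "'u set" where K: "small K" "infinite K" "|?I| <o |K|" "|Field \<alpha>| \<le>o |K|" "|Func ?I K| \<le>o |K|"
    by metis
  have Kne: "K \<noteq> {}" using K(2) by auto
  have \<Phi>K: "|Func (pp_formulas R L) K| \<le>o |K|"
    using card_of_Func_mono_index[OF card_of_Plus1 Kne] K(5) by (rule ordLeq_transitive)
  have LK: "|Func L K| \<le>o |K|"
    using card_of_Func_mono_index[OF card_of_Plus2 Kne] K(5) by (rule ordLeq_transitive)
  have "|types_in R (R_Mod R) prec M N| \<le>o |K|"
    if N: "N \<in> R_Mod R" and MN: "is_submodule R M N" and M: "|carrier M| =o |K|" for M N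
  proof -
    note D = is_submoduleD[OF MN]
    let ?\<tau> = "\<lambda>c. ortp R (R_Mod R) prec c (carrier M) N"
    let ?Y = "insert None (Some ` Func L (carrier M))"
    have "types_in R (R_Mod R) prec M N = ?\<tau> ` carrier N" by (auto simp: types_in_def)
    moreover have "|?\<tau> ` carrier N| \<le>o |pp_type R L M N ` carrier N|"
    proof (rule card_of_image_factor)
      fix c c' assume c: "c \<in> carrier N" "c' \<in> carrier N" and eq: "pp_type R L M N c = pp_type R L M N c'"
      show "?\<tau> c = ?\<tau> c'"
      proof (rule ortp_eqI, rule E_at_of_realizes[OF MN N c])
        fix \<phi> m assume \<phi>: "\<phi> \<in> pp_formulas R L" "m \<in> Func L (carrier M)"
        show "realizes R L N c \<phi> m \<longleftrightarrow> realizes R L N c' \<phi> m"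
          using pp_type_eqD[OF D(2,3) c eq \<phi>] pp_type_eqD[OF D(2,3) c(2,1) eq[symmetric] \<phi>] by (rule iffI)
      qed
    qed
    moreover have "|pp_type R L M N ` carrier N| \<le>o |Func (pp_formulas R L) ?Y|"
    proof (rule card_of_mono1, rule image_subsetI)
      fix c assume "c \<in> carrier N"
      have "(SOME m. m \<in> Func L (carrier M) \<and> realizes R L N c \<phi> m) \<in> Func L (carrier M)"
        if "\<exists>m\<in>Func L (carrier M). realizes R L N c \<phi> m" for \<phi>
        using someI_ex[of "\<lambda>m. m \<in> Func L (carrier M) \<and> realizes R L N c \<phi> m"] that by blast
      then show "pp_type R L M N c \<in> Func (pp_formulas R L) ?Y"
        by (simp add: Func_def pp_type_def)
    qed
    moreover have "|Func (pp_formulas R L) ?Y| \<le>o |K|"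
    proof -
      have "|Func L (carrier M)| \<le>o |K|"
        using card_of_Func_mono[OF ordIso_imp_ordLeq[OF M]] LK by (rule ordLeq_transitive)
      then have "|Some ` Func L (carrier M)| \<le>o |K|" by (rule ordLeq_transitive[OF card_of_image])
      moreover have "|{None :: ('u \<Rightarrow> 'u) option}| \<le>o |K|" using Kne by (rule card_of_singl_ordLeq)
      ultimately have "|{None} \<union> Some ` Func L (carrier M)| \<le>o |K|"
        using K(2) by (intro Un_Cinfinite_bound) (simp_all add: Cinfinite_card_of)
      then have "|?Y| \<le>o |K|" by simp
      from ordLeq_transitive[OF card_of_Func_mono[OF this] \<Phi>K] show ?thesis .
    qed
    ultimately show ?thesis using ordLeq_transitive by metis
  qed
  moreover have "infinite_cardinal |K|"
    using K(1,2) unfolding infinite_cardinal_def cardinal_def small_def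
    by (simp add: Cinfinite_card_of conj_commute card_of_card_order_on Field_card_of cinfinite_def)
  moreover have "\<alpha> \<le>o |K|" by (rule ordIso_ordLeq_trans[OF ordIso_symmetric[OF F\<alpha>] K(4)])
  ultimately show ?thesis by blast
qed

lemma almost_stable: "almost_stable_class R (R_Mod R) prec"
  unfolding almost_stable_class_def
proof (intro allI impI)
  fix \<alpha> :: "'u rel" assume "cardinal \<alpha>"
  from exists_type_bound[OF this] obtain \<kappa> :: "'u rel"
    where \<kappa>: "infinite_cardinal \<kappa>" "\<alpha> \<le>o \<kappa>"
      "\<forall>M N. N \<in> R_Mod R \<and> is_submodule R M N \<and> |carrier M| =o \<kappa> \<longrightarrow>
       |types_in R (R_Mod R) prec M N| \<le>o \<kappa>"
    by (elim exE conjE)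
  have "|types_in R (R_Mod R) prec M N| \<le>o \<kappa>" if "prec M N \<and> |carrier M| =o \<kappa>" for M N
    using \<kappa>(3) that precD(2,3)[OF conjunct1[OF that]] by blast
  then show "\<exists>\<kappa> :: 'u rel. infinite_cardinal \<kappa> \<and> \<alpha> \<le>o \<kappa> \<and>
           (\<forall>M\<in>R_Mod R. \<forall>N\<in>R_Mod R. prec M N \<and> |carrier M| =o \<kappa> \<longrightarrow>
             |types_in R (R_Mod R) prec M N| \<le>o \<kappa>)"
    using \<kappa>(1,2) by (intro exI[of _ \<kappa>]) simp
qed

lemma K_embedding_comp_iso:
  assumes f: "K_embedding R (R_Mod R) prec M N f"
    and \<pi>: "left_module R N'" "lin_map R N N' \<pi>" "bij_betw \<pi> (carrier N) (carrier N')"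
  shows "K_embedding R (R_Mod R) prec M N' (\<pi> \<circ> f)"
proof -
  have f: "M \<in> R_Mod R" "N \<in> R_Mod R" "lin_map R M N f" "inj_on f (carrier M)"
    "prec (N\<lparr>carrier := f ` carrier M\<rparr>) N"
    using f by (auto simp: K_embedding_def left_module_hom_iff)
  have lm: "left_module R M" using f(1) by (simp add: R_Mod_def)
  have \<pi>f: "lin_map R M N' (\<pi> \<circ> f)" by (rule lin_map_comp[OF f(3) \<pi>(2)])
  have "f ` carrier M \<subseteq> carrier N" using lin_map_closed[OF f(3)] by blast
  then have "inj_on (\<pi> \<circ> f) (carrier M)"
    using f(4) \<pi>(3) by (intro comp_inj_on) (auto simp: bij_betw_def intro: inj_on_subset)
  moreover have "prec (N'\<lparr>carrier := (\<pi> \<circ> f) ` carrier M\<rparr>) N'"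
    by (rule prec_iso[OF f(5) \<pi> lin_map_image_submodule(1)[OF lm \<pi>(1) \<pi>f]]) (simp add: image_comp)
  ultimately show ?thesis
    using f(1) \<pi>f R_Mod_iso[OF f(2) \<pi>(1,3)] by (simp add: K_embedding_def left_module_hom_iff)
qed

text \<open>Amalgamation yields a common embedding of \<open>M\<close> that need not be the
  identity, whereas types over \<open>M\<close> are compared by maps that fix \<open>M\<close>.
  Renaming the amalgam along this embedding makes \<open>M\<close> a submodule of it.\<close>

lemma exists_extension_realizing:
  fixes I :: "'u set" and F :: "'u \<Rightarrow> ('r, 'u) module"
  assumes AP: "infinity_AP R (R_Mod R) prec" and I: "small I" "I \<noteq> {}"
    and M: "M \<in> R_Mod R" and F: "\<And>i. i \<in> I \<Longrightarrow> prec M (F i)" "\<And>i. i \<in> I \<Longrightarrow> b i \<in> carrier (F i)"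
  shows "\<exists>N. N \<in> R_Mod R \<and> is_submodule R M N \<and>
    (\<forall>i\<in>I. ortp R (R_Mod R) prec (b i) (carrier M) (F i) \<in> types_in R (R_Mod R) prec M N)"
proof -
  have lmM: "left_module R M" using M by (simp add: R_Mod_def)
  have "\<exists>N\<in>R_Mod R. \<exists>g. (\<forall>i\<in>I. K_embedding R (R_Mod R) prec (F i) N (g i)) \<and>
           (\<forall>i\<in>I. \<forall>j\<in>I. \<forall>x\<in>carrier M. g i x = g j x)"
    using AP[unfolded infinity_AP_def, rule_format, OF M, of I F "\<lambda>_ x. x"]
      I(1) F(1) K_embedding_prec by simp
  then obtain N g where N: "N \<in> R_Mod R" and g: "\<forall>i\<in>I. K_embedding R (R_Mod R) prec (F i) N (g i)"
    and gM: "\<forall>i\<in>I. \<forall>j\<in>I. \<forall>x\<in>carrier M. g i x = g j x" by (elim bexE exE conjE)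
  obtain i0 where i0: "i0 \<in> I" using I(2) by blast
  have lmN: "left_module R N" using N by (simp add: R_Mod_def)
  have MF: "carrier M \<subseteq> carrier (F i)" if "i \<in> I" for i
    by (rule is_submoduleD(3)[OF precD(3)[OF F(1)[OF that]]])
  have gi: "lin_map R (F i) N (g i)" "inj_on (g i) (carrier (F i))" if "i \<in> I" for i
    using bspec[OF g that] by (auto simp: K_embedding_def left_module_hom_iff)
  have inj: "inj_on ((\<lambda>x. x) \<circ> g i0) (carrier M)"
    using gi(2)[OF i0] MF[OF i0] by (simp add: comp_def inj_on_subset)
  have sub: "g i0 ` carrier M \<subseteq> carrier N" using lin_map_closed[OF gi(1)[OF i0]] MF[OF i0] by blast
  have "|(\<lambda>x. x) ` carrier N| <o |UNIV :: 'u set|" using N by (simp add: R_Mod_def small_def)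
  from exists_renaming[OF infinite_universe[OF SI] this inj sub]
  obtain \<pi> :: "'u \<Rightarrow> 'u" where \<pi>: "\<And>x y. x \<in> carrier N \<Longrightarrow> y \<in> carrier N \<Longrightarrow> \<pi> x = \<pi> y \<longleftrightarrow> x = y"
    "\<And>m. m \<in> carrier M \<Longrightarrow> \<pi> (g i0 m) = m" by metis
  let ?N = "image_module N \<pi>"
  have N': "left_module R ?N" "lin_map R N ?N \<pi>" by (rule image_module[OF lmN]; simp add: \<pi>)+
  have bij: "bij_betw \<pi> (carrier N) (carrier ?N)" using \<pi>(1) by (simp add: bij_betw_def inj_on_def)
  have NR: "?N \<in> R_Mod R" by (rule R_Mod_iso[OF N N'(1) bij])
  have k: "K_embedding R (R_Mod R) prec (F i) ?N (\<pi> \<circ> g i)" if "i \<in> I" for i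
    by (rule K_embedding_comp_iso[OF bspec[OF g that] N' bij])
  have kM: "(\<pi> \<circ> g i) m = m" if "i \<in> I" "m \<in> carrier M" for i m
    using gM that i0 \<pi>(2)[OF that(2)] by (metis comp_apply)
  have kc: "(\<pi> \<circ> g i) x \<in> carrier ?N" if "i \<in> I" "x \<in> carrier (F i)" for i x
    using lin_map_closed[OF gi(1)[OF that(1)] that(2)] by simp
  have "lin_map R M ?N (\<pi> \<circ> g i0)"
    using lin_map_comp[OF is_submodule_lin_map[OF precD(3)[OF F(1)[OF i0]]] lin_map_comp[OF gi(1)[OF i0] N'(2)]]
    by (simp add: comp_def)
  then have "lin_map R M ?N (\<lambda>x. x)"
    unfolding lin_map_def using kM[OF i0] abelian_monoid.a_closed[OF abelian_group.axioms(1)[OF left_module.axioms(2)[OF lmM]]]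
      left_module.smult_closed[OF lmM] by (simp add: Pi_iff)
  moreover have "carrier M \<subseteq> carrier ?N"
  proof
    fix m assume m: "m \<in> carrier M"
    then have "m \<in> carrier (F i0)" using MF[OF i0] by blast
    from kc[OF i0 this] show "m \<in> carrier ?N" unfolding kM[OF i0 m] .
  qed
  ultimately have MN: "is_submodule R M ?N" by (intro is_submoduleI[OF lmM N'(1)])
  have "ortp R (R_Mod R) prec (b i) (carrier M) (F i) \<in> types_in R (R_Mod R) prec M ?N" if i: "i \<in> I" for i
  proof -
    let ?d = "(\<pi> \<circ> g i) (b i)"
    have d: "?d \<in> carrier ?N" by (rule kc[OF i F(2)[OF i]])
    \<comment> \<open>The renamed amalgam witnesses the equivalence itself, with the identity as
      embedding for the second triple.\<close>
    have "((b i, carrier M, F i), (?d, carrier M, ?N)) \<in> E_at R (R_Mod R) prec"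
      unfolding E_at_def
    proof (intro CollectI exI conjI)
      show "K_embedding R (R_Mod R) prec (F i) ?N (\<pi> \<circ> g i)" by (rule k[OF i])
      show "K_embedding R (R_Mod R) prec ?N ?N (\<lambda>x. x)" by (rule K_embedding_prec[OF prec_refl[OF NR]])
      show "\<forall>a\<in>carrier M. (\<pi> \<circ> g i) a = a \<and> a = a" using kM[OF i] by blast
    qed (use MF[OF i] is_submoduleD(3)[OF MN] F(2)[OF i] d NR precD(2)[OF F(1)[OF i]] in simp_all)
    from ortp_eqI[OF this] show ?thesis using d unfolding types_in_def by blast
  qed
  with NR MN show ?thesis by blast
qed

text \<open>The types over \<open>M\<close> come from a proper class of extensions, while
  \<open>infinity_AP\<close> accepts only small families. A violation of the bound is therefore
  first cut down to \<open>\<kappa>^+\<close> distinct types; one extension realizing all of them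
  contradicts the bound for a single extension.\<close>

lemma stable:
  assumes AP: "infinity_AP R (R_Mod R) prec"
  shows "stable_class R (R_Mod R) prec"
  unfolding stable_class_def
proof (intro allI impI)
  fix \<alpha> :: "'u rel" assume "cardinal \<alpha>"
  from exists_type_bound[OF this] obtain \<kappa> :: "'u rel"
    where \<kappa>: "infinite_cardinal \<kappa>" "\<alpha> \<le>o \<kappa>"
      "\<forall>M N. N \<in> R_Mod R \<and> is_submodule R M N \<and> |carrier M| =o \<kappa> \<longrightarrow>
       |types_in R (R_Mod R) prec M N| \<le>o \<kappa>"
    by (elim exE conjE)
  have co: "Card_order \<kappa>" using \<kappa>(1) by (simp add: infinite_cardinal_def cardinal_def)
  have "|types_over R (R_Mod R) prec M| \<le>o \<kappa>" if M: "M \<in> R_Mod R" "|carrier M| =o \<kappa>" for M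
  proof (rule ccontr)
    let ?S = "types_over R (R_Mod R) prec M"
    assume "\<not> |?S| \<le>o \<kappa>"
    then have "\<kappa> <o |?S|"
      using not_ordLeq_iff_ordLess[OF card_order_on_well_order_on[OF co] card_of_Well_order] by blast
    then have le: "cardSuc \<kappa> \<le>o |?S|" by (rule cardSuc_least[OF co card_of_Card_order])
    \<comment> \<open>A copy of \<open>\<kappa>^+\<close> on the universe type, whose field can
      index the family to be amalgamated.\<close>
    obtain \<nu> :: "'u rel" where \<nu>: "infinite_cardinal \<nu>" "regularCard \<nu>" "\<nu> =o cardSuc \<kappa>"
      using exists_successor_cardinal[OF SI \<kappa>(1)] .
    have \<nu>co: "Card_order \<nu>" "\<nu> <o |UNIV :: 'u set|" "infinite (Field \<nu>)"
      using \<nu>(1) by (auto simp: infinite_cardinal_def cardinal_def cinfinite_def)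
    let ?I = "Field \<nu>"
    have I: "|?I| =o \<nu>" by (rule card_of_Field_ordIso[OF \<nu>co(1)])
    have small_I: "small ?I" unfolding small_def by (rule ordIso_ordLess_trans[OF I \<nu>co(2)])
    have "|?I| \<le>o |?S|" by (rule ordIso_ordLeq_trans[OF ordIso_transitive[OF I \<nu>(3)] le])
    then obtain t where t: "inj_on t ?I" "t ` ?I \<subseteq> ?S" using card_of_ordLeq by metis
    have "\<exists>N b. prec M N \<and> b \<in> carrier N \<and> t i = ortp R (R_Mod R) prec b (carrier M) N" if "i \<in> ?I" for i
      using t(2) that unfolding types_over_def types_in_def by blast
    then obtain F b where F: "\<And>i. i \<in> ?I \<Longrightarrow> prec M (F i)" "\<And>i. i \<in> ?I \<Longrightarrow> b i \<in> carrier (F i)"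
      "\<And>i. i \<in> ?I \<Longrightarrow> t i = ortp R (R_Mod R) prec (b i) (carrier M) (F i)" by metis
    have "?I \<noteq> {}" using \<nu>co(3) by auto
    have "\<exists>N. N \<in> R_Mod R \<and> is_submodule R M N \<and>
      (\<forall>i\<in>?I. ortp R (R_Mod R) prec (b i) (carrier M) (F i) \<in> types_in R (R_Mod R) prec M N)"
      by (rule exists_extension_realizing[OF AP small_I \<open>?I \<noteq> {}\<close> M(1)]) (use F(1,2) in simp_all)
    then obtain N where N: "N \<in> R_Mod R" "is_submodule R M N"
      "\<forall>i\<in>?I. ortp R (R_Mod R) prec (b i) (carrier M) (F i) \<in> types_in R (R_Mod R) prec M N"
      by (elim exE conjE)
    have "t ` ?I \<subseteq> types_in R (R_Mod R) prec M N" using N(3) F(3) by auto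
    then have "|?I| \<le>o |types_in R (R_Mod R) prec M N|" 
      using card_of_ordLeq[of ?I "types_in R (R_Mod R) prec M N"] t(1) by metis
    moreover have "|types_in R (R_Mod R) prec M N| \<le>o \<kappa>" using \<kappa>(3) N(1,2) M(2) by simp
    ultimately have "|?I| \<le>o \<kappa>" by (rule ordLeq_transitive)
    from ordIso_ordLeq_trans[OF ordIso_symmetric[OF ordIso_transitive[OF I \<nu>(3)]] this]
    have "cardSuc \<kappa> \<le>o \<kappa>" .
    then show False using cardSuc_greater[OF co] not_ordLess_ordLeq by blast
  qed
  then show "\<exists>\<kappa> :: 'u rel. infinite_cardinal \<kappa> \<and> \<alpha> \<le>o \<kappa> \<and>
           (\<forall>M\<in>R_Mod R. |carrier M| =o \<kappa> \<longrightarrow> |types_over R (R_Mod R) prec M| \<le>o \<kappa>)"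
    using \<kappa>(1,2) by (intro exI[of _ \<kappa>]) simp
qed

end

lemma exists_pure_admissible_relation:
  assumes SI: "strongly_inaccessible |UNIV :: 'u set|" and R: "ring R"
    and R_small: "|carrier R| <o |UNIV :: 'u set|"
    and prec: "(prec :: ('r, 'u) module \<Rightarrow> _) \<in> admissible_relations R"
  shows "\<exists>\<mu> \<theta> lam. pure_admissible_relation R prec \<mu> \<theta> lam"
proof -
  obtain \<mu> \<theta> where 1: "admissible_relation R prec \<mu> \<theta>"
    using admissible_relation_obtain[OF SI R prec] by blast
  obtain lam :: "'u rel" where 2: "infinite_cardinal lam" "\<And>A B. pp_pure R lam A B \<Longrightarrow> prec A B"
    using pp_pure_cofinal[OF SI R prec] by metis
  have "pure_admissible_relation R prec \<mu> \<theta> lam"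
    by (rule pure_admissible_relation.intro[OF 1 pure_admissible_relation_axioms.intro[OF R_small 2]])
  then show ?thesis by blast
qed

theorem theorem5:
  fixes R :: "('r, 'x) ring_scheme"
  assumes "strongly_inaccessible |UNIV :: 'u set|"
    and "ring R"
    and "|carrier R| <o |UNIV :: 'u set|"
  shows
    "(\<forall>lam :: 'u rel. infinite_cardinal lam \<longrightarrow> pp_pure R lam \<in> admissible_relations R) \<and>
     (\<forall>prec \<in> admissible_relations R. \<exists>lam :: 'u rel. infinite_cardinal lam \<and>
        (\<forall>A\<in>R_Mod R. \<forall>B\<in>R_Mod R. pp_pure R lam A B \<longrightarrow> prec A B)) \<and>
     (\<forall>prec :: ('r, 'u) module \<Rightarrow> ('r, 'u) module \<Rightarrow> bool. prec \<in> admissible_relations R \<longrightarrow>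
        almost_stable_class R (R_Mod R) prec \<and>
        (infinity_AP R (R_Mod R) prec \<longrightarrow> stable_class R (R_Mod R) prec))"
proof (intro conjI allI impI ballI)
  show "pp_pure R lam \<in> admissible_relations R" if "infinite_cardinal lam" for lam :: "'u rel"
    by (rule pp_pure_admissible[OF assms that])
next
  fix prec :: "('r, 'u) module \<Rightarrow> ('r, 'u) module \<Rightarrow> bool"
  assume "prec \<in> admissible_relations R"
  from pp_pure_cofinal[OF assms(1,2) this]
  show "\<exists>lam :: 'u rel. infinite_cardinal lam \<and>
      (\<forall>A\<in>R_Mod R. \<forall>B\<in>R_Mod R. pp_pure R lam A B \<longrightarrow> prec A B)" by metis
next
  fix prec :: "('r, 'u) module \<Rightarrow> ('r, 'u) module \<Rightarrow> bool"
  assume "prec \<in> admissible_relations R"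
  from exists_pure_admissible_relation[OF assms this]
  obtain \<mu> \<theta> lam where "pure_admissible_relation R prec \<mu> \<theta> lam" by (elim exE)
  then interpret pure_admissible_relation R prec \<mu> \<theta> lam .
  show "almost_stable_class R (R_Mod R) prec" by (rule almost_stable)
  show "stable_class R (R_Mod R) prec" if "infinity_AP R (R_Mod R) prec" by (rule stable[OF that])
qed

end
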